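(* For $f_1,\dots,f_4\in L^2(\mathbb{R}\to\mathbb{C})$ there hold the representations $$\mathcal{E}_4(f_1,f_2,f_3,f_4)=\frac{1}{2\sqrt{2}\,\pi^2}\int_0^{2\pi}E_{S(\theta)}(G,f_1,f_2,G,f_3,f_4)\,d\theta,$$ $$\mathcal{T}_4(f_1,f_2,f_3)(x)=\frac{\sqrt{2}}{\pi^2}\int_0^{2\pi}T_{S(\theta)}(G,f_1,f_2,G,f_3)(x)\,d\theta,$$ where $G(x)=e^{-x^2/2}$ and $S(\theta)$ is the rotation of $\mathbb{R}^3$ by $\theta$ radians about the axis $(0,1,1)$.
   Context: $H=-\Delta+x^2$ on $L^2(\mathbb{R})$, and $e^{itH}$ is the unitary propagator of $iu_t+Hu=0$ (so $e^{itH}\phi_n=e^{it(2n+1)}\phi_n$ for the Hermite functions $\phi_n$, $H\phi_n=(2n+1)\phi_n$). Define $$\mathcal{E}_4(f_1,f_2,f_3,f_4)=\frac{2}{\pi}\int_0^{\pi/2}\int_{\mathbb{R}}(e^{itH}f_1)(e^{itH}f_2)\overline{(e^{itH}f_3)(e^{itH}f_4)}\,dx\,dt,$$ and $\mathcal{T}_4:(L^2)^3\to L^2$ by duality: $\langle\mathcal{T}_4(f_1,f_2,f_3),g\rangle_{L^2}=4\,\mathcal{E}_4(f_1,f_2,f_3,g)$, with $\langle f,g\rangle_{L^2}=\int f\overline{g}\,dx$. For a linear isometry $A:\mathbb{R}^3\to\mathbb{R}^3$, with $(Ax)_k=\langle Ax,e_k\rangle$, $$E_A(f_1,\dots,f_6)=\int_{\mathbb{R}^3}f_1((Ax)_1)f_2((Ax)_2)f_3((Ax)_3)\overline{f_4(x_1)f_5(x_2)f_6(x_3)}\,dx_1dx_2dx_3,$$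 and $T_A$ is defined by duality: $\langle T_A(f_1,\dots,f_5),g\rangle_{L^2}=E_A(f_1,\dots,f_5,g)$. *)

theory Defs
  imports "HOL-Analysis.Analysis" "HOL-Computational_Algebra.Polynomial"
begin

section \<open>The space L2 of the line\<close>

text \<open>
  Elements of \<open>L\<^sup>2(\<real> \<rightarrow> \<complex>)\<close> are represented by Borel functions (every class of Lebesgue measurable
  functions contains one); equality in \<open>L\<^sup>2\<close> is equality almost everywhere.
\<close>

definition L2 :: "(real \<Rightarrow> complex) set" where
  "L2 = {f \<in> borel_measurable lborel. integrable lborel (\<lambda>x. (cmod (f x))\<^sup>2)}"

definition L2_inner :: "(real \<Rightarrow> complex) \<Rightarrow> (real \<Rightarrow> complex) \<Rightarrow> complex" where
  "L2_inner f g = (LINT x|lborel. f x * cnj (g x))"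

definition L2_norm :: "(real \<Rightarrow> complex) \<Rightarrow> real" where
  "L2_norm f = sqrt (LINT x|lborel. (cmod (f x))\<^sup>2)"

text \<open>
  A functional \<open>\<Phi>\<close> on \<open>L2\<close> is represented by \<open>h\<close> if \<open>\<langle>h, g\<rangle> = \<Phi> g\<close> for all \<open>g\<close>; such an \<open>h\<close> is
  unique up to null sets, and \<open>by_duality \<Phi>\<close> picks one (it is meaningful only if one exists).
\<close>

definition represents :: "(real \<Rightarrow> complex) \<Rightarrow> ((real \<Rightarrow> complex) \<Rightarrow> complex) \<Rightarrow> bool" where
  "represents h \<Phi> \<longleftrightarrow> h \<in> L2 \<and> (\<forall>g\<in>L2. L2_inner h g = \<Phi> g)"

definition by_duality :: "((real \<Rightarrow> complex) \<Rightarrow> complex) \<Rightarrow> real \<Rightarrow> complex" where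
  "by_duality \<Phi> = (SOME h. represents h \<Phi>)"

section \<open>The harmonic oscillator and its propagator\<close>

text \<open>Physicists' Hermite polynomials: \<open>h\<^sub>0 = 1\<close>, \<open>h\<^sub>n\<^sub>+\<^sub>1 = 2 x h\<^sub>n - h\<^sub>n'\<close>.\<close>

fun hermite_poly :: "nat \<Rightarrow> real poly" where
  "hermite_poly 0 = 1"
| "hermite_poly (Suc n) = [:0, 2:] * hermite_poly n - pderiv (hermite_poly n)"

definition hermite_fun :: "nat \<Rightarrow> real \<Rightarrow> real" where
  "hermite_fun n x = poly (hermite_poly n) x * exp (- x\<^sup>2 / 2) / sqrt (2 ^ n * fact n * sqrt pi)"

definition harmonic_oscillator :: "(real \<Rightarrow> real) \<Rightarrow> real \<Rightarrow> real" where
  "harmonic_oscillator f x = - deriv (deriv f) x + x\<^sup>2 * f x"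

lemma pderiv_hermite_poly: "pderiv (hermite_poly (Suc n)) = smult (2 * real (Suc n)) (hermite_poly n)"
proof (induction n)
  case 0
  show ?case by (simp add: pderiv_pCons one_pCons)
next
  case (Suc n)
  let ?h = "hermite_poly (Suc n)"
  have "pderiv (hermite_poly (Suc (Suc n))) =
      smult 2 ?h + [:0, 2:] * pderiv ?h - pderiv (pderiv ?h)"
    by (simp add: pderiv_mult pderiv_diff pderiv_pCons del: mult_pCons_left)
  also have "\<dots> = smult 2 ?h + smult (2 * real (Suc n)) ([:0, 2:] * hermite_poly n - pderiv (hermite_poly n))"
    unfolding Suc.IH pderiv_smult by (simp add: smult_diff_right del: mult_pCons_left)
  also have "\<dots> = smult (2 + 2 * real (Suc n)) ?h"
    by (simp only: hermite_poly.simps smult_add_left)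
  finally show ?case by (simp add: algebra_simps)
qed

lemma hermite_ode:
  "poly (pderiv (pderiv (hermite_poly n))) x
     = 2 * x * poly (pderiv (hermite_poly n)) x - 2 * real n * poly (hermite_poly n) x"
proof (cases n)
  case (Suc m)
  then show ?thesis
    by (simp add: pderiv_hermite_poly pderiv_smult algebra_simps
             del: hermite_poly.simps) (simp add: algebra_simps)
qed (simp add: one_pCons)

lemma harmonic_oscillator_hermite_fun:
  "harmonic_oscillator (hermite_fun n) x = (2 * real n + 1) * hermite_fun n x"
proof -
  define c where "c = sqrt (2 ^ n * fact n * sqrt pi)"
  have c: "c > 0" by (simp add: c_def)
  let ?p = "hermite_poly n"
  have gen: "((\<lambda>x. poly q x * exp (- x\<^sup>2 / 2) / c) has_real_derivative
      poly (pderiv q - [:0, 1:] * q) x * exp (- x\<^sup>2 / 2) / c) (at x)" for q x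
    using c by (auto intro!: derivative_eq_intros poly_DERIV simp: field_simps)
  have f: "hermite_fun n = (\<lambda>x. poly ?p x * exp (- x\<^sup>2 / 2) / c)"
    by (simp add: hermite_fun_def fun_eq_iff c_def)
  have d1: "deriv (hermite_fun n) = (\<lambda>x. poly (pderiv ?p - [:0, 1:] * ?p) x * exp (- x\<^sup>2 / 2) / c)"
    unfolding f using gen DERIV_imp_deriv by (intro ext) blast
  have d2: "deriv (deriv (hermite_fun n)) x =
     poly (pderiv (pderiv ?p - [:0, 1:] * ?p) - [:0, 1:] * (pderiv ?p - [:0, 1:] * ?p)) x
       * exp (- x\<^sup>2 / 2) / c"
    unfolding d1 using gen DERIV_imp_deriv by blast
  show ?thesis
    unfolding harmonic_oscillator_def d2 unfolding f using c
    by (simp add: pderiv_diff pderiv_mult pderiv_pCons hermite_ode divide_simps)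
       (simp add: algebra_simps power2_eq_square)
qed

definition hermite :: "nat \<Rightarrow> real \<Rightarrow> complex" where
  "hermite n x = complex_of_real (hermite_fun n x)"

definition propagator_partial :: "nat \<Rightarrow> real \<Rightarrow> (real \<Rightarrow> complex) \<Rightarrow> real \<Rightarrow> complex" where
  "propagator_partial N t f x =
     (\<Sum>n<N. exp (\<i> * of_real (t * (2 * real n + 1))) * L2_inner f (hermite n) * hermite n x)"

text \<open>
  \<open>e\<^sup>i\<^sup>t\<^sup>H f\<close>, by the spectral resolution of \<open>H = - \<Delta> + x\<^sup>2\<close>: the \<open>L\<^sup>2\<close> limit of the phase-rotated
  Hermite expansion of \<open>f\<close>.  The representative is arbitrary on null sets (separately for each \<open>t\<close>).
\<close>

definition propagator :: "real \<Rightarrow> (real \<Rightarrow> complex) \<Rightarrow> real \<Rightarrow> complex" where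
  "propagator t f = (SOME u. u \<in> L2 \<and>
     (\<lambda>N. L2_norm (\<lambda>x. u x - propagator_partial N t f x)) \<longlonglongrightarrow> 0)"

section \<open>The quartic functional and its operator\<close>

definition E4_density ::
  "(real \<Rightarrow> complex) \<Rightarrow> (real \<Rightarrow> complex) \<Rightarrow> (real \<Rightarrow> complex) \<Rightarrow> (real \<Rightarrow> complex) \<Rightarrow> real \<Rightarrow> real \<Rightarrow> complex"
where
  "E4_density f1 f2 f3 f4 t x =
     propagator t f1 x * propagator t f2 x * cnj (propagator t f3 x * propagator t f4 x)"

text \<open>
  Since the integrals are iterated, neither notion below depends on the representatives chosen by
  \<open>propagator\<close>.
\<close>

definition E4 ::
  "(real \<Rightarrow> complex) \<Rightarrow> (real \<Rightarrow> complex) \<Rightarrow> (real \<Rightarrow> complex) \<Rightarrow> (real \<Rightarrow> complex) \<Rightarrow> complex"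
where
  "E4 f1 f2 f3 f4 =
     of_real (2 / pi) * (LINT t:{0..pi/2}|lborel. LINT x|lborel. E4_density f1 f2 f3 f4 t x)"

definition E4_converges ::
  "(real \<Rightarrow> complex) \<Rightarrow> (real \<Rightarrow> complex) \<Rightarrow> (real \<Rightarrow> complex) \<Rightarrow> (real \<Rightarrow> complex) \<Rightarrow> bool"
where
  "E4_converges f1 f2 f3 f4 \<longleftrightarrow>
     (AE t in lborel. t \<in> {0..pi/2} \<longrightarrow> integrable lborel (E4_density f1 f2 f3 f4 t)) \<and>
     set_integrable lborel {0..pi/2} (\<lambda>t. LINT x|lborel. E4_density f1 f2 f3 f4 t x)"

definition T4 ::
  "(real \<Rightarrow> complex) \<Rightarrow> (real \<Rightarrow> complex) \<Rightarrow> (real \<Rightarrow> complex) \<Rightarrow> real \<Rightarrow> complex"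
where
  "T4 f1 f2 f3 = by_duality (\<lambda>g. 4 * E4 f1 f2 f3 g)"

section \<open>The functionals attached to isometries of three-space\<close>

definition E_density ::
  "(real^3 \<Rightarrow> real^3) \<Rightarrow> (real \<Rightarrow> complex) \<Rightarrow> (real \<Rightarrow> complex) \<Rightarrow> (real \<Rightarrow> complex) \<Rightarrow>
     (real \<Rightarrow> complex) \<Rightarrow> (real \<Rightarrow> complex) \<Rightarrow> (real \<Rightarrow> complex) \<Rightarrow> real^3 \<Rightarrow> complex"
where
  "E_density A f1 f2 f3 f4 f5 f6 x =
     f1 (A x $ 1) * f2 (A x $ 2) * f3 (A x $ 3) * cnj (f4 (x $ 1) * f5 (x $ 2) * f6 (x $ 3))"

definition E_iso ::
  "(real^3 \<Rightarrow> real^3) \<Rightarrow> (real \<Rightarrow> complex) \<Rightarrow> (real \<Rightarrow> complex) \<Rightarrow> (real \<Rightarrow> complex) \<Rightarrow>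
     (real \<Rightarrow> complex) \<Rightarrow> (real \<Rightarrow> complex) \<Rightarrow> (real \<Rightarrow> complex) \<Rightarrow> complex"
where
  "E_iso A f1 f2 f3 f4 f5 f6 = (LINT x|lborel. E_density A f1 f2 f3 f4 f5 f6 x)"

definition T_iso ::
  "(real^3 \<Rightarrow> real^3) \<Rightarrow> (real \<Rightarrow> complex) \<Rightarrow> (real \<Rightarrow> complex) \<Rightarrow> (real \<Rightarrow> complex) \<Rightarrow>
     (real \<Rightarrow> complex) \<Rightarrow> (real \<Rightarrow> complex) \<Rightarrow> real \<Rightarrow> complex"
where
  "T_iso A f1 f2 f3 f4 f5 = by_duality (\<lambda>g. E_iso A f1 f2 f3 f4 f5 g)"

definition gaussian :: "real \<Rightarrow> complex" where
  "gaussian x = of_real (exp (- x\<^sup>2 / 2))"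

text \<open>Rodrigues' formula: the right-handed rotation by \<open>\<theta>\<close> about the axis spanned by \<open>v\<close>.\<close>

definition rotation_about :: "real^3 \<Rightarrow> real \<Rightarrow> real^3 \<Rightarrow> real^3" where
  "rotation_about v \<theta> x =
     (let k = sgn v in cos \<theta> *\<^sub>R x + sin \<theta> *\<^sub>R cross3 k x + ((1 - cos \<theta>) * (k \<bullet> x)) *\<^sub>R k)"

definition S_rot :: "real \<Rightarrow> real^3 \<Rightarrow> real^3" where
  "S_rot \<theta> = rotation_about (vector [0, 1, 1]) \<theta>"

lemma orthogonal_transformation_rotation_about:
  assumes "v \<noteq> 0"
  shows "orthogonal_transformation (rotation_about v \<theta>)"
proof -
  define k where "k = sgn v"
  have kk: "k \<bullet> k = 1" using assms by (simp add: k_def dot_square_norm norm_sgn)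
  have R: "rotation_about v \<theta> x =
      cos \<theta> *\<^sub>R x + sin \<theta> *\<^sub>R cross3 k x + ((1 - cos \<theta>) * (k \<bullet> x)) *\<^sub>R k" for x
    by (simp add: rotation_about_def k_def Let_def)
  have lin: "linear (rotation_about v \<theta>)"
    unfolding R[abs_def]
    by (intro linearI)
       (simp_all add: cross_add_right cross_mult_right algebra_simps)
  have "norm (rotation_about v \<theta> x) = norm x" for x
  proof -
    have n: "cross3 k x \<bullet> cross3 k x = x \<bullet> x - (k \<bullet> x)\<^sup>2"
      using norm_cross_dot[of k x] kk by (simp add: power_mult_distrib power2_norm_eq_inner)
    have z: "x \<bullet> cross3 k x = 0" "k \<bullet> cross3 k x = 0" "cross3 k x \<bullet> x = 0" "cross3 k x \<bullet> k = 0"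
      by (simp_all add: dot_cross_self)
    have "rotation_about v \<theta> x \<bullet> rotation_about v \<theta> x =
        (cos \<theta>)\<^sup>2 * (x \<bullet> x) + (sin \<theta>)\<^sup>2 * (x \<bullet> x - (k \<bullet> x)\<^sup>2)
        + 2 * cos \<theta> * (1 - cos \<theta>) * (k \<bullet> x)\<^sup>2 + (1 - cos \<theta>)\<^sup>2 * (k \<bullet> x)\<^sup>2"
      unfolding R by (simp add: inner_add_left inner_add_right z n kk inner_commute[of x k])
        (simp add: algebra_simps power2_eq_square)
    also have "\<dots> = x \<bullet> x"
      unfolding sin_squared_eq by (simp add: algebra_simps power2_eq_square)
    finally show ?thesis by (simp add: norm_eq)
  qed
  then show ?thesis using lin by (simp add: orthogonal_transformation)
qed

lemma orthogonal_transformation_S_rot: "orthogonal_transformation (S_rot \<theta>)"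
proof -
  have "(vector [0, 1, 1] :: real^3) \<noteq> 0"
    by (simp add: vec_eq_iff forall_3)
  then show ?thesis
    unfolding S_rot_def by (rule orthogonal_transformation_rotation_about)
qed

lemma S_rot_axis: "S_rot \<theta> (vector [0, 1, 1]) = vector [0, 1, 1]"
proof -
  define v :: "real^3" where "v = vector [0, 1, 1]"
  have "sgn v \<bullet> v = norm v"
    by (cases "v = 0") (simp_all add: sgn_div_norm dot_square_norm power2_eq_square)
  moreover have "cross3 (sgn v) v = 0"
    by (simp add: sgn_div_norm cross_mult_left)
  moreover have "norm v *\<^sub>R sgn v = v"
    by (cases "v = 0") (simp_all add: sgn_div_norm)
  ultimately have "rotation_about v \<theta> v = cos \<theta> *\<^sub>R v + (1 - cos \<theta>) *\<^sub>R v"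
    by (simp add: rotation_about_def Let_def flip: scaleR_scaleR)
  then show ?thesis by (simp add: S_rot_def v_def algebra_simps)
qed

section \<open>Integrating families of L2 functions\<close>

text \<open>
  Each \<open>F \<theta>\<close> is only determined almost everywhere, so \<open>\<integral> F \<theta> x d\<theta>\<close> is meaningful only for a choice
  of representatives \<open>K \<theta>\<close> that is measurable in \<open>(\<theta>, x)\<close> jointly.
\<close>

definition measurable_version ::
  "real set \<Rightarrow> (real \<Rightarrow> real \<Rightarrow> complex) \<Rightarrow> (real \<Rightarrow> real \<Rightarrow> complex) \<Rightarrow> bool"
where
  "measurable_version I F K \<longleftrightarrow>
     (\<lambda>(\<theta>, x). K \<theta> x) \<in> borel_measurable (lborel \<Otimes>\<^sub>M lborel) \<and>
     (\<forall>\<theta>\<in>I. AE x in lborel. K \<theta> x = F \<theta> x)"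

end

theory Submission
  imports Defs "HOL-Probability.Levy" "HOL-Real_Asymp.Real_Asymp"
begin

text \<open>
  The propagator maps the coherent state \<open>exp (- x\<^sup>2 / 2 + 2 s x - s\<^sup>2)\<close> to \<open>e\<^sup>i\<^sup>t\<close> times the coherent
  state with parameter \<open>e\<^sup>2\<^sup>i\<^sup>t s\<close>.  On coherent states both sides of the first representation are
  Gaussian integrals: with \<open>m = s\<^sub>1 - s\<^sub>2\<close> and \<open>n = s\<^sub>3 - s\<^sub>4\<close> (the last two conjugated) they reduce, up to
  a common factor, to the means over the circle of \<open>exp (- (m\<^sup>2 z + n\<^sup>2 / z) / 2)\<close> and of
  \<open>exp (m n (z + 1 / z) / 2)\<close>.  The mean of \<open>exp (a z + b / z)\<close> depends on \<open>a b\<close> only, so they agree.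

  The right-hand side is bounded on \<open>L\<^sup>2\<close> because rotations preserve the norm of \<open>L\<^sup>2(\<real>\<^sup>3)\<close>; applied to
  linear combinations \<open>f\<close> of coherent states, the identity therefore yields the Strichartz bound of
  \<open>e\<^sup>i\<^sup>t\<^sup>H f\<close> in \<open>L\<^sup>4\<close> of space-time.  As these combinations are dense, both sides extend to \<open>L\<^sup>2\<close> along
  rapidly convergent, hence dominated, sequences.  The operator identity follows by Fubini's theorem
  from an explicit integral kernel.
\<close>

section \<open>Square-integrable functions\<close>

text \<open>A product of four functions in L^2 of the line need not be integrable, and
  \<open>propagator\<close> fixes a representative only up to a null set at each time separately, so
  neither convergence nor joint measurability of the quartic integrand is available at the outset.
  Both come from explicit flows: a coherent state is the Gaussian times the generating function of
  the Hermite polynomials, its n-th Hermite coefficient is a constant times s^n, and the phase of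
  the n-th mode, e^(it) (e^(2it))^n, is therefore absorbed into the parameter s. Rotating s through
  e^(2it) makes the quadratic exponents depend on e^(4it), so that [0, pi/2] covers the circle
  exactly once. The constant of the representation comes from 2/pi, the factor 1/4 of this
  substitution, sqrt(pi/2) from the integral of e^(-2x^2) on the line, and pi^(3/2) from that of
  e^(-|x|^2) on R^3. Approximants with squared error 8^(-k) leave room for both weights in the
  limit: 4^k in L^2, and 16^k in L^4, where the Strichartz bound is quadratic in the squared norm
  and yields a multiple of 64^(-k).\<close>

definition Lsp :: "nat \<Rightarrow> 'a measure \<Rightarrow> ('a \<Rightarrow> complex) set" where
  "Lsp p M = {f \<in> borel_measurable M. integrable M (\<lambda>x. cmod (f x) ^ p)}"

lemma L2_eq_Lsp: "L2 = Lsp 2 lborel"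
  by (simp add: L2_def Lsp_def)

lemma Lsp_measurable: "f \<in> Lsp p M \<Longrightarrow> f \<in> borel_measurable M"
  and Lsp_integrable: "f \<in> Lsp p M \<Longrightarrow> integrable M (\<lambda>x. cmod (f x) ^ p)"
  by (auto simp: Lsp_def)

lemma add_power_le:
  fixes a b :: real
  assumes "0 \<le> a" "0 \<le> b"
  shows "(a + b) ^ p \<le> 2 ^ p * (a ^ p + b ^ p)"
proof -
  have "(a + b) ^ p \<le> (2 * max a b) ^ p"
    using assms by (intro power_mono) auto
  also have "\<dots> = 2 ^ p * max a b ^ p" by (simp add: power_mult_distrib)
  also have "\<dots> \<le> 2 ^ p * (a ^ p + b ^ p)"
    using assms by (intro mult_left_mono) (auto simp: max_def)
  finally show ?thesis .
qed

lemma Lsp_lincomb: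
  assumes "f \<in> Lsp p M" "g \<in> Lsp p M"
  shows "(\<lambda>x. a * f x + b * g x) \<in> Lsp p M"
proof -
  have [measurable]: "f \<in> borel_measurable M" "g \<in> borel_measurable M"
    using assms by (auto simp: Lsp_def)
  have "integrable M (\<lambda>x. 2 ^ p * (cmod a ^ p * cmod (f x) ^ p + cmod b ^ p * cmod (g x) ^ p))"
    using assms by (auto simp: Lsp_def)
  then have "integrable M (\<lambda>x. cmod (a * f x + b * g x) ^ p)"
  proof (rule Bochner_Integration.integrable_bound)
    show "AE x in M. norm (cmod (a * f x + b * g x) ^ p)
        \<le> norm (2 ^ p * (cmod a ^ p * cmod (f x) ^ p + cmod b ^ p * cmod (g x) ^ p))"
    proof (rule AE_I2)
      fix x
      have "cmod (a * f x + b * g x) ^ p \<le> (cmod (a * f x) + cmod (b * g x)) ^ p"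
        by (intro power_mono norm_triangle_ineq) auto
      also have "\<dots> \<le> 2 ^ p * (cmod (a * f x) ^ p + cmod (b * g x) ^ p)"
        by (rule add_power_le) auto
      finally show "norm (cmod (a * f x + b * g x) ^ p)
        \<le> norm (2 ^ p * (cmod a ^ p * cmod (f x) ^ p + cmod b ^ p * cmod (g x) ^ p))"
        by (simp add: norm_mult power_mult_distrib)
    qed
  qed measurable
  then show ?thesis by (simp add: Lsp_def)
qed

lemma Lsp_scale: "f \<in> Lsp p M \<Longrightarrow> (\<lambda>x. a * f x) \<in> Lsp p M"
  using Lsp_lincomb[of f p M f a 0] by simp

lemma Lsp_add: "f \<in> Lsp p M \<Longrightarrow> g \<in> Lsp p M \<Longrightarrow> (\<lambda>x. f x + g x) \<in> Lsp p M"
  using Lsp_lincomb[of f p M g 1 1] by simp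

lemma Lsp_diff: "f \<in> Lsp p M \<Longrightarrow> g \<in> Lsp p M \<Longrightarrow> (\<lambda>x. f x - g x) \<in> Lsp p M"
  using Lsp_lincomb[of f p M g 1 "-1"] by simp

lemma borel_measurable_cnj [measurable (raw)]:
  "f \<in> borel_measurable M \<Longrightarrow> (\<lambda>x. cnj (f x)) \<in> borel_measurable M"
  by (rule borel_measurable_continuous_on) (auto intro: continuous_intros)

lemma Lsp_cnj: "f \<in> Lsp p M \<Longrightarrow> (\<lambda>x. cnj (f x)) \<in> Lsp p M"
  by (auto simp: Lsp_def intro: borel_measurable_cnj)

lemma Lsp_zero: "p > 0 \<Longrightarrow> (\<lambda>x. 0) \<in> Lsp p M"
  by (simp add: Lsp_def power_0_left)

lemma Lsp_sum:
  "p > 0 \<Longrightarrow> (\<And>i. i \<in> I \<Longrightarrow> f i \<in> Lsp p M) \<Longrightarrow> (\<lambda>x. \<Sum>i\<in>I. f i x) \<in> Lsp p M"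
  by (induction I rule: infinite_finite_induct) (auto simp: Lsp_zero intro: Lsp_add)

lemma Lsp_bound:
  assumes "g \<in> Lsp p M" "f \<in> borel_measurable M" "AE x in M. cmod (f x) \<le> cmod (g x)"
  shows "f \<in> Lsp p M"
proof -
  have "integrable M (\<lambda>x. cmod (f x) ^ p)"
    using Lsp_integrable[OF assms(1)]
    by (rule Bochner_Integration.integrable_bound) (use assms in \<open>auto intro: power_mono elim!: eventually_mono\<close>)
  then show ?thesis using assms by (simp add: Lsp_def)
qed

section \<open>Integrability of products and the Cauchy-Schwarz inequality\<close>

lemma two_mult_le_squares: "2 * (a * b) \<le> a\<^sup>2 + (b::real)\<^sup>2"
  using zero_le_power2[of "a - b"] by (simp add: power2_diff)

lemma mult_le_squares: "0 \<le> a * b \<Longrightarrow> a * b \<le> a\<^sup>2 + (b::real)\<^sup>2"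
  using two_mult_le_squares[of a b] by linarith

lemma integrable_mult_L2:
  assumes "f \<in> Lsp 2 M" "g \<in> Lsp 2 M"
  shows "integrable M (\<lambda>x. f x * g x)"
proof -
  have [measurable]: "f \<in> borel_measurable M" "g \<in> borel_measurable M"
    using assms by (auto simp: Lsp_def)
  have "integrable M (\<lambda>x. (cmod (f x))\<^sup>2 + (cmod (g x))\<^sup>2)"
    using assms by (auto simp: Lsp_def)
  then show ?thesis
  proof (rule Bochner_Integration.integrable_bound)
    show "AE x in M. norm (f x * g x) \<le> norm ((cmod (f x))\<^sup>2 + (cmod (g x))\<^sup>2)"
    proof (rule AE_I2)
      fix x
      show "norm (f x * g x) \<le> norm ((cmod (f x))\<^sup>2 + (cmod (g x))\<^sup>2)"
        using mult_le_squares[of "cmod (f x)" "cmod (g x)"] by (simp add: norm_mult)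
    qed
  qed measurable
qed

text \<open>Two rounds of 2ab \<le> a^2 + b^2: a pointwise substitute for the Hoelder inequality
  with four exponents 4.\<close>

lemma four_mult_le:
  fixes a b c d :: real
  assumes "0 \<le> a" "0 \<le> b" "0 \<le> c" "0 \<le> d"
  shows "a * b * (c * d) \<le> a ^ 4 + b ^ 4 + c ^ 4 + d ^ 4"
proof -
  have "2 * (a * b * (c * d)) \<le> (a * b)\<^sup>2 + (c * d)\<^sup>2"
    by (rule two_mult_le_squares)
  moreover have "2 * (a\<^sup>2 * b\<^sup>2) \<le> (a\<^sup>2)\<^sup>2 + (b\<^sup>2)\<^sup>2" "2 * (c\<^sup>2 * d\<^sup>2) \<le> (c\<^sup>2)\<^sup>2 + (d\<^sup>2)\<^sup>2"
    by (rule two_mult_le_squares)+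
  ultimately show ?thesis
    using assms by (simp add: power_mult_distrib power_mult[symmetric])
      (smt (verit) mult_nonneg_nonneg zero_le_power)
qed

lemma integrable_mult_L4:
  assumes "f1 \<in> Lsp 4 M" "f2 \<in> Lsp 4 M" "f3 \<in> Lsp 4 M" "f4 \<in> Lsp 4 M"
  shows "integrable M (\<lambda>x. f1 x * f2 x * cnj (f3 x * f4 x))"
proof -
  have [measurable]: "f1 \<in> borel_measurable M" "f2 \<in> borel_measurable M"
     "f3 \<in> borel_measurable M" "f4 \<in> borel_measurable M"
    using assms by (auto simp: Lsp_def)
  have "integrable M (\<lambda>x. cmod (f1 x) ^ 4 + cmod (f2 x) ^ 4 + cmod (f3 x) ^ 4 + cmod (f4 x) ^ 4)"
    using assms by (auto simp: Lsp_def)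
  then show ?thesis
  proof (rule Bochner_Integration.integrable_bound)
    show "AE x in M. norm (f1 x * f2 x * cnj (f3 x * f4 x)) \<le>
        norm (cmod (f1 x) ^ 4 + cmod (f2 x) ^ 4 + cmod (f3 x) ^ 4 + cmod (f4 x) ^ 4)"
    proof (rule AE_I2)
      fix x
      show "norm (f1 x * f2 x * cnj (f3 x * f4 x)) \<le>
        norm (cmod (f1 x) ^ 4 + cmod (f2 x) ^ 4 + cmod (f3 x) ^ 4 + cmod (f4 x) ^ 4)"
        using four_mult_le[of "cmod (f1 x)" "cmod (f2 x)" "cmod (f3 x)" "cmod (f4 x)"]
        by (simp add: norm_mult)
    qed
  qed measurable
qed

lemma Cauchy_Schwarz_Lsp:
  assumes "f \<in> Lsp 2 M" "g \<in> Lsp 2 M"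
  shows "(cmod (\<integral>x. f x * g x \<partial>M))\<^sup>2 \<le> (\<integral>x. (cmod (f x))\<^sup>2 \<partial>M) * (\<integral>x. (cmod (g x))\<^sup>2 \<partial>M)"
proof -
  have [measurable]: "f \<in> borel_measurable M" "g \<in> borel_measurable M"
    using assms by (auto simp: Lsp_def)
  have i: "integrable M (\<lambda>x. (cmod (f x))\<^sup>2)" "integrable M (\<lambda>x. (cmod (g x))\<^sup>2)"
    using assms by (auto simp: Lsp_def)
  have "ennreal ((cmod (\<integral>x. f x * g x \<partial>M))\<^sup>2) = (ennreal (cmod (\<integral>x. f x * g x \<partial>M)))\<^sup>2"
    by (simp add: ennreal_power)
  also have "\<dots> \<le> (\<integral>\<^sup>+x. ennreal (cmod (f x * g x)) \<partial>M)\<^sup>2"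
    by (intro power_mono integral_norm_bound_ennreal integrable_mult_L2 assms) auto
  also have "\<dots> = (\<integral>\<^sup>+x. ennreal (cmod (f x)) * ennreal (cmod (g x)) \<partial>M)\<^sup>2"
    by (simp add: norm_mult ennreal_mult)
  also have "\<dots> \<le> (\<integral>\<^sup>+x. (ennreal (cmod (f x)))\<^sup>2 \<partial>M) * (\<integral>\<^sup>+x. (ennreal (cmod (g x)))\<^sup>2 \<partial>M)"
    by (rule Cauchy_Schwarz_nn_integral) measurable
  also have "\<dots> = ennreal (\<integral>x. (cmod (f x))\<^sup>2 \<partial>M) * ennreal (\<integral>x. (cmod (g x))\<^sup>2 \<partial>M)"
    using i by (simp add: ennreal_power nn_integral_eq_integral)
  also have "\<dots> = ennreal ((\<integral>x. (cmod (f x))\<^sup>2 \<partial>M) * (\<integral>x. (cmod (g x))\<^sup>2 \<partial>M))"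
    by (simp add: ennreal_mult)
  finally show ?thesis by (subst (asm) ennreal_le_iff) auto
qed

lemma integral_square_zero_AE:
  assumes "f \<in> Lsp 2 M" "(\<integral>x. (cmod (f x))\<^sup>2 \<partial>M) = 0"
  shows "AE x in M. f x = 0"
  using integral_nonneg_eq_0_iff_AE[of M "\<lambda>x. (cmod (f x))\<^sup>2"] assms by (auto simp: Lsp_def)

lemma integral_square_add_le:
  assumes "f \<in> Lsp 2 M" "g \<in> Lsp 2 M"
  shows "(\<integral>x. (cmod (f x + g x))\<^sup>2 \<partial>M) \<le> 2 * (\<integral>x. (cmod (f x))\<^sup>2 \<partial>M) + 2 * (\<integral>x. (cmod (g x))\<^sup>2 \<partial>M)"
proof -
  have i: "integrable M (\<lambda>x. (cmod (f x))\<^sup>2)" "integrable M (\<lambda>x. (cmod (g x))\<^sup>2)"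
      "integrable M (\<lambda>x. (cmod (f x + g x))\<^sup>2)"
    using assms Lsp_add[OF assms] by (auto simp: Lsp_def)
  have "(\<integral>x. (cmod (f x + g x))\<^sup>2 \<partial>M) \<le> (\<integral>x. 2 * (cmod (f x))\<^sup>2 + 2 * (cmod (g x))\<^sup>2 \<partial>M)"
  proof (rule integral_mono)
    fix x
    have "(cmod (f x + g x))\<^sup>2 \<le> (cmod (f x) + cmod (g x))\<^sup>2"
      by (intro power_mono norm_triangle_ineq) auto
    then show "(cmod (f x + g x))\<^sup>2 \<le> 2 * (cmod (f x))\<^sup>2 + 2 * (cmod (g x))\<^sup>2"
      using two_mult_le_squares[of "cmod (f x)" "cmod (g x)"] by (simp add: power2_sum)
  qed (use i in auto)
  then show ?thesis using i by simp
qed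

section \<open>Sequences with summable increments\<close>

text \<open>Peeling off one term at a time by \<open>add_power_le\<close> costs a factor 2^p per
  step, so the k-th term carries the weight (2^p)^k. Sequences that converge geometrically fast
  enough absorb these weights, and no p-th roots occur.\<close>

lemma power_sum_le_weighted:
  fixes a :: "nat \<Rightarrow> real"
  assumes "\<And>k. 0 \<le> a k" "p > 0"
  shows "(\<Sum>k<n. a k) ^ p \<le> 2 ^ p * (\<Sum>k<n. (2 ^ p) ^ k * a k ^ p)"
  using assms(1)
proof (induction n arbitrary: a)
  case 0
  then show ?case using assms(2) by (simp add: power_0_left)
next
  case (Suc n)
  have "(\<Sum>k<Suc n. a k) ^ p = (a 0 + (\<Sum>k<n. a (Suc k))) ^ p"
    by (simp only: sum.lessThan_Suc_shift)
  also have "\<dots> \<le> 2 ^ p * (a 0 ^ p + (\<Sum>k<n. a (Suc k)) ^ p)"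
    using Suc.prems by (intro add_power_le sum_nonneg)
  also have "\<dots> \<le> 2 ^ p * (a 0 ^ p + 2 ^ p * (\<Sum>k<n. (2 ^ p) ^ k * a (Suc k) ^ p))"
    using Suc.IH[of "\<lambda>k. a (Suc k)"] Suc.prems by (intro mult_left_mono add_left_mono) auto
  also have "\<dots> = 2 ^ p * (\<Sum>k<Suc n. (2 ^ p) ^ k * a k ^ p)"
    by (simp only: sum.lessThan_Suc_shift) (simp add: sum_distrib_left mult_ac)
  finally show ?case .
qed

text \<open>Turns a bound on the p-th power of a partial sum into a bound on the sum itself, which
  is all that summability needs; x can exceed x^p only when x \<le> 1.\<close>

lemma le_one_plus_of_power_le:
  fixes x c :: real
  assumes "0 \<le> x" "p > 0" "x ^ p \<le> c"
  shows "x \<le> 1 + c"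
proof (cases "x \<le> 1")
  case True
  have "0 \<le> c" using assms zero_le_power order_trans by blast
  then show ?thesis using True by simp
next
  case False
  then have "x ^ 1 \<le> x ^ p" using assms by (intro power_increasing) auto
  then show ?thesis using assms by simp
qed

text \<open>Geometric weights and convexity replace Minkowski's inequality for infinite sums.\<close>

lemma series_Lsp:
  assumes d: "\<And>k. d k \<in> Lsp p M" and p: "p > 0"
    and s: "summable (\<lambda>k. (2 ^ p) ^ k * (\<integral>x. cmod (d k x) ^ p \<partial>M))"
  shows "AE x in M. summable (\<lambda>k. cmod (d k x))"
    and "(\<lambda>x. complex_of_real (\<Sum>k. cmod (d k x))) \<in> Lsp p M"
proof -
  have [measurable]: "d k \<in> borel_measurable M" for k using d by (auto simp: Lsp_def)
  have i: "integrable M (\<lambda>x. (2 ^ p) ^ k * cmod (d k x) ^ p)" for k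
    using d by (auto simp: Lsp_def)
  let ?g = "\<lambda>k x. (2 ^ p) ^ k * cmod (d k x) ^ p"
  \<comment> \<open>Monotone convergence interchanges sum and integral; the finite integral forces
    the weighted series, and through it the unweighted one, to converge almost everywhere.\<close>
  have "(\<integral>\<^sup>+x. (\<Sum>k. ennreal (?g k x)) \<partial>M) = (\<Sum>k. \<integral>\<^sup>+x. ennreal (?g k x) \<partial>M)"
    by (rule nn_integral_suminf) measurable
  also have "\<dots> = (\<Sum>k. ennreal ((2 ^ p) ^ k * (\<integral>x. cmod (d k x) ^ p \<partial>M)))"
    using i by (subst nn_integral_eq_integral) auto
  also have "\<dots> = ennreal (\<Sum>k. (2 ^ p) ^ k * (\<integral>x. cmod (d k x) ^ p \<partial>M))"
    by (rule suminf_ennreal2) (use s in auto)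
  finally have "(\<integral>\<^sup>+x. (\<Sum>k. ennreal (?g k x)) \<partial>M) \<noteq> \<infinity>" by simp
  then have "AE x in M. (\<Sum>k. ennreal (?g k x)) \<noteq> \<infinity>"
    by (intro nn_integral_PInf_AE) measurable
  then have AEg: "AE x in M. summable (\<lambda>k. ?g k x)"
    by eventually_elim (auto intro!: summable_suminf_not_top)
  have pw: "summable (\<lambda>k. cmod (d k x)) \<and> (\<Sum>k. cmod (d k x)) ^ p \<le> 2 ^ p * (\<Sum>k. ?g k x)"
    if sg: "summable (\<lambda>k. ?g k x)" for x
  proof -
    have b: "(\<Sum>k<n. cmod (d k x)) ^ p \<le> 2 ^ p * (\<Sum>k. ?g k x)" for n
      by (rule order_trans[OF power_sum_le_weighted[OF _ p]])
        (auto intro!: sum_le_suminf sg)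
    have s1: "summable (\<lambda>k. cmod (d k x))"
      by (rule summableI_nonneg_bounded[where x = "1 + 2 ^ p * (\<Sum>k. ?g k x)"])
        (use b p in \<open>auto intro!: le_one_plus_of_power_le[where p = p] sum_nonneg\<close>)
    have "(\<lambda>n. (\<Sum>k<n. cmod (d k x)) ^ p) \<longlonglongrightarrow> (\<Sum>k. cmod (d k x)) ^ p"
      by (intro tendsto_power summable_LIMSEQ s1)
    then have "(\<Sum>k. cmod (d k x)) ^ p \<le> 2 ^ p * (\<Sum>k. ?g k x)"
      by (rule LIMSEQ_le_const2) (use b in auto)
    with s1 show ?thesis by simp
  qed
  show "AE x in M. summable (\<lambda>k. cmod (d k x))"
    using AEg by eventually_elim (use pw in blast)
  have "integrable M (\<lambda>x. \<Sum>k. ?g k x)"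
    by (rule integrable_suminf) (use i AEg s in auto)
  then have "integrable M (\<lambda>x. 2 ^ p * (\<Sum>k. ?g k x))" by simp
  then have "integrable M (\<lambda>x. cmod (complex_of_real (\<Sum>k. cmod (d k x))) ^ p)"
  proof (rule Bochner_Integration.integrable_bound)
    show "AE x in M. norm (cmod (complex_of_real (\<Sum>k. cmod (d k x))) ^ p) \<le> norm (2 ^ p * (\<Sum>k. ?g k x))"
      using AEg
    proof eventually_elim
      case (elim x)
      have nn: "0 \<le> (\<Sum>k. cmod (d k x))" using pw[OF elim] by (intro suminf_nonneg) auto
      have nn2: "0 \<le> (\<Sum>k. ?g k x)" using elim by (intro suminf_nonneg) auto
      show ?case using conjunct2[OF pw[OF elim]] nn nn2 by simp
    qed
  qed measurable
  then show "(\<lambda>x. complex_of_real (\<Sum>k. cmod (d k x))) \<in> Lsp p M"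
    by (simp add: Lsp_def)
qed

text \<open>Telescoping bounds every term and the limit by one quantity free of k; when the terms
  are functions of x, this quantity is a dominating function.\<close>

lemma lim_of_summable_increments:
  fixes w :: "nat \<Rightarrow> 'a::banach"
  assumes "summable (\<lambda>k. norm (w (Suc k) - w k))"
  shows "w \<longlonglongrightarrow> lim w" "norm (w k) \<le> norm (w 0) + (\<Sum>k. norm (w (Suc k) - w k))"
    "norm (lim w) \<le> norm (w 0) + (\<Sum>k. norm (w (Suc k) - w k))"
proof -
  have eq: "w n = w 0 + (\<Sum>k<n. w (Suc k) - w k)" for n
    by (simp add: sum_lessThan_telescope)
  have "(\<lambda>n. w 0 + (\<Sum>k<n. w (Suc k) - w k)) \<longlonglongrightarrow> w 0 + (\<Sum>k. w (Suc k) - w k)"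
    by (intro tendsto_intros summable_LIMSEQ summable_norm_cancel[OF assms])
  then show l: "w \<longlonglongrightarrow> lim w"
    unfolding eq[symmetric] using limI by force
  show b: "norm (w k) \<le> norm (w 0) + (\<Sum>k. norm (w (Suc k) - w k))" for k
  proof -
    have "norm (w k) \<le> norm (w 0) + norm (\<Sum>k<k. w (Suc k) - w k)"
      by (subst eq) (rule norm_triangle_ineq)
    also have "\<dots> \<le> norm (w 0) + (\<Sum>k<k. norm (w (Suc k) - w k))"
      by (intro add_left_mono norm_sum)
    also have "\<dots> \<le> norm (w 0) + (\<Sum>k. norm (w (Suc k) - w k))"
      by (intro add_left_mono sum_le_suminf assms) auto
    finally show ?thesis .
  qed
  show "norm (lim w) \<le> norm (w 0) + (\<Sum>k. norm (w (Suc k) - w k))"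
    by (rule LIMSEQ_le_const2[OF tendsto_norm[OF l]]) (use b in auto)
qed

section \<open>Dominated limits and density in the Hilbert space\<close>

lemma integral_square_add:
  assumes "f \<in> Lsp 2 M" "g \<in> Lsp 2 M"
  shows "(\<integral>x. (cmod (f x + g x))\<^sup>2 \<partial>M) =
     (\<integral>x. (cmod (f x))\<^sup>2 \<partial>M) + 2 * Re (\<integral>x. f x * cnj (g x) \<partial>M) + (\<integral>x. (cmod (g x))\<^sup>2 \<partial>M)"
proof -
  have i: "integrable M (\<lambda>x. (cmod (f x))\<^sup>2)" "integrable M (\<lambda>x. (cmod (g x))\<^sup>2)"
      "integrable M (\<lambda>x. f x * cnj (g x))"
    using assms integrable_mult_L2[OF assms(1) Lsp_cnj[OF assms(2)]] by (auto simp: Lsp_def)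
  have "(\<lambda>x. (cmod (f x + g x))\<^sup>2) = (\<lambda>x. (cmod (f x))\<^sup>2 + 2 * Re (f x * cnj (g x)) + (cmod (g x))\<^sup>2)"
    unfolding cmod_power2 by (auto simp: fun_eq_iff algebra_simps power2_eq_square)
  then have "(\<integral>x. (cmod (f x + g x))\<^sup>2 \<partial>M) =
      (\<integral>x. (cmod (f x))\<^sup>2 + 2 * Re (f x * cnj (g x)) + (cmod (g x))\<^sup>2 \<partial>M)"
    by (simp only:)
  also have "\<dots> = (\<integral>x. (cmod (f x))\<^sup>2 \<partial>M) + 2 * Re (\<integral>x. f x * cnj (g x) \<partial>M) + (\<integral>x. (cmod (g x))\<^sup>2 \<partial>M)"
    using i by (simp del: complex_cnj_mult times_complex.sel)
  finally show ?thesis .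
qed

lemma integral_square_scale: "(\<integral>x. (cmod (c * f x))\<^sup>2 \<partial>M) = (cmod c)\<^sup>2 * (\<integral>x. (cmod (f x))\<^sup>2 \<partial>M)"
  by (simp add: norm_mult power_mult_distrib)

lemma integral_square_parallelogram:
  assumes "f \<in> Lsp 2 M" "g \<in> Lsp 2 M"
  shows "(\<integral>x. (cmod (f x - g x))\<^sup>2 \<partial>M) =
     2 * (\<integral>x. (cmod (f x))\<^sup>2 \<partial>M) + 2 * (\<integral>x. (cmod (g x))\<^sup>2 \<partial>M) - (\<integral>x. (cmod (f x + g x))\<^sup>2 \<partial>M)"
  using integral_square_add[OF assms] integral_square_add[OF assms(1) Lsp_scale[OF assms(2), of "-1"]]
  by simp

text \<open>A fast Cauchy sequence carries its own majorant: the first term plus the sum of the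
  absolute increments. Choosing the limit pointwise by \<open>lim\<close> makes it measurable
  without any modification on null sets.\<close>

lemma Lsp_lim_dominated:
  assumes w: "\<And>k. w k \<in> Lsp p M" and p: "p > 0"
    and s: "summable (\<lambda>k. (2 ^ p) ^ k * (\<integral>x. cmod (w (Suc k) x - w k x) ^ p \<partial>M))"
  defines "h \<equiv> (\<lambda>x. cmod (w 0 x) + (\<Sum>k. cmod (w (Suc k) x - w k x)))"
  shows "(\<lambda>x. complex_of_real (h x)) \<in> Lsp p M"
    and "AE x in M. (\<lambda>k. w k x) \<longlonglongrightarrow> lim (\<lambda>k. w k x) \<and> (\<forall>k. cmod (w k x) \<le> h x) \<and>
       cmod (lim (\<lambda>k. w k x)) \<le> h x"
    and "(\<lambda>x. lim (\<lambda>k. w k x)) \<in> Lsp p M"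
proof -
  have [measurable]: "w k \<in> borel_measurable M" for k using w by (auto simp: Lsp_def)
  have d: "(\<lambda>x. w (Suc k) x - w k x) \<in> Lsp p M" for k
    using w by (intro Lsp_diff)
  note S = series_Lsp[OF d p s]
  have "(\<lambda>x. complex_of_real (cmod (w 0 x))) \<in> Lsp p M"
    by (rule Lsp_bound[OF w[of 0]]) auto
  from Lsp_add[OF this S(2)] show h: "(\<lambda>x. complex_of_real (h x)) \<in> Lsp p M"
    by (simp add: h_def)
  show AE: "AE x in M. (\<lambda>k. w k x) \<longlonglongrightarrow> lim (\<lambda>k. w k x) \<and> (\<forall>k. cmod (w k x) \<le> h x) \<and>
       cmod (lim (\<lambda>k. w k x)) \<le> h x"
    using S(1)
    by eventually_elim (use lim_of_summable_increments[where w = "\<lambda>k. w k _"] in \<open>auto simp: h_def\<close>)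
  show "(\<lambda>x. lim (\<lambda>k. w k x)) \<in> Lsp p M"
  proof (rule Lsp_bound[OF h])
    show "(\<lambda>x. lim (\<lambda>k. w k x)) \<in> borel_measurable M"
      by (rule borel_measurable_lim_metric) measurable
    show "AE x in M. cmod (lim (\<lambda>k. w k x)) \<le> cmod (complex_of_real (h x))"
      using AE by eventually_elim auto
  qed
qed

lemma dominated_convergence_square:
  assumes w: "\<And>k. w k \<in> Lsp 2 M" and u: "u \<in> Lsp 2 M" and h: "(\<lambda>x. complex_of_real (h x)) \<in> Lsp 2 M"
    and AE: "AE x in M. (\<lambda>k. w k x) \<longlonglongrightarrow> u x \<and> (\<forall>k. cmod (w k x) \<le> h x) \<and> cmod (u x) \<le> h x"
  shows "(\<lambda>k. \<integral>x. (cmod (u x - w k x))\<^sup>2 \<partial>M) \<longlonglongrightarrow> 0"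
proof -
  have [measurable]: "w k \<in> borel_measurable M" "u \<in> borel_measurable M" for k
    using w u by (auto simp: Lsp_def)
  have i: "integrable M (\<lambda>x. 4 * (h x)\<^sup>2)"
    using Lsp_integrable[OF h] by simp
  have "(\<lambda>k. \<integral>x. (cmod (u x - w k x))\<^sup>2 \<partial>M) \<longlonglongrightarrow> (\<integral>x. 0 \<partial>M)"
  proof (rule integral_dominated_convergence[where w = "\<lambda>x. 4 * (h x)\<^sup>2"])
    show "AE x in M. (\<lambda>k. (cmod (u x - w k x))\<^sup>2) \<longlonglongrightarrow> 0"
      using AE
    proof eventually_elim
      case (elim x)
      have "(\<lambda>k. (cmod (u x - w k x))\<^sup>2) \<longlonglongrightarrow> (cmod (u x - u x))\<^sup>2"
        using elim by (intro tendsto_intros) auto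
      then show ?case by simp
    qed
    show "AE x in M. norm ((cmod (u x - w k x))\<^sup>2) \<le> 4 * (h x)\<^sup>2" for k
      using AE
    proof eventually_elim
      case (elim x)
      have "cmod (u x - w k x) \<le> cmod (u x) + cmod (w k x)" by (rule norm_triangle_ineq4)
      also have "\<dots> \<le> 2 * h x" using elim spec[of _ k] by (smt (verit))
      finally have "(cmod (u x - w k x))\<^sup>2 \<le> (2 * h x)\<^sup>2" by (intro power_mono) auto
      then show ?case by (simp add: power_mult_distrib)
    qed
  qed (use i in auto)
  then show ?thesis by simp
qed

text \<open>
  A minimizing sequence for the distance to \<open>V\<close> converges by the parallelogram law, and the residual
  is orthogonal to \<open>V\<close>.
\<close>

lemma dense_if_orthogonal_trivial:
  assumes V: "V \<subseteq> Lsp 2 M" "V \<noteq> {}"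
    and lin: "\<And>v w a b. v \<in> V \<Longrightarrow> w \<in> V \<Longrightarrow> (\<lambda>x. a * v x + b * w x) \<in> V"
    and triv: "\<And>g. g \<in> Lsp 2 M \<Longrightarrow> (\<And>v. v \<in> V \<Longrightarrow> (\<integral>x. g x * cnj (v x) \<partial>M) = 0) \<Longrightarrow> AE x in M. g x = 0"
    and f: "f \<in> Lsp 2 M" and e: "e > 0"
  shows "\<exists>v\<in>V. (\<integral>x. (cmod (f x - v x))\<^sup>2 \<partial>M) < e"
proof -
  define Q where "Q v = (\<integral>x. (cmod (f x - v x))\<^sup>2 \<partial>M)" for v
  define D where "D = Inf (Q ` V)"
  have Q0: "0 \<le> Q v" for v unfolding Q_def by simp
  have bdd: "bdd_below (Q ` V)" using Q0 by (intro bdd_belowI[of _ 0]) auto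
  have D: "D \<le> Q v" if "v \<in> V" for v
    unfolding D_def using bdd that by (intro cInf_lower) auto
  \<comment> \<open>The rate 8^(-k) beats the weight (2^2)^k that \<open>Lsp_lim_dominated\<close>
    puts on squared increments: the weighted terms decay like 2^(-k).\<close>
  have "\<exists>v\<in>V. Q v < D + (1/8) ^ k" for k
    using cInf_lessD[of "Q ` V" "D + (1/8) ^ k"] V(2) by (auto simp: D_def)
  then obtain v where v: "\<And>k. v k \<in> V" and Qv: "\<And>k. Q (v k) < D + (1/8) ^ k" by metis
  have vL: "v k \<in> Lsp 2 M" for k using v V by auto
  have fv: "(\<lambda>x. f x - v k x) \<in> Lsp 2 M" for k using f vL by (intro Lsp_diff)
  have step: "(\<integral>x. (cmod (v (Suc k) x - v k x))\<^sup>2 \<partial>M) \<le> 4 * (1/8) ^ k" for k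
  proof -
    \<comment> \<open>The midpoint lies in V, hence at squared distance at least D from f. By the
      parallelogram law the squared distance of consecutive terms is then at most twice the sum of
      their excesses over D.\<close>
    have mid: "(\<lambda>x. 1/2 * v k x + 1/2 * v (Suc k) x) \<in> V" using lin v by blast
    have "(\<lambda>x. (cmod (f x - v k x + (f x - v (Suc k) x)))\<^sup>2)
        = (\<lambda>x. 4 * (cmod (f x - (1/2 * v k x + 1/2 * v (Suc k) x)))\<^sup>2)"
    proof
      fix x
      have eq: "f x - v k x + (f x - v (Suc k) x) = 2 * (f x - (1/2 * v k x + 1/2 * v (Suc k) x))"
        by (simp add: algebra_simps)
      then show "(cmod (f x - v k x + (f x - v (Suc k) x)))\<^sup>2
          = 4 * (cmod (f x - (1/2 * v k x + 1/2 * v (Suc k) x)))\<^sup>2"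
        unfolding eq norm_mult power_mult_distrib by simp
    qed
    then have "(\<integral>x. (cmod (f x - v k x + (f x - v (Suc k) x)))\<^sup>2 \<partial>M)
        = 4 * Q (\<lambda>x. 1/2 * v k x + 1/2 * v (Suc k) x)"
      by (simp add: Q_def)
    also have "\<dots> \<ge> 4 * D" using D[OF mid] by simp
    finally have "(\<integral>x. (cmod (v (Suc k) x - v k x))\<^sup>2 \<partial>M) \<le> 2 * Q (v k) + 2 * Q (v (Suc k)) - 4 * D"
      using integral_square_parallelogram[OF fv[of k] fv[of "Suc k"]] by (simp add: Q_def)
    also have "\<dots> \<le> 2 * (1/8) ^ k + 2 * (1/8) ^ Suc k" using Qv[of k] Qv[of "Suc k"] by linarith
    also have "\<dots> \<le> 4 * (1/8) ^ k" by simp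
    finally show ?thesis .
  qed
  have "summable (\<lambda>k. (2\<^sup>2) ^ k * (\<integral>x. (cmod (v (Suc k) x - v k x))\<^sup>2 \<partial>M))"
  proof (rule summable_comparison_test'[where g = "\<lambda>k. 4 * (1/2::real) ^ k" and N = 0])
    fix k
    have "(2\<^sup>2) ^ k * (\<integral>x. (cmod (v (Suc k) x - v k x))\<^sup>2 \<partial>M) \<le> 4 ^ k * (4 * (1/8) ^ k)"
      using step[of k] by (intro mult_mono) auto
    also have "\<dots> = 4 * (1/2) ^ k" by (simp add: power_mult_distrib[symmetric])
    finally show "norm ((2\<^sup>2) ^ k * (\<integral>x. (cmod (v (Suc k) x - v k x))\<^sup>2 \<partial>M)) \<le> 4 * (1/2) ^ k" by simp
  qed (auto intro: summable_mult summable_geometric)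
  note L = Lsp_lim_dominated[where w = v, OF vL _ this, simplified]
  define p where "p = (\<lambda>x. lim (\<lambda>k. v k x))"
  define h where "h = (\<lambda>x. cmod (v 0 x) + (\<Sum>k. cmod (v (Suc k) x - v k x)))"
  have p: "p \<in> Lsp 2 M" using L(3) by (simp add: p_def)
  have h: "(\<lambda>x. complex_of_real (h x)) \<in> Lsp 2 M" using L(1) by (simp add: h_def)
  have AE: "AE x in M. (\<lambda>k. v k x) \<longlonglongrightarrow> p x \<and> (\<forall>k. cmod (v k x) \<le> h x) \<and> cmod (p x) \<le> h x"
    using L(2) unfolding p_def h_def by simp
  have conv: "(\<lambda>k. \<integral>x. (cmod (p x - v k x))\<^sup>2 \<partial>M) \<longlonglongrightarrow> 0"
    by (rule dominated_convergence_square[OF vL p h AE])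
  have orth: "(\<integral>x. (f x - p x) * cnj (z x) \<partial>M) = 0" if z: "z \<in> V" for z
  proof -
    have zL: "z \<in> Lsp 2 M" using z V by auto
    define N where "N = (\<integral>x. (cmod (z x))\<^sup>2 \<partial>M)"
    have N: "0 \<le> N" by (simp add: N_def)
    define a where "a k = (\<integral>x. (f x - v k x) * cnj (z x) \<partial>M)" for k
    have bnd: "(cmod (a k))\<^sup>2 \<le> (N + 1) * (1/8) ^ k" for k
    proof -
      \<comment> \<open>Moving from \<open>v k\<close> by \<open>t a k z\<close> stays in V and
        changes the squared distance to f by (t^2 N - 2t) times the square of |\<open>a k\<close>|.
        With t = 1/(N + 1) the quadratic term is at most half the linear one; the 1 covers N =
        0.\<close>
      define t where "t = 1 / (N + 1)"
      have t: "t > 0" using N by (simp add: t_def)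
      have "(\<lambda>x. 1 * v k x + (of_real t * a k) * z x) \<in> V" using lin v z by blast
      from D[OF this] have "D \<le> (\<integral>x. (cmod ((f x - v k x) + (- of_real t * a k) * z x))\<^sup>2 \<partial>M)"
        by (simp add: Q_def algebra_simps)
      also have "\<dots> = Q (v k) + 2 * Re (\<integral>x. (f x - v k x) * cnj ((- of_real t * a k) * z x) \<partial>M)
          + (cmod (- of_real t * a k))\<^sup>2 * N"
        unfolding integral_square_add[OF fv Lsp_scale[OF zL]] integral_square_scale N_def Q_def ..
      also have "(\<integral>x. (f x - v k x) * cnj ((- of_real t * a k) * z x) \<partial>M) = cnj (- of_real t * a k) * a k"
        unfolding a_def integral_mult_right_zero[symmetric] by (simp add: mult_ac)
      also have "Re (cnj (- of_real t * a k) * a k) = - t * (cmod (a k))\<^sup>2"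
        unfolding cmod_power2 by (simp add: algebra_simps power2_eq_square)
      also have "(cmod (- of_real t * a k))\<^sup>2 = t\<^sup>2 * (cmod (a k))\<^sup>2"
        by (simp add: norm_mult power_mult_distrib)
      finally have 1: "(cmod (a k))\<^sup>2 * (2 * t - t\<^sup>2 * N) \<le> (1/8) ^ k"
        using Qv[of k] by (simp add: algebra_simps)
      have "t * N \<le> 1" using N by (simp add: t_def field_simps)
      then have "t\<^sup>2 * N \<le> t" using t by (simp add: power2_eq_square mult.assoc)
      then have "(cmod (a k))\<^sup>2 * t \<le> (cmod (a k))\<^sup>2 * (2 * t - t\<^sup>2 * N)"
        by (intro mult_left_mono) auto
      with 1 have "(cmod (a k))\<^sup>2 * t \<le> (1/8) ^ k" by linarith
      then show ?thesis using N by (simp add: t_def field_simps)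
    qed
    have "(\<lambda>k. (N + 1) * (1/8::real) ^ k) \<longlonglongrightarrow> (N + 1) * 0"
      by (rule tendsto_mult_left, rule LIMSEQ_power_zero) simp
    then have "(\<lambda>k. (N + 1) * (1/8::real) ^ k) \<longlonglongrightarrow> 0" by simp
    then have "(\<lambda>k. (cmod (a k))\<^sup>2) \<longlonglongrightarrow> 0"
      by (rule tendsto_sandwich[OF _ _ tendsto_const[of 0], rotated 2]) (use bnd in auto)
    then have a0: "a \<longlonglongrightarrow> 0"
      using tendsto_real_sqrt[of "\<lambda>k. (cmod (a k))\<^sup>2" 0] by (simp add: tendsto_norm_zero_iff)
    have [measurable]: "f \<in> borel_measurable M" "z \<in> borel_measurable M" "p \<in> borel_measurable M"
      "v k \<in> borel_measurable M" for k
      using f zL p vL by (auto simp: Lsp_def)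
    have "a \<longlonglongrightarrow> (\<integral>x. (f x - p x) * cnj (z x) \<partial>M)"
      unfolding a_def
    proof (rule integral_dominated_convergence[where w = "\<lambda>x. (cmod (f x) + h x) * cmod (z x)"])
      have "(\<lambda>x. complex_of_real (cmod (f x))) \<in> Lsp 2 M" by (rule Lsp_bound[OF f]) auto
      from integrable_mult_L2[OF Lsp_add[OF this h] Lsp_bound[OF zL, of "\<lambda>x. complex_of_real (cmod (z x))"]]
      have "integrable M (\<lambda>x. (complex_of_real (cmod (f x)) + complex_of_real (h x)) * complex_of_real (cmod (z x)))"
        by simp
      then have "integrable M (\<lambda>x. complex_of_real ((cmod (f x) + h x) * cmod (z x)))" by simp
      then show "integrable M (\<lambda>x. (cmod (f x) + h x) * cmod (z x))"
        by (simp only: complex_of_real_integrable_eq)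
      show "AE x in M. (\<lambda>i. (f x - v i x) * cnj (z x)) \<longlonglongrightarrow> (f x - p x) * cnj (z x)"
        using AE by eventually_elim (auto intro!: tendsto_intros)
      show "AE x in M. norm ((f x - v i x) * cnj (z x)) \<le> (cmod (f x) + h x) * cmod (z x)" for i
        using AE
      proof eventually_elim
        case (elim x)
        have "cmod (f x - v i x) \<le> cmod (f x) + cmod (v i x)" by (rule norm_triangle_ineq4)
        also have "\<dots> \<le> cmod (f x) + h x" using elim by auto
        finally show ?case by (auto simp: norm_mult intro: mult_right_mono)
      qed
    qed measurable
    from LIMSEQ_unique[OF this a0] show ?thesis .
  qed
  have "AE x in M. f x - p x = 0"
    by (rule triv[OF Lsp_diff[OF f p] orth])
  moreover have [measurable]: "f \<in> borel_measurable M" "p \<in> borel_measurable M" "v k \<in> borel_measurable M" for k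
    using f p vL by (auto simp: Lsp_def)
  ultimately have "(\<integral>x. (cmod (p x - v k x))\<^sup>2 \<partial>M) = Q (v k)" for k
    unfolding Q_def by (intro integral_cong_AE) (auto elim: eventually_mono)
  with conv have "(\<lambda>k. Q (v k)) \<longlonglongrightarrow> 0" by simp
  then have "eventually (\<lambda>k. Q (v k) < e) sequentially"
    using e by (rule order_tendstoD)
  then obtain k where "Q (v k) < e" by (auto simp: eventually_sequentially)
  then show ?thesis using v by (auto simp: Q_def)
qed

section \<open>Gaussians and Fourier uniqueness\<close>

text \<open>Positive and negative part of h have the same Fourier transform, in particular the same
  mass at t = 0. Scaled to probability densities they have equal characteristic functions, so Levy's
  uniqueness theorem makes them equal almost everywhere.\<close>

lemma real_fourier_unique:
  fixes h :: "real \<Rightarrow> real"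
  assumes h: "integrable lborel h"
    and z: "\<And>t. (\<integral>x. of_real (h x) * iexp (t * x) \<partial>lborel) = 0"
  shows "AE x in lborel. h x = 0"
proof -
  have [measurable]: "h \<in> borel_measurable borel" using h by auto
  define p where "p x = max 0 (h x)" for x
  define n where "n x = max 0 (- h x)" for x
  have pn: "h x = p x - n x" for x by (auto simp: p_def n_def)
  have nn: "0 \<le> p x" "0 \<le> n x" for x by (auto simp: p_def n_def)
  have ip: "integrable lborel p" and im: "integrable lborel n"
    unfolding p_def n_def using h by auto
  have [measurable]: "p \<in> borel_measurable borel" "n \<in> borel_measurable borel" using ip im by auto
  have eq: "(\<integral>x. of_real (p x) * iexp (t * x) \<partial>lborel) = (\<integral>x. of_real (n x) * iexp (t * x) \<partial>lborel)" for t
  proof -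
    have bnd: "integrable lborel (\<lambda>x. of_real (q x) * iexp (t * x))" if "integrable lborel q" for q :: "real \<Rightarrow> real"
      by (rule Bochner_Integration.integrable_bound[OF that]) (use that in \<open>auto simp: norm_mult\<close>)
    have "(\<integral>x. of_real (h x) * iexp (t * x) \<partial>lborel) =
        (\<integral>x. of_real (p x) * iexp (t * x) - of_real (n x) * iexp (t * x) \<partial>lborel)"
      by (simp add: pn algebra_simps)
    also have "\<dots> = (\<integral>x. of_real (p x) * iexp (t * x) \<partial>lborel) - (\<integral>x. of_real (n x) * iexp (t * x) \<partial>lborel)"
      by (intro Bochner_Integration.integral_diff bnd ip im)
    finally show ?thesis using z[of t] by simp
  qed
  define m where "m = (\<integral>x. p x \<partial>lborel)"
  have m': "m = (\<integral>x. n x \<partial>lborel)"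
    using eq[of 0] by (simp add: m_def)
  have m0: "0 \<le> m" unfolding m_def using nn by simp
  show ?thesis
  \<comment> \<open>A common mass 0 cannot be normalised; both parts then vanish almost everywhere
    by nonnegativity.\<close>
  proof (cases "m = 0")
    case True
    then have "AE x in lborel. p x = 0" "AE x in lborel. n x = 0"
      using integral_nonneg_eq_0_iff_AE[OF ip] integral_nonneg_eq_0_iff_AE[OF im] nn m' by (auto simp: m_def)
    then show ?thesis by eventually_elim (simp add: pn)
  next
    case False
    with m0 have m: "m > 0" by simp
    have dist: "real_distribution (density lborel (\<lambda>x. ennreal (q x / m)))"
      if q: "integrable lborel q" "\<And>x. 0 \<le> q x" "(\<integral>x. q x \<partial>lborel) = m" for q :: "real \<Rightarrow> real"
    proof -
      have [measurable]: "q \<in> borel_measurable borel" using q(1) by auto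
      have "(\<integral>\<^sup>+x. ennreal (q x / m) \<partial>lborel) = ennreal (\<integral>x. q x / m \<partial>lborel)"
        using q m by (intro nn_integral_eq_integral) auto
      also have "\<dots> = 1" using q m by simp
      finally have "prob_space (density lborel (\<lambda>x. ennreal (q x / m)))"
        by (intro prob_spaceI) (simp add: emeasure_density)
      then show ?thesis by (simp add: real_distribution_def real_distribution_axioms_def)
    qed
    have char: "char (density lborel (\<lambda>x. ennreal (q x / m))) t = (\<integral>x. of_real (q x) * iexp (t * x) \<partial>lborel) / m"
      if q: "q \<in> borel_measurable borel" "\<And>x. 0 \<le> q x" for q :: "real \<Rightarrow> real" and t
    proof -
      note [measurable] = q(1)
      have "char (density lborel (\<lambda>x. ennreal (q x / m))) t = (\<integral>x. (q x / m) *\<^sub>R iexp (t * x) \<partial>lborel)"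
        unfolding char_def by (rule integral_density) (use q m in auto)
      also have "\<dots> = (\<integral>x. of_real (q x) * iexp (t * x) / of_real m \<partial>lborel)"
        by (simp add: scaleR_conv_of_real)
      finally show ?thesis by simp
    qed
    have "density lborel (\<lambda>x. ennreal (p x / m)) = density lborel (\<lambda>x. ennreal (n x / m))"
    proof (rule Levy_uniqueness)
      show "char (density lborel (\<lambda>x. ennreal (p x / m))) = char (density lborel (\<lambda>x. ennreal (n x / m)))"
        using char[of p] char[of n] nn eq by (simp add: fun_eq_iff)
    qed (use dist[OF ip] dist[OF im] nn m_def m' in auto)
    moreover have "(\<integral>\<^sup>+x. ennreal (p x / m) \<partial>lborel) = ennreal (\<integral>x. p x / m \<partial>lborel)"
      using ip nn m by (intro nn_integral_eq_integral) auto
    ultimately have "AE x in lborel. ennreal (p x / m) = ennreal (n x / m)"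
      by (subst (asm) finite_density_unique) auto
    then show ?thesis
      by eventually_elim (use m nn in \<open>auto simp: pn divide_nonneg_pos\<close>)
  qed
qed

text \<open>Conjugating the hypothesis at -t shows that the transform of \<open>cnj h\<close>
  vanishes too. Real and imaginary part are combinations of h and \<open>cnj h\<close>, so each
  falls under the real case.\<close>

lemma complex_fourier_unique:
  fixes h :: "real \<Rightarrow> complex"
  assumes h: "integrable lborel h"
    and z: "\<And>t. (\<integral>x. h x * iexp (t * x) \<partial>lborel) = 0"
  shows "AE x in lborel. h x = 0"
proof -
  have bnd: "integrable lborel (\<lambda>x. q x * iexp (t * x))" if "integrable lborel q" for q :: "real \<Rightarrow> complex" and t
    by (rule Bochner_Integration.integrable_bound[OF that]) (use that in \<open>auto simp: norm_mult\<close>)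
  have ic: "integrable lborel (\<lambda>x. cnj (h x))" using h by simp
  have c: "(\<integral>x. cnj (h x) * iexp (t * x) \<partial>lborel) = 0" for t
  proof -
    have "(\<integral>x. cnj (h x) * iexp (t * x) \<partial>lborel) = (\<integral>x. cnj (h x * iexp ((- t) * x)) \<partial>lborel)"
      by (simp add: exp_cnj)
    also have "\<dots> = cnj (\<integral>x. h x * iexp ((- t) * x) \<partial>lborel)"
      by (rule Bochner_Integration.integral_cnj)
    finally show ?thesis using z[of "- t"] by simp
  qed
  have "AE x in lborel. Re (h x) = 0"
  proof (rule real_fourier_unique)
    fix t
    have "(\<integral>x. of_real (Re (h x)) * iexp (t * x) \<partial>lborel)
        = (\<integral>x. (1/2) * (h x * iexp (t * x) + cnj (h x) * iexp (t * x)) \<partial>lborel)"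
      by (intro Bochner_Integration.integral_cong refl) (simp add: complex_add_cnj flip: distrib_right)
    also have "\<dots> = (1/2) * ((\<integral>x. h x * iexp (t * x) \<partial>lborel) + (\<integral>x. cnj (h x) * iexp (t * x) \<partial>lborel))"
      by (subst integral_mult_right_zero, subst Bochner_Integration.integral_add) (intro bnd h ic refl)+
    finally show "(\<integral>x. of_real (Re (h x)) * iexp (t * x) \<partial>lborel) = 0" using z c by simp
  qed (use h in simp)
  moreover have "AE x in lborel. Im (h x) = 0"
  proof (rule real_fourier_unique)
    fix t
    have "(\<integral>x. of_real (Im (h x)) * iexp (t * x) \<partial>lborel)
        = (\<integral>x. (-\<i>/2) * (h x * iexp (t * x) - cnj (h x) * iexp (t * x)) \<partial>lborel)"
      by (intro Bochner_Integration.integral_cong refl) (simp add: complex_diff_cnj algebra_simps flip: left_diff_distrib)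
    also have "\<dots> = (-\<i>/2) * ((\<integral>x. h x * iexp (t * x) \<partial>lborel) - (\<integral>x. cnj (h x) * iexp (t * x) \<partial>lborel))"
      by (subst integral_mult_right_zero, subst Bochner_Integration.integral_diff) (intro bnd h ic refl)+
    finally show "(\<integral>x. of_real (Im (h x)) * iexp (t * x) \<partial>lborel) = 0" using z c by simp
  qed (use h in simp)
  ultimately show ?thesis by eventually_elim (simp add: complex_eq_iff)
qed

section \<open>Gaussian integrals with a complex linear term\<close>

lemma has_bochner_integral_std_gaussian:
  "has_bochner_integral lborel (\<lambda>x. exp (- (of_real x)\<^sup>2 / 2 + \<i> * of_real (q * x)))
     (complex_of_real (sqrt (2 * pi)) * exp (- (of_real q)\<^sup>2 / 2))"
proof -
  have e: "std_normal_density x *\<^sub>R iexp (q * x) = exp (- (of_real x)\<^sup>2 / 2 + \<i> * of_real (q * x)) / of_real (sqrt (2 * pi))" for x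
    by (simp add: std_normal_density_def scaleR_conv_of_real exp_add[symmetric] mult_exp_exp exp_of_real[symmetric] algebra_simps)
  have i: "integrable lborel (\<lambda>x. std_normal_density x *\<^sub>R iexp (q * x))"
    by (rule Bochner_Integration.integrable_bound[where f = std_normal_density]) auto
  have "(\<integral>x. std_normal_density x *\<^sub>R iexp (q * x) \<partial>lborel) = char std_normal_distribution q"
    unfolding char_def by (rule integral_density[symmetric]) auto
  also have "\<dots> = exp (- (of_real q)\<^sup>2 / 2)"
    by (simp add: char_std_normal_distribution exp_of_real[symmetric])
  finally have "has_bochner_integral lborel (\<lambda>x. exp (- (of_real x)\<^sup>2 / 2 + \<i> * of_real (q * x)) / of_real (sqrt (2 * pi)))
      (exp (- (of_real q)\<^sup>2 / 2) :: complex)"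
    using i unfolding e has_bochner_integral_iff by simp
  from has_bochner_integral_mult_right[OF this, of "of_real (sqrt (2 * pi))"]
  show ?thesis by simp
qed

lemma has_bochner_integral_gaussian:
  fixes b :: complex
  assumes a: "a > 0"
  shows "has_bochner_integral lborel (\<lambda>x. exp (- of_real a * (of_real x)\<^sup>2 + b * of_real x))
     (of_real (sqrt (pi / a)) * exp (b\<^sup>2 / (4 * of_real a)))"
proof -
  \<comment> \<open>The substitution x = t + c y completes the square for the real part of b only
    and scales the quadratic term to y^2/2. The imaginary part of b stays as an oscillating factor,
    which the characteristic function of the normal law evaluates, so no contour has to be
    shifted.\<close>
  define c where "c = 1 / sqrt (2 * a)"
  define t where "t = Re b / (2 * a)"
  have c: "c > 0" "c\<^sup>2 = 1 / (2 * a)" using a by (simp_all add: c_def power_divide)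
  have b: "b = of_real (Re b) + \<i> * of_real (Im b)" by (simp add: complex_eq)
  have ac: "a * c\<^sup>2 = 1/2" "a * t = Re b / 2" using a c by (simp_all add: t_def)
  have F: "exp (- of_real a * (of_real (t + c * y))\<^sup>2 + b * of_real (t + c * y)) =
     exp (of_real (t * Re b / 2) + \<i> * of_real (Im b * t)) *
       exp (- (of_real y)\<^sup>2 / 2 + \<i> * of_real ((Im b * c) * y))" for y
  proof -
    have "- a * (t + c * y)\<^sup>2 + Re b * (t + c * y) = t * Re b / 2 - y\<^sup>2 / 2"
    proof -
      have "- a * (t + c * y)\<^sup>2 + Re b * (t + c * y)
         = - (a * t) * t - 2 * (a * t) * c * y - (a * c\<^sup>2) * y\<^sup>2 + Re b * t + Re b * c * y"
        by (simp add: power2_eq_square algebra_simps)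
      also have "\<dots> = t * Re b / 2 - y\<^sup>2 / 2" unfolding ac by (simp add: algebra_simps)
      finally show ?thesis .
    qed
    then have "- of_real a * (of_real (t + c * y))\<^sup>2 + b * of_real (t + c * y) =
       of_real (t * Re b / 2) + \<i> * of_real (Im b * t) + (- (of_real y)\<^sup>2 / 2 + \<i> * of_real ((Im b * c) * y))"
      by (simp add: complex_eq_iff algebra_simps power2_eq_square)
    then show ?thesis by (simp only: exp_add)
  qed
  have val: "exp (of_real (t * Re b / 2) + \<i> * of_real (Im b * t)) *
       (complex_of_real (sqrt (2 * pi)) * exp (- (of_real (Im b * c))\<^sup>2 / 2))
     = (of_real (sqrt (pi / a)) * exp (b\<^sup>2 / (4 * of_real a))) /\<^sub>R \<bar>c\<bar>"
  proof -
    have S: "complex_of_real c * of_real (sqrt (2 * pi)) = of_real (sqrt (pi / a))"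
      unfolding of_real_mult[symmetric] using a by (simp add: c_def real_sqrt_divide real_sqrt_mult)
    have E: "of_real (t * Re b / 2) + \<i> * of_real (Im b * t) + (- (of_real (Im b * c))\<^sup>2 / 2) = b\<^sup>2 / (4 * of_real a)"
    proof -
      have "b\<^sup>2 / (4 * of_real a) = of_real (((Re b)\<^sup>2 - (Im b)\<^sup>2) / (4 * a)) + \<i> * of_real (Re b * Im b / (2 * a))"
        by (subst b) (use a in \<open>simp add: power2_eq_square field_simps\<close>)
      moreover have "(Im b * c)\<^sup>2 = (Im b)\<^sup>2 / (2 * a)" using c by (simp add: power_mult_distrib)
      then have "(complex_of_real (Im b * c))\<^sup>2 = of_real ((Im b)\<^sup>2 / (2 * a))"
        by (metis of_real_power)
      then have "of_real (t * Re b / 2) + \<i> * of_real (Im b * t) + (- (of_real (Im b * c))\<^sup>2 / 2)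
         = of_real (t * Re b / 2 - (Im b)\<^sup>2 / (2 * a) / 2) + \<i> * of_real (Im b * t)"
        by (simp only:) simp
      ultimately show ?thesis using a by (simp add: t_def complex_eq_iff power2_eq_square field_simps)
    qed
    have "exp A * (S * exp B) = of_real r * S * exp C /\<^sub>R r" if "A + B = C" "r > 0" for A B C S :: complex and r
      using that by (auto simp: exp_add scaleR_conv_of_real)
    from this[OF E c(1), of "of_real (sqrt (2 * pi))"] S show ?thesis using c(1) by simp
  qed
  have "has_bochner_integral lborel (\<lambda>y. exp (- of_real a * (of_real (t + c * y))\<^sup>2 + b * of_real (t + c * y)))
     ((of_real (sqrt (pi / a)) * exp (b\<^sup>2 / (4 * of_real a))) /\<^sub>R \<bar>c\<bar>)"
    unfolding F val[symmetric]
    by (rule has_bochner_integral_mult_right) (use has_bochner_integral_std_gaussian[of "Im b * c"] in simp)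
  then show ?thesis
    using c by (subst lborel_has_bochner_integral_real_affine_iff[of c _ _ t]) auto
qed

section \<open>Coherent states\<close>

text \<open>The generating function e^(2sx - s^2) of the physicists' Hermite polynomials, times the
  Gaussian. It is left unnormalised so that it is holomorphic in s.\<close>

definition coh :: "complex \<Rightarrow> real \<Rightarrow> complex" where
  "coh s x = exp (- (of_real x)\<^sup>2 / 2 + 2 * s * of_real x - s\<^sup>2)"

lemma coh_measurable [measurable]: "(\<lambda>x. coh s x) \<in> borel_measurable borel"
  unfolding coh_def by (intro borel_measurable_continuous_onI continuous_intros) auto

lemma cnj_coh: "cnj (coh s x) = coh (cnj s) x"
  by (simp add: coh_def exp_cnj)

lemma cmod_coh: "cmod (coh s x) = exp (- x\<^sup>2 / 2 + 2 * Re s * x - Re (s\<^sup>2))"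
  by (simp add: coh_def)

lemma coh_mult_coh:
  "coh s x * coh t x = exp (- s\<^sup>2 - t\<^sup>2) * exp (- of_real 1 * (of_real x)\<^sup>2 + (2 * (s + t)) * of_real x)"
  unfolding coh_def mult_exp_exp by (rule arg_cong[of _ _ exp]) (simp add: algebra_simps)

text \<open>A bilinear pairing, without conjugation: completing the square leaves (s + t)^2 - s^2 -
  t^2 = 2st. Inner products arise by conjugating a parameter, as in \<open>cnj_coh\<close>.\<close>

lemma has_bochner_integral_coh_coh:
  "has_bochner_integral lborel (\<lambda>x. coh s x * coh t x) (of_real (sqrt pi) * exp (2 * s * t))"
proof -
  have e: "exp (- s\<^sup>2 - t\<^sup>2) * (of_real (sqrt (pi / 1)) * exp ((2 * (s + t))\<^sup>2 / (4 * of_real 1)))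
     = of_real (sqrt pi) * exp (2 * s * t)"
    unfolding mult.left_commute[of "exp (- s\<^sup>2 - t\<^sup>2)"] mult_exp_exp
    by (simp add: power2_eq_square) (simp add: field_simps)
  show ?thesis
    unfolding coh_mult_coh
    by (rule has_bochner_integral_mult_right[OF has_bochner_integral_gaussian[of 1 "2 * (s + t)"],
          of "exp (- s\<^sup>2 - t\<^sup>2)", unfolded e]) simp
qed

lemma coh_square: "(cmod (coh s x))\<^sup>2 = Re (coh s x * coh (cnj s) x)"
  unfolding cnj_coh[symmetric] cmod_power2 by (simp add: power2_eq_square)

lemma coh_L2: "coh s \<in> L2"
proof -
  have "integrable lborel (\<lambda>x. Re (coh s x * coh (cnj s) x))"
    using has_bochner_integral_coh_coh[of s "cnj s"]
    by (intro integrable_Re) (simp only: has_bochner_integral_iff)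
  then show ?thesis by (simp add: L2_def coh_square del: times_complex.sel)
qed

lemma integral_coh_square: "(\<integral>x. (cmod (coh s x))\<^sup>2 \<partial>lborel) = sqrt pi * exp (2 * (cmod s)\<^sup>2)"
proof -
  have "(\<integral>x. (cmod (coh s x))\<^sup>2 \<partial>lborel) = Re (\<integral>x. coh s x * coh (cnj s) x \<partial>lborel)"
    unfolding coh_square
    by (rule integral_Re) (use has_bochner_integral_coh_coh[of s "cnj s"] in \<open>unfold has_bochner_integral_iff, blast\<close>)
  also have "(\<integral>x. coh s x * coh (cnj s) x \<partial>lborel) = of_real (sqrt pi) * exp (2 * s * cnj s)"
    using has_bochner_integral_coh_coh[of s "cnj s"] by (simp add: has_bochner_integral_iff)
  also have "2 * s * cnj s = of_real (2 * (cmod s)\<^sup>2)"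
    using complex_norm_square[of s] by (simp add: mult_ac)
  finally show ?thesis by (simp add: exp_of_real del: of_real_mult of_real_power)
qed

text \<open>Imaginary parameters suffice. For s = -it/2 the conjugate of \<open>coh s\<close> is a
  constant times e^(itx) times the Gaussian, so orthogonality says that the Fourier transform of g
  times the Gaussian vanishes. The Gaussian also makes this product integrable, which g alone need
  not be.\<close>

lemma coh_total:
  assumes g: "g \<in> L2" and z: "\<And>s. L2_inner g (coh s) = 0"
  shows "AE x in lborel. g x = 0"
proof -
  have i: "integrable lborel (\<lambda>x. g x * coh 0 x)"
    using g coh_L2[of 0] by (intro integrable_mult_L2) (auto simp: L2_eq_Lsp)
  have "AE x in lborel. g x * coh 0 x = 0"
  proof (rule complex_fourier_unique[OF i])
    fix t
    define s where "s = - \<i> * of_real t / 2"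
    have "cnj (coh s x) = exp ((of_real t)\<^sup>2 / 4) * (coh 0 x * iexp (t * x))" for x
      unfolding cnj_coh unfolding coh_def mult_exp_exp
      by (rule arg_cong[of _ _ exp]) (simp add: s_def power2_eq_square algebra_simps)
    then have "L2_inner g (coh s) = (\<integral>x. exp ((of_real t)\<^sup>2 / 4) * (g x * coh 0 x * iexp (t * x)) \<partial>lborel)"
      by (simp add: L2_inner_def mult_ac)
    also have "\<dots> = exp ((of_real t)\<^sup>2 / 4) * (\<integral>x. g x * coh 0 x * iexp (t * x) \<partial>lborel)"
      by (rule integral_mult_right_zero)
    finally show "(\<integral>x. g x * coh 0 x * iexp (t * x) \<partial>lborel) = 0" using z[of s] by simp
  qed
  then show ?thesis by eventually_elim (simp add: coh_def)
qed

section \<open>Hermite expansions\<close>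

text \<open>An exponential majorant suits Gaussian weights: multiplied by e^(-x^2 + bx) it yields
  Gaussians with a shifted linear term, so integrability and decay at infinity reduce to pure
  Gaussians.\<close>

lemma poly_exp_bound:
  fixes q :: "real poly"
  shows "\<exists>C k. 0 \<le> C \<and> (\<forall>x. \<bar>poly q x\<bar> \<le> C * exp (real k * \<bar>x\<bar>))"
proof (induction q)
  case 0
  show ?case by (intro exI[of _ 0]) auto
next
  case (pCons a q)
  then obtain C k where C: "0 \<le> C" "\<And>x. \<bar>poly q x\<bar> \<le> C * exp (real k * \<bar>x\<bar>)" by blast
  have "\<bar>poly (pCons a q) x\<bar> \<le> (\<bar>a\<bar> + C) * exp (real (Suc k) * \<bar>x\<bar>)" for x
  proof -
    have "\<bar>x\<bar> \<le> exp \<bar>x\<bar>" using exp_ge_add_one_self[of "\<bar>x\<bar>"] by linarith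
    then have "\<bar>x\<bar> * \<bar>poly q x\<bar> \<le> exp \<bar>x\<bar> * (C * exp (real k * \<bar>x\<bar>))"
      by (intro mult_mono C) auto
    also have "\<dots> = C * exp (real (Suc k) * \<bar>x\<bar>)" by (simp add: exp_add algebra_simps)
    finally have "\<bar>x * poly q x\<bar> \<le> C * exp (real (Suc k) * \<bar>x\<bar>)" by (simp add: abs_mult)
    moreover have "\<bar>a\<bar> * 1 \<le> \<bar>a\<bar> * exp (real (Suc k) * \<bar>x\<bar>)" by (intro mult_left_mono) auto
    ultimately show ?thesis using abs_triangle_ineq[of a "x * poly q x"] by (simp add: distrib_right)
  qed
  then show ?case using C(1) by (intro exI[of _ "\<bar>a\<bar> + C"] exI[of _ "Suc k"]) auto
qed

text \<open>The product of the two factors e^(-x^2/2) of a pair of states, with linear term b: b = 0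
  for two Hermite functions, b = 2s for a Hermite function and \<open>coh s\<close>. The coefficient
  \<open>of_real 1\<close> keeps the shape of \<open>has_bochner_integral_gaussian\<close>.\<close>

definition gweight :: "complex \<Rightarrow> real \<Rightarrow> complex" where
  "gweight b x = exp (- of_real 1 * (of_real x)\<^sup>2 + b * of_real x)"

lemma cmod_gweight: "cmod (gweight b x) = exp (- x\<^sup>2 + Re b * x)"
  by (simp add: gweight_def)

lemma gweight_measurable [measurable]: "gweight b \<in> borel_measurable borel"
  unfolding gweight_def[abs_def] by (intro borel_measurable_continuous_onI continuous_intros)

lemma has_bochner_integral_gweight:
  "has_bochner_integral lborel (gweight b) (of_real (sqrt pi) * exp (b\<^sup>2 / 4))"
  using has_bochner_integral_gaussian[of 1 b] by (simp add: gweight_def[abs_def])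

lemma poly_gweight_bound:
  obtains C k where "0 \<le> C" "\<And>x. cmod (of_real (poly q x) * gweight b x)
     \<le> C * (exp (- x\<^sup>2 + (Re b + k) * x) + exp (- x\<^sup>2 + (Re b - k) * x))"
proof -
  obtain C k where C: "0 \<le> C" "\<And>x. \<bar>poly q x\<bar> \<le> C * exp (real k * \<bar>x\<bar>)"
    using poly_exp_bound by blast
  have "cmod (of_real (poly q x) * gweight b x)
     \<le> C * (exp (- x\<^sup>2 + (Re b + k) * x) + exp (- x\<^sup>2 + (Re b - k) * x))" for x
  proof -
    have "cmod (of_real (poly q x) * gweight b x) \<le> C * exp (real k * \<bar>x\<bar>) * exp (- x\<^sup>2 + Re b * x)"
      unfolding norm_mult cmod_gweight using C(2) by (intro mult_right_mono) auto
    also have "exp (real k * \<bar>x\<bar>) \<le> exp (k * x) + exp (- k * x)"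
      by (cases "x \<ge> 0") (auto simp: add_increasing add_increasing2)
    finally have "cmod (of_real (poly q x) * gweight b x)
       \<le> C * (exp (k * x) + exp (- k * x)) * exp (- x\<^sup>2 + Re b * x)"
      using C(1) by (simp add: mult_left_mono mult_right_mono)
    also have "\<dots> = C * (exp (- x\<^sup>2 + (Re b + k) * x) + exp (- x\<^sup>2 + (Re b - k) * x))"
      by (simp add: distrib_left distrib_right mult_exp_exp mult.assoc) (simp add: algebra_simps)
    finally show ?thesis .
  qed
  then show ?thesis using C(1) that by blast
qed

lemma integrable_real_gweight: "integrable lborel (\<lambda>x::real. exp (- x\<^sup>2 + c * x))"
  using integrable_norm[of lborel "gweight (of_real c)"] has_bochner_integral_gweight[of "of_real c"]
  by (simp add: cmod_gweight has_bochner_integral_iff)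

lemma integrable_poly_gweight: "integrable lborel (\<lambda>x. of_real (poly q x) * gweight b x)"
proof -
  obtain C k where C: "0 \<le> C" "\<And>x. cmod (of_real (poly q x) * gweight b x)
     \<le> C * (exp (- x\<^sup>2 + (Re b + k) * x) + exp (- x\<^sup>2 + (Re b - k) * x))"
    using poly_gweight_bound[of q b] by blast
  have [measurable]: "(\<lambda>x. poly q x) \<in> borel_measurable borel"
    by (intro borel_measurable_continuous_onI continuous_intros)
  have "integrable lborel (\<lambda>x. C * (exp (- x\<^sup>2 + (Re b + k) * x) + exp (- x\<^sup>2 + (Re b - k) * x)))"
    by (intro integrable_mult_right Bochner_Integration.integrable_add integrable_real_gweight)
  then show ?thesis
    by (rule Bochner_Integration.integrable_bound) (use C in \<open>auto intro!: AE_I2 order_trans[OF C(2)]\<close>)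
qed

definition gint :: "complex \<Rightarrow> real poly \<Rightarrow> complex" where
  "gint b q = (\<integral>x. of_real (poly q x) * gweight b x \<partial>lborel)"

lemma gint_add: "gint b (p + q) = gint b p + gint b q"
  by (simp add: gint_def distrib_right integrable_poly_gweight)

lemma gint_diff: "gint b (p - q) = gint b p - gint b q"
  by (simp add: gint_def left_diff_distrib integrable_poly_gweight)

lemma gint_smult: "gint b (smult c q) = of_real c * gint b q"
  by (simp add: gint_def mult.assoc)

lemma gint_1: "gint b 1 = of_real (sqrt pi) * exp (b\<^sup>2 / 4)"
  using has_bochner_integral_gweight[of b] by (simp add: gint_def has_bochner_integral_iff)

text \<open>The function q e^(-x^2 + bx) vanishes at both ends and has an integrable derivative,
  whose integral is therefore 0; the product rule splits this integral into the three terms.\<close>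

lemma gint_by_parts: "gint b (pderiv q) = gint b ([:0, 2:] * q) - b * gint b q"
proof -
  define F where "F x = of_real (poly q x) * gweight b x" for x
  define f where "f x = of_real (poly (pderiv q) x) * gweight b x - of_real (poly ([:0, 2:] * q) x) * gweight b x
     + b * (of_real (poly q x) * gweight b x)" for x
  have gw: "(gweight b has_vector_derivative (gweight b x * (b - 2 * of_real x))) (at x)" for x
    unfolding gweight_def[abs_def]
    by (rule has_vector_derivative_real_field) (auto intro!: derivative_eq_intros)
  have pq: "((\<lambda>x. complex_of_real (poly q x)) has_vector_derivative of_real (poly (pderiv q) x)) (at x)" for x
    by (rule has_vector_derivative_of_real) (simp add: poly_DERIV has_real_derivative_iff_has_vector_derivative[symmetric])
  have dF: "(F has_vector_derivative f x) (at x)" for x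
    using has_vector_derivative_mult[OF pq gw] unfolding F_def f_def by (simp add: algebra_simps)
  have cont: "isCont f x" for x
    unfolding f_def gweight_def by (intro continuous_intros)
  have int: "integrable lborel f"
    unfolding f_def
    by (intro Bochner_Integration.integrable_add Bochner_Integration.integrable_diff integrable_mult_right integrable_poly_gweight)
  obtain C k where C: "0 \<le> C" "\<And>x. cmod (F x)
     \<le> C * (exp (- x\<^sup>2 + (Re b + k) * x) + exp (- x\<^sup>2 + (Re b - k) * x))"
    unfolding F_def using poly_gweight_bound[of q b] by blast
  have top: "(F \<longlongrightarrow> 0) at_top"
  proof (rule Lim_null_comparison)
    show "\<forall>\<^sub>F x in at_top. cmod (F x) \<le> C * (exp (- x\<^sup>2 + (Re b + k) * x) + exp (- x\<^sup>2 + (Re b - k) * x))"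
      using C(2) by simp
    show "((\<lambda>x. C * (exp (- x\<^sup>2 + (Re b + k) * x) + exp (- x\<^sup>2 + (Re b - k) * x))) \<longlongrightarrow> 0) at_top"
      by (rule tendsto_mult_right_zero, rule tendsto_add_zero; real_asymp)
  qed
  have bot: "(F \<longlongrightarrow> 0) at_bot"
  proof (rule Lim_null_comparison)
    show "\<forall>\<^sub>F x in at_bot. cmod (F x) \<le> C * (exp (- x\<^sup>2 + (Re b + k) * x) + exp (- x\<^sup>2 + (Re b - k) * x))"
      using C(2) by simp
    show "((\<lambda>x. C * (exp (- x\<^sup>2 + (Re b + k) * x) + exp (- x\<^sup>2 + (Re b - k) * x))) \<longlongrightarrow> 0) at_bot"
      by (rule tendsto_mult_right_zero, rule tendsto_add_zero; real_asymp)
  qed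
  have "(LBINT x=-\<infinity>..\<infinity>. f x) = 0 - 0"
    by (rule interval_integral_FTC_integrable[where F = F])
      (use dF cont int top bot in \<open>auto simp: set_integrable_def ereal_tendsto_simps\<close>)
  then have "(\<integral>x. f x \<partial>lborel) = 0"
    by (simp add: interval_lebesgue_integral_def set_lebesgue_integral_def)
  moreover have "(\<integral>x. f x \<partial>lborel) = gint b (pderiv q) - gint b ([:0, 2:] * q) + b * gint b q"
    unfolding f_def gint_def
    by (subst Bochner_Integration.integral_add Bochner_Integration.integral_diff integral_mult_right_zero;
        (intro integrable_poly_gweight integrable_mult_right Bochner_Integration.integrable_diff)?)+
      (rule refl)
  ultimately show ?thesis by (simp add: algebra_simps)
qed

text \<open>Integration by parts makes 2x - d/dx, which raises the index of a Hermite polynomial,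
  the adjoint of d/dx + b with respect to the weight. Moving it onto q lowers the index.\<close>

lemma gint_hermite_Suc: "gint b (hermite_poly (Suc n) * q) = gint b (hermite_poly n * pderiv q) + b * gint b (hermite_poly n * q)"
proof -
  have "hermite_poly (Suc n) * q = [:0, 2:] * (hermite_poly n * q) - pderiv (hermite_poly n) * q"
    by (simp add: left_diff_distrib del: mult_pCons_left)
  moreover have "pderiv (hermite_poly n * q) = hermite_poly n * pderiv q + pderiv (hermite_poly n) * q"
    by (simp add: pderiv_mult mult_ac)
  ultimately show ?thesis
    using gint_by_parts[of b "hermite_poly n * q"] by (simp add: gint_add gint_diff algebra_simps)
qed

lemma gint_hermite: "gint b (hermite_poly n) = b ^ n * (of_real (sqrt pi) * exp (b\<^sup>2 / 4))"
proof (induction n)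
  case (Suc n)
  have "gint b 0 = 0" by (simp add: gint_def)
  then show ?case using gint_hermite_Suc[of b n 1] Suc.IH by simp
qed (simp add: gint_1)

text \<open>At b = 0, raising one index is adjoint to differentiating the other factor, and the
  derivative of the m-th polynomial is 2m times its predecessor. Both indices thus drop together
  until one is 0, where the integral vanishes unless both are.\<close>

lemma gint_hermite_hermite:
  "gint 0 (hermite_poly n * hermite_poly m) = (if n = m then of_real (2 ^ n * fact n * sqrt pi) else 0)"
proof (induction n arbitrary: m)
  case 0
  have "gint 0 (hermite_poly m) = (if m = 0 then of_real (sqrt pi) else 0)"
    by (simp add: gint_hermite power_0_left)
  then show ?case by simp
next
  case (Suc n)
  show ?case
  proof (cases m)
    case 0
    then show ?thesis using gint_hermite[of 0 "Suc n"] by simp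
  next
    case (Suc k)
    have "gint 0 (hermite_poly (Suc n) * hermite_poly m) = of_real (2 * real (Suc k)) * gint 0 (hermite_poly n * hermite_poly k)"
      unfolding gint_hermite_Suc Suc pderiv_hermite_poly by (simp add: gint_smult)
    then show ?thesis unfolding Suc.IH Suc by (simp add: mult_ac)
  qed
qed

section \<open>The Hermite functions as an orthonormal system\<close>

definition hermite_norm :: "nat \<Rightarrow> real" where
  "hermite_norm n = sqrt (2 ^ n * fact n * sqrt pi)"

lemma hermite_norm: "hermite_norm n > 0" "(hermite_norm n)\<^sup>2 = 2 ^ n * fact n * sqrt pi"
  by (simp_all add: hermite_norm_def)

lemma hermite_measurable [measurable]: "hermite n \<in> borel_measurable borel"
  unfolding hermite_def[abs_def] hermite_fun_def
  by (intro borel_measurable_continuous_onI continuous_intros) auto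

lemma hermite_mult: "hermite n x * cnj (hermite m x) =
   of_real (poly (hermite_poly n * hermite_poly m) x) * gweight 0 x / of_real (hermite_norm n * hermite_norm m)"
proof -
  have "complex_of_real (exp (- x\<^sup>2 / 2)) * of_real (exp (- x\<^sup>2 / 2)) = gweight 0 x"
    unfolding exp_of_real[symmetric] mult_exp_exp gweight_def by (rule arg_cong[of _ _ exp]) simp
  then show ?thesis
    by (simp add: hermite_def hermite_fun_def hermite_norm_def mult_ac)
qed

lemma hermite_L2: "hermite n \<in> L2"
proof -
  have "integrable lborel (\<lambda>x. hermite n x * cnj (hermite n x))"
    unfolding hermite_mult by (intro integrable_divide integrable_poly_gweight)
  then have "integrable lborel (\<lambda>x. complex_of_real ((cmod (hermite n x))\<^sup>2))"
    by (simp only: complex_norm_square)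
  then show ?thesis unfolding complex_of_real_integrable_eq by (simp add: L2_def)
qed

lemma hermite_orthonormal: "L2_inner (hermite n) (hermite m) = (if n = m then 1 else 0)"
proof -
  have "L2_inner (hermite n) (hermite m) = gint 0 (hermite_poly n * hermite_poly m) / of_real (hermite_norm n * hermite_norm m)"
    unfolding L2_inner_def hermite_mult gint_def by (rule integral_divide_zero)
  also have "\<dots> = (if n = m then 1 else 0)"
    using hermite_norm[of n] by (cases "n = m") (auto simp: gint_hermite_hermite power2_eq_square simp flip: of_real_mult)
  finally show ?thesis .
qed

text \<open>The parameter enters only through its n-th power. Multiplying s by z therefore
  multiplies the n-th coefficient by z^n, which is how a phase proportional to n acts on a coherent
  state.\<close>

lemma L2_inner_coh_hermite: "L2_inner (coh s) (hermite n) = of_real (sqrt pi) * (2 * s) ^ n / of_real (hermite_norm n)"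
proof -
  have e: "coh s x * cnj (hermite n x) = exp (- s\<^sup>2) * (of_real (poly (hermite_poly n) x) * gweight (2 * s) x) / of_real (hermite_norm n)" for x
  proof -
    have "coh s x * of_real (exp (- x\<^sup>2 / 2)) = exp (- s\<^sup>2) * gweight (2 * s) x"
      unfolding coh_def gweight_def exp_of_real[symmetric] mult_exp_exp
      by (rule arg_cong[of _ _ exp]) simp
    moreover have "cnj (hermite n x) = of_real (poly (hermite_poly n) x) * of_real (exp (- x\<^sup>2 / 2)) / of_real (hermite_norm n)"
      by (simp add: hermite_def hermite_fun_def hermite_norm_def)
    ultimately show ?thesis by (simp add: mult_ac)
  qed
  have "L2_inner (coh s) (hermite n) = exp (- s\<^sup>2) * gint (2 * s) (hermite_poly n) / of_real (hermite_norm n)"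
    unfolding L2_inner_def e gint_def by simp
  also have "\<dots> = (2 * s) ^ n * of_real (sqrt pi) * (exp (- s\<^sup>2) * exp (s\<^sup>2)) / of_real (hermite_norm n)"
    by (simp add: gint_hermite power_mult_distrib)
  also have "exp (- s\<^sup>2) * exp (s\<^sup>2) = 1" by (simp add: mult_exp_exp)
  finally show ?thesis by (simp add: mult_ac)
qed

abbreviation sqn :: "(real \<Rightarrow> complex) \<Rightarrow> real" where
  "sqn f \<equiv> (LINT x|lborel. (cmod (f x))\<^sup>2)"

lemma integrable_L2_inner: "f \<in> L2 \<Longrightarrow> g \<in> L2 \<Longrightarrow> integrable lborel (\<lambda>x. f x * cnj (g x))"
  by (intro integrable_mult_L2 Lsp_cnj) (auto simp: L2_eq_Lsp)

lemma L2_inner_lincomb: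
  assumes "f \<in> L2" "g \<in> L2" "h \<in> L2"
  shows "L2_inner (\<lambda>x. a * f x + b * g x) h = a * L2_inner f h + b * L2_inner g h"
proof -
  have "L2_inner (\<lambda>x. a * f x + b * g x) h = (\<integral>x. a * (f x * cnj (h x)) + b * (g x * cnj (h x)) \<partial>lborel)"
    unfolding L2_inner_def by (simp add: algebra_simps)
  also have "\<dots> = a * L2_inner f h + b * L2_inner g h"
    unfolding L2_inner_def using integrable_L2_inner assms by simp
  finally show ?thesis .
qed

lemma L2_inner_cnj: "L2_inner g f = cnj (L2_inner f g)"
  unfolding L2_inner_def by (subst Bochner_Integration.integral_cnj[symmetric]) (simp add: mult.commute)

lemma L2_lincomb: "f \<in> L2 \<Longrightarrow> g \<in> L2 \<Longrightarrow> (\<lambda>x. a * f x + b * g x) \<in> L2"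
  unfolding L2_eq_Lsp by (rule Lsp_lincomb)

lemma hermite_sum_L2: "(\<lambda>x. \<Sum>n<N. a n * hermite n x) \<in> L2"
  unfolding L2_eq_Lsp using hermite_L2 by (intro Lsp_sum Lsp_scale) (auto simp: L2_eq_Lsp)

lemma L2_inner_hermite_sum:
  assumes "f \<in> L2"
  shows "L2_inner (\<lambda>x. \<Sum>n<N. a n * hermite n x) f = (\<Sum>n<N. a n * L2_inner (hermite n) f)"
proof (induction N)
  case 0
  then show ?case by (simp add: L2_inner_def)
next
  case (Suc N)
  show ?case
    using L2_inner_lincomb[of "\<lambda>x. \<Sum>n<N. a n * hermite n x" "hermite N" f 1 "a N"]
      hermite_sum_L2[of a N] hermite_L2[of N] assms Suc by simp
qed

lemma sqn_hermite_sum: "sqn (\<lambda>x. \<Sum>n<N. a n * hermite n x) = (\<Sum>n<N. (cmod (a n))\<^sup>2)"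
proof (induction N)
  case (Suc N)
  let ?P = "\<lambda>x. \<Sum>n<N. a n * hermite n x"
  have "sqn (\<lambda>x. \<Sum>n<Suc N. a n * hermite n x) = sqn (\<lambda>x. ?P x + a N * hermite N x)" by simp
  also have "\<dots> = sqn ?P + 2 * Re (\<integral>x. ?P x * cnj (a N * hermite N x) \<partial>lborel) + sqn (\<lambda>x. a N * hermite N x)"
    using hermite_sum_L2 hermite_L2 by (intro integral_square_add Lsp_scale) (auto simp: L2_eq_Lsp)
  also have "(\<integral>x. ?P x * cnj (a N * hermite N x) \<partial>lborel) = (\<integral>x. cnj (a N) * (?P x * cnj (hermite N x)) \<partial>lborel)"
    by (simp add: mult_ac)
  also have "\<dots> = cnj (a N) * L2_inner ?P (hermite N)"
    unfolding L2_inner_def by (rule integral_mult_right_zero)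
  also have "\<dots> = 0"
    by (auto simp: L2_inner_hermite_sum[OF hermite_L2] hermite_orthonormal)
  also have "sqn (\<lambda>x. a N * hermite N x) = (cmod (a N))\<^sup>2 * sqn (hermite N)"
    by (rule integral_square_scale)
  also have "sqn (hermite N) = 1"
  proof -
    have "complex_of_real (sqn (hermite N)) = L2_inner (hermite N) (hermite N)"
      unfolding L2_inner_def complex_norm_square[symmetric] by (rule integral_complex_of_real[symmetric])
    then show ?thesis by (simp add: hermite_orthonormal)
  qed
  finally show ?case using Suc by simp
qed simp

lemma sqn_diff_hermite_sum:
  assumes f: "f \<in> L2"
  shows "sqn (\<lambda>x. f x - (\<Sum>n<N. L2_inner f (hermite n) * hermite n x)) = sqn f - (\<Sum>n<N. (cmod (L2_inner f (hermite n)))\<^sup>2)"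
proof -
  let ?P = "\<lambda>x. \<Sum>n<N. L2_inner f (hermite n) * hermite n x"
  have "sqn (\<lambda>x. f x + - 1 * ?P x) = sqn f + 2 * Re (\<integral>x. f x * cnj (- 1 * ?P x) \<partial>lborel) + sqn (\<lambda>x. - 1 * ?P x)"
    using f hermite_sum_L2 by (intro integral_square_add Lsp_scale) (auto simp: L2_eq_Lsp)
  also have "(\<integral>x. f x * cnj (- 1 * ?P x) \<partial>lborel) = - L2_inner f ?P"
    unfolding L2_inner_def by simp
  also have "L2_inner f ?P = cnj (L2_inner ?P f)" by (rule L2_inner_cnj)
  also have "L2_inner ?P f = (\<Sum>n<N. of_real ((cmod (L2_inner f (hermite n)))\<^sup>2))"
    unfolding L2_inner_hermite_sum[OF f] complex_norm_square
    by (intro sum.cong refl) (simp add: L2_inner_cnj[of _ f])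
  finally show ?thesis by (simp add: sqn_hermite_sum)
qed

lemma Bessel: "f \<in> L2 \<Longrightarrow> (\<Sum>n<N. (cmod (L2_inner f (hermite n)))\<^sup>2) \<le> sqn f"
proof -
  assume f: "f \<in> L2"
  have "0 \<le> sqn (\<lambda>x. f x - (\<Sum>n<N. L2_inner f (hermite n) * hermite n x))" by simp
  then show ?thesis unfolding sqn_diff_hermite_sum[OF f] by simp
qed

section \<open>The truncated propagator and the flow of coherent states\<close>

lemma propagator_partial_L2: "propagator_partial N t f \<in> L2"
  unfolding propagator_partial_def[abs_def] by (rule hermite_sum_L2)

lemma sqn_propagator_partial: "f \<in> L2 \<Longrightarrow> sqn (propagator_partial N t f) \<le> sqn f"
  using Bessel[of f N] by (simp add: propagator_partial_def sqn_hermite_sum norm_mult)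

lemma propagator_partial_lincomb:
  assumes "f \<in> L2" "g \<in> L2"
  shows "propagator_partial N t (\<lambda>x. a * f x + b * g x) x = a * propagator_partial N t f x + b * propagator_partial N t g x"
  using assms by (simp add: propagator_partial_def L2_inner_lincomb hermite_L2 algebra_simps sum.distrib sum_distrib_left)

text \<open>Parseval's identity by direct summation: the squared coefficients sqrt(pi) (2|s|^2)^n /
  n! add up to sqrt(pi) e^(2|s|^2), which is the squared norm of \<open>coh s\<close>. Hence the
  remainder of the expansion tends to 0.\<close>

lemma hermite_expansion_coh:
  "(\<lambda>N. sqn (\<lambda>x. coh s x - (\<Sum>n<N. L2_inner (coh s) (hermite n) * hermite n x))) \<longlonglongrightarrow> 0"
proof -
  have sq: "(cmod (L2_inner (coh s) (hermite n)))\<^sup>2 = sqrt pi * ((2 * (cmod s)\<^sup>2) ^ n /\<^sub>R fact n)" for n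
  proof -
    have "(cmod (L2_inner (coh s) (hermite n)))\<^sup>2 = pi * (4 ^ n * (cmod s)\<^sup>2 ^ n) / (2 ^ n * fact n * sqrt pi)"
    proof -
      have "((2::real) ^ n)\<^sup>2 = 4 ^ n" "(cmod s ^ n)\<^sup>2 = (cmod s)\<^sup>2 ^ n"
        by (simp_all add: power2_eq_square flip: power_mult_distrib)
      then show ?thesis
        by (simp add: L2_inner_coh_hermite norm_mult norm_divide norm_power power_divide power_mult_distrib hermite_norm)
    qed
    also have "\<dots> = sqrt pi * ((2 * (cmod s)\<^sup>2) ^ n / fact n)"
    proof -
      have "(4::real) ^ n = 2 ^ n * 2 ^ n" by (simp flip: power_mult_distrib)
      moreover have "(P * P) * (A * A * c) / (A * F * P) = P * (A * c / F)" if "P \<noteq> 0" "A \<noteq> 0" "F \<noteq> 0" for P A c F :: real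
        using that by (simp add: divide_simps)
      from this[of "sqrt pi" "2 ^ n" "fact n" "(cmod s)\<^sup>2 ^ n"] have
        "pi * (2 ^ n * 2 ^ n * (cmod s)\<^sup>2 ^ n) / (2 ^ n * fact n * sqrt pi) = sqrt pi * (2 ^ n * (cmod s)\<^sup>2 ^ n / fact n)"
        by simp
      ultimately show ?thesis by (simp add: power_mult_distrib)
    qed
    finally show ?thesis by (simp add: divide_inverse mult_ac)
  qed
  have "(\<lambda>n. (cmod (L2_inner (coh s) (hermite n)))\<^sup>2) sums (sqrt pi * exp (2 * (cmod s)\<^sup>2))"
    unfolding sq by (intro sums_mult exp_converges)
  then have "(\<lambda>N. sqn (coh s) - (\<Sum>n<N. (cmod (L2_inner (coh s) (hermite n)))\<^sup>2)) \<longlonglongrightarrow> sqn (coh s) - sqrt pi * exp (2 * (cmod s)\<^sup>2)"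
    unfolding sums_def by (intro tendsto_diff tendsto_const)
  then show ?thesis
    by (simp add: sqn_diff_hermite_sum[OF coh_L2] integral_coh_square)
qed

text \<open>Splits off the ground-state phase and writes the rest as an n-th power, to be merged
  with the (2s)^n of \<open>L2_inner_coh_hermite\<close>.\<close>

lemma cis_power_phase: "exp (\<i> * of_real (t * (2 * real n + 1))) = exp (\<i> * of_real t) * exp (2 * \<i> * of_real t) ^ n"
  by (simp add: exp_of_nat_mult[symmetric] mult_exp_exp) (simp add: algebra_simps)

text \<open>Pairs an initial datum with an explicit flow, given at every t and x. As an inductive
  relation it has linearity built in, and properties of data and flows are proved together by rule
  induction.\<close>

inductive evolves :: "(real \<Rightarrow> complex) \<Rightarrow> (real \<Rightarrow> real \<Rightarrow> complex) \<Rightarrow> bool" where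
  evolves_coh: "evolves (coh s) (\<lambda>t x. exp (\<i> * of_real t) * coh (exp (2 * \<i> * of_real t) * s) x)"
| evolves_lin: "evolves f u \<Longrightarrow> evolves g v \<Longrightarrow>
    evolves (\<lambda>x. a * f x + b * g x) (\<lambda>t x. a * u t x + b * v t x)"

lemma evolves_L2: "evolves f u \<Longrightarrow> f \<in> L2 \<and> u t \<in> L2"
proof (induction rule: evolves.induct)
  case (evolves_coh s)
  show ?case using coh_L2 Lsp_scale[of "coh (exp (2 * \<i> * of_real t) * s)" 2 lborel] by (simp add: L2_eq_Lsp)
qed (auto intro: L2_lincomb)

lemma evolves_propagator_partial:
  "evolves f u \<Longrightarrow> (\<lambda>N. sqn (\<lambda>x. u t x - propagator_partial N t f x)) \<longlonglongrightarrow> 0"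
proof (induction rule: evolves.induct)
  case (evolves_coh s)
  let ?z = "exp (2 * \<i> * of_real t)"
  have "sqn (\<lambda>x. exp (\<i> * of_real t) * coh (?z * s) x - propagator_partial N t (coh s) x) =
     sqn (\<lambda>x. coh (?z * s) x - (\<Sum>n<N. L2_inner (coh (?z * s)) (hermite n) * hermite n x))" for N
  proof -
    have "propagator_partial N t (coh s) x = exp (\<i> * of_real t) * (\<Sum>n<N. L2_inner (coh (?z * s)) (hermite n) * hermite n x)" for x
      unfolding propagator_partial_def sum_distrib_left
      unfolding cis_power_phase L2_inner_coh_hermite by (intro sum.cong refl) (simp add: power_mult_distrib mult_ac)
    then have eq: "exp (\<i> * of_real t) * coh (?z * s) x - propagator_partial N t (coh s) x =
        exp (\<i> * of_real t) * (coh (?z * s) x - (\<Sum>n<N. L2_inner (coh (?z * s)) (hermite n) * hermite n x))" for x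
      by (simp add: right_diff_distrib)
    show ?thesis unfolding eq norm_mult by simp
  qed
  then show ?case using hermite_expansion_coh[of "?z * s"] by simp
next
  case (evolves_lin f u g v a b)
  have L: "(\<lambda>x. u t x - propagator_partial N t f x) \<in> Lsp 2 lborel" "(\<lambda>x. v t x - propagator_partial N t g x) \<in> Lsp 2 lborel" for N
    using evolves_L2[OF evolves_lin.hyps(1)] evolves_L2[OF evolves_lin.hyps(2)] propagator_partial_L2
    by (auto simp: L2_eq_Lsp intro!: Lsp_diff)
  let ?E = "\<lambda>N. 2 * ((cmod a)\<^sup>2 * sqn (\<lambda>x. u t x - propagator_partial N t f x)) + 2 * ((cmod b)\<^sup>2 * sqn (\<lambda>x. v t x - propagator_partial N t g x))"
  have "sqn (\<lambda>x. a * u t x + b * v t x - propagator_partial N t (\<lambda>x. a * f x + b * g x) x) \<le> ?E N" for N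
  proof -
    have "sqn (\<lambda>x. a * u t x + b * v t x - propagator_partial N t (\<lambda>x. a * f x + b * g x) x)
       = sqn (\<lambda>x. a * (u t x - propagator_partial N t f x) + b * (v t x - propagator_partial N t g x))"
      using evolves_L2[OF evolves_lin.hyps(1)] evolves_L2[OF evolves_lin.hyps(2)]
      by (simp add: propagator_partial_lincomb algebra_simps)
    also have "\<dots> \<le> ?E N"
      unfolding integral_square_scale[symmetric] using L by (intro integral_square_add_le Lsp_scale)
    finally show ?thesis .
  qed
  note le = this
  have "?E \<longlonglongrightarrow> 2 * ((cmod a)\<^sup>2 * 0) + 2 * ((cmod b)\<^sup>2 * 0)"
    by (intro tendsto_add tendsto_mult tendsto_const evolves_lin.IH)
  then have E: "?E \<longlonglongrightarrow> 0" by simp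
  show ?case
    by (rule Lim_null_comparison[OF _ E]) (use le in simp)
qed

text \<open>The truncated propagator is a contraction by Bessel's inequality, and the flow is its
  limit. The factor 2 comes from |a + b|^2 \<le> 2|a|^2 + 2|b|^2; what counts is uniformity in
  t.\<close>

lemma evolves_sqn:
  assumes "evolves f u"
  shows "sqn (u t) \<le> 2 * sqn f"
proof -
  have L: "f \<in> L2" "u t \<in> Lsp 2 lborel" "propagator_partial N t f \<in> Lsp 2 lborel" for N
    using evolves_L2[OF assms] propagator_partial_L2 by (auto simp: L2_eq_Lsp)
  have "sqn (u t) \<le> 2 * sqn (\<lambda>x. u t x - propagator_partial N t f x) + 2 * sqn f" for N
  proof -
    have "sqn (\<lambda>x. (u t x - propagator_partial N t f x) + propagator_partial N t f x) \<le>
        2 * sqn (\<lambda>x. u t x - propagator_partial N t f x) + 2 * sqn (propagator_partial N t f)"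
      using L by (intro integral_square_add_le Lsp_diff)
    then show ?thesis using sqn_propagator_partial[OF L(1), of N t] by simp
  qed
  moreover have "(\<lambda>N. 2 * sqn (\<lambda>x. u t x - propagator_partial N t f x) + 2 * sqn f) \<longlonglongrightarrow> 2 * 0 + 2 * sqn f"
    by (intro tendsto_add tendsto_mult tendsto_const evolves_propagator_partial assms)
  ultimately show ?thesis by (intro LIMSEQ_le_const) auto
qed

lemma evolves_measurable:
  "evolves f u \<Longrightarrow> (\<lambda>p. u (fst p) (snd p)) \<in> borel_measurable (borel \<Otimes>\<^sub>M borel)"
proof (induction rule: evolves.induct)
  case (evolves_coh s)
  show ?case unfolding coh_def borel_prod
    by (intro borel_measurable_continuous_onI continuous_intros) auto
next
  case (evolves_lin f u g v a b)
  then show ?case by (intro borel_measurable_add borel_measurable_times) auto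
qed

text \<open>The flow only turns the phase of the parameter, so its modulus, and with it the bound,
  does not depend on t. The rate 1/4 makes the fourth power decay like e^(-x^2).\<close>

lemma evolves_gaussian_bound:
  "evolves f u \<Longrightarrow> \<exists>C. 0 \<le> C \<and> (\<forall>t x. cmod (u t x) \<le> C * exp (- x\<^sup>2 / 4))"
proof (induction rule: evolves.induct)
  case (evolves_coh s)
  have "cmod (exp (\<i> * of_real t) * coh (exp (2 * \<i> * of_real t) * s) x) \<le> exp (5 * (cmod s)\<^sup>2) * exp (- x\<^sup>2 / 4)" for t x
  proof -
    let ?w = "exp (2 * \<i> * of_real t) * s"
    have w: "cmod ?w = cmod s" by (simp add: norm_mult)
    have "Re ?w * x \<le> cmod s * \<bar>x\<bar>"
      using abs_Re_le_cmod[of ?w] unfolding w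
      by (metis abs_ge_self abs_mult mult_right_mono abs_ge_zero order_trans)
    \<comment> \<open>Half of this inequality bounds the linear term of the exponent, 2|s||x| \<le>
      x^2/4 + 4|s|^2, and leaves half of the decay -x^2/2. The term with the square of the parameter
      adds one more |s|^2, whence the constant 5.\<close>
    moreover have "4 * (cmod s * \<bar>x\<bar>) \<le> (x\<^sup>2 / 2) + 8 * (cmod s)\<^sup>2"
      using zero_le_power2[of "\<bar>x\<bar> - 4 * cmod s"] by (simp add: power2_diff power_mult_distrib algebra_simps)
    moreover have "- Re (?w\<^sup>2) \<le> (cmod s)\<^sup>2"
      using abs_Re_le_cmod[of "?w\<^sup>2"] unfolding norm_power w by linarith
    ultimately have "- x\<^sup>2 / 2 + 2 * Re ?w * x - Re (?w\<^sup>2) \<le> 5 * (cmod s)\<^sup>2 + - x\<^sup>2 / 4"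
      by linarith
    then show ?thesis unfolding norm_mult cmod_coh mult_exp_exp by simp
  qed
  then show ?case by (intro exI[of _ "exp (5 * (cmod s)\<^sup>2)"]) auto
next
  case (evolves_lin f u g v a b)
  then obtain C D where C: "0 \<le> C" "\<And>t x. cmod (u t x) \<le> C * exp (- x\<^sup>2 / 4)"
    and D: "0 \<le> D" "\<And>t x. cmod (v t x) \<le> D * exp (- x\<^sup>2 / 4)" by blast
  have "cmod (a * u t x + b * v t x) \<le> (cmod a * C + cmod b * D) * exp (- x\<^sup>2 / 4)" for t x
  proof -
    have "cmod (a * u t x + b * v t x) \<le> cmod a * cmod (u t x) + cmod b * cmod (v t x)"
      by (metis norm_mult norm_triangle_ineq)
    also have "\<dots> \<le> cmod a * (C * exp (- x\<^sup>2 / 4)) + cmod b * (D * exp (- x\<^sup>2 / 4))"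
      by (intro add_mono mult_left_mono C D) auto
    finally show ?thesis by (simp add: algebra_simps)
  qed
  then show ?case using C D by (intro exI[of _ "cmod a * C + cmod b * D"]) auto
qed

lemma evolves_dense:
  assumes f: "f \<in> L2" and e: "e > 0"
  shows "\<exists>g u. evolves g u \<and> sqn (\<lambda>x. f x - g x) < e"
proof -
  have "\<exists>v\<in>{g. \<exists>u. evolves g u}. (\<integral>x. (cmod (f x - v x))\<^sup>2 \<partial>lborel) < e"
  proof (rule dense_if_orthogonal_trivial)
    show "{g. \<exists>u. evolves g u} \<subseteq> Lsp 2 lborel" using evolves_L2 by (auto simp: L2_eq_Lsp)
    show "{g. \<exists>u. evolves g u} \<noteq> {}" using evolves_coh by blast
    show "AE x in lborel. g x = 0" if "g \<in> Lsp 2 lborel"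
      "\<And>v. v \<in> {g. \<exists>u. evolves g u} \<Longrightarrow> (\<integral>x. g x * cnj (v x) \<partial>lborel) = 0" for g
      by (rule coh_total) (use that evolves_coh in \<open>auto simp: L2_eq_Lsp L2_inner_def\<close>)
  qed (use f e in \<open>auto simp: L2_eq_Lsp intro: evolves_lin\<close>)
  then show ?thesis by auto
qed

section \<open>Integration over three-space\<close>

text \<open>The third coordinate comes first because it is the argument of the last function, the
  one paired by duality: in iterated integrals it is then the outer variable and the pair of the
  other two is the inner one.\<close>

definition vec3 :: "real \<times> real \<times> real \<Rightarrow> real^3" where
  "vec3 p = (\<chi> i. if i = 1 then fst (snd p) else if i = 2 then snd (snd p) else fst p)"

lemma vec3_nth [simp]: "vec3 (c, a, b) $ 1 = a" "vec3 (c, a, b) $ 2 = b" "vec3 (c, a, b) $ 3 = c"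
  by (simp_all add: vec3_def)

lemma vec3_measurable [measurable]: "vec3 \<in> borel_measurable borel"
proof (rule borel_measurable_continuous_onI)
  show "continuous_on UNIV vec3"
    unfolding vec3_def[abs_def]
  proof (rule continuous_on_vec_lambda)
    fix i :: 3
    show "continuous_on UNIV (\<lambda>p. if i = 1 then fst (snd p) else if i = 2 then snd (snd p) else fst p :: real)"
      by (cases "i = 1"; cases "i = 2") (auto intro!: continuous_intros)
  qed
qed

lemma Basis_real3_prod: "(\<Prod>b\<in>Basis. f b) = f (axis 1 1) * f (axis 2 1) * f (axis 3 1)"
  for f :: "real^3 \<Rightarrow> 'a::comm_monoid_mult"
proof -
  have B: "(Basis :: (real^3) set) = (\<lambda>i::3. axis i (1::real)) ` UNIV"
    by (auto simp: Basis_vec_def)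
  have inj: "inj (\<lambda>i::3. axis i (1::real))"
    by (auto simp: inj_def axis_eq_axis)
  have "(\<Prod>b\<in>Basis. f b) = (\<Prod>i\<in>UNIV. f (axis i 1))"
    unfolding B prod.reindex[OF inj] by simp
  also have "\<dots> = f (axis 1 1) * f (axis 2 1) * f (axis 3 1)"
    unfolding UNIV_3 by (simp add: ac_simps)
  finally show ?thesis .
qed

lemma emeasure_lborel_Times:
  fixes A :: "'a::euclidean_space set" and B :: "'b::euclidean_space set"
  assumes "A \<in> sets borel" "B \<in> sets borel"
  shows "emeasure lborel (A \<times> B) = emeasure lborel A * emeasure lborel B"
  by (subst lborel_prod[symmetric], rule lborel.emeasure_pair_measure_Times) (use assms in auto)

lemma distr_vec3: "distr lborel borel vec3 = lborel"
proof (rule lborel_eqI[symmetric])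
  fix l u :: "real^3"
  assume lu: "\<And>b. b \<in> Basis \<Longrightarrow> l \<bullet> b \<le> u \<bullet> b"
  have le: "l $ i \<le> u $ i" for i using lu[of "axis i 1"] by (simp add: inner_axis)
  have "vec3 -` box l u = {l$3<..<u$3} \<times> ({l$1<..<u$1} \<times> {l$2<..<u$2})"
    by (auto simp: mem_box_cart forall_3)
  then have "emeasure (distr lborel borel vec3) (box l u) = emeasure lborel ({l$3<..<u$3} \<times> ({l$1<..<u$1} \<times> {l$2<..<u$2}))"
    by (simp add: emeasure_distr)
  also have "\<dots> = ennreal (u$3 - l$3) * (ennreal (u$1 - l$1) * ennreal (u$2 - l$2))"
    using le by (simp add: emeasure_lborel_Times borel_Times)
  also have "\<dots> = ennreal (\<Prod>b\<in>Basis. (u - l) \<bullet> b)"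
    using le by (simp add: Basis_real3_prod inner_axis ennreal_mult[symmetric] mult_ac)
  finally show "emeasure (distr lborel borel vec3) (box l u) = ennreal (\<Prod>b\<in>Basis. (u - l) \<bullet> b)" .
qed simp

text \<open>Lebesgue measure is determined by its values on boxes, and the preimage of a box is its
  image under the inverse isometry, which has the same volume.\<close>

lemma distr_orthogonal:
  fixes f :: "real^('n::{finite,wellorder}) \<Rightarrow> real^'n::_"
  assumes f: "orthogonal_transformation f"
  shows "distr lborel borel f = lborel"
proof (rule lborel_eqI[symmetric])
  have [measurable]: "f \<in> borel_measurable borel"
    using f by (intro borel_measurable_continuous_onI linear_continuous_on)
      (auto simp: orthogonal_transformation_def linear_conv_bounded_linear)
  fix l u :: "real^'n::{finite,wellorder}"
  assume lu: "\<And>b. b \<in> Basis \<Longrightarrow> l \<bullet> b \<le> u \<bullet> b"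
  have T: "orthogonal_transformation (inv f)" using f by (rule orthogonal_transformation_inv)
  have "bij f" using f by (rule orthogonal_transformation_bij)
  then have pre: "f -` box l u = inv f ` box l u" by (simp add: bij_vimage_eq_inv_image)
  have box: "box l u \<in> lmeasurable" by (rule lmeasurable_box)
  have m: "measure lebesgue (inv f ` box l u) = measure lebesgue (box l u)"
    using T box by (rule measure_orthogonal_image)
  have lm: "inv f ` box l u \<in> lmeasurable" using T box by (rule measurable_orthogonal_image)
  have pre_sets: "f -` box l u \<in> sets borel"
    using measurable_sets[of f borel borel "box l u"] by simp
  have "emeasure (distr lborel borel f) (box l u) = emeasure lebesgue (f -` box l u)"
    using pre_sets by (simp add: emeasure_distr)
  also have "\<dots> = emeasure lebesgue (box l u)"
    unfolding pre using emeasure_eq_measure2[OF lm] emeasure_eq_measure2[OF box] m by simp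
  also have "\<dots> = ennreal (\<Prod>b\<in>Basis. (u - l) \<bullet> b)"
    using lu by simp
  finally show "emeasure (distr lborel borel f) (box l u) = ennreal (\<Prod>b\<in>Basis. (u - l) \<bullet> b)" .
qed simp

lemma nn_integral_real3:
  assumes [measurable]: "g \<in> borel_measurable borel"
  shows "(\<integral>\<^sup>+x. g x \<partial>lborel) = (\<integral>\<^sup>+c. \<integral>\<^sup>+a. \<integral>\<^sup>+b. g (vec3 (c, a, b)) \<partial>lborel \<partial>lborel \<partial>lborel)"
proof -
  have "(\<integral>\<^sup>+x. g x \<partial>lborel) = (\<integral>\<^sup>+p. g (vec3 p) \<partial>(lborel \<Otimes>\<^sub>M lborel))"
    by (subst distr_vec3[symmetric], subst nn_integral_distr) (simp_all add: lborel_prod)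
  also have "\<dots> = (\<integral>\<^sup>+c. \<integral>\<^sup>+q. g (vec3 (c, q)) \<partial>lborel \<partial>lborel)"
    by (subst lborel.nn_integral_fst[symmetric]) (simp_all add: lborel_prod)
  also have "\<dots> = (\<integral>\<^sup>+c. \<integral>\<^sup>+q. g (vec3 (c, q)) \<partial>(lborel \<Otimes>\<^sub>M lborel) \<partial>lborel)"
    by (simp add: lborel_prod)
  also have "\<dots> = (\<integral>\<^sup>+c. \<integral>\<^sup>+a. \<integral>\<^sup>+b. g (vec3 (c, a, b)) \<partial>lborel \<partial>lborel \<partial>lborel)"
    by (subst lborel.nn_integral_fst[symmetric]) (simp_all add: lborel_prod)
  finally show ?thesis .
qed

lemma component_measurable [measurable]: "(\<lambda>x::real^3. x $ i) \<in> borel_measurable borel"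
  by (intro borel_measurable_continuous_onI continuous_intros)

lemma nn_integral_real3_prod:
  assumes [measurable]: "g1 \<in> borel_measurable borel" "g2 \<in> borel_measurable borel" "g3 \<in> borel_measurable borel"
  shows "(\<integral>\<^sup>+(x::real^3). g1 (x$1) * g2 (x$2) * g3 (x$3) \<partial>lborel) =
    (\<integral>\<^sup>+x. g1 x \<partial>lborel) * (\<integral>\<^sup>+x. g2 x \<partial>lborel) * (\<integral>\<^sup>+x. g3 x \<partial>(lborel :: real measure))"
  by (subst nn_integral_real3) (simp_all add: nn_integral_cmult nn_integral_multc mult_ac)

text \<open>The preimage of a null set of the line under a coordinate is its product with two full
  lines, of measure 0 times infinity times infinity, which is 0 in \<open>ennreal\<close>.\<close>

lemma AE_component:
  fixes i :: 3
  assumes "AE y in lborel. P y"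
  shows "AE (x::real^3) in lborel. P (x $ i)"
proof -
  from AE_E[OF assms] obtain N where N: "{y. \<not> P y} \<subseteq> N" "N \<in> sets borel" "emeasure lborel N = 0" by auto
  note [measurable] = N(2)
  define A where "A j = (if i = j then N else UNIV)" for j :: 3
  have A: "A j \<in> sets borel" for j by (simp add: A_def)
  note [measurable] = A
  have AN: "emeasure lborel (A i) = 0" by (simp add: A_def N)
  have "(\<integral>\<^sup>+(x::real^3). indicator N (x $ i) \<partial>lborel) = (\<integral>\<^sup>+(x::real^3). indicator (A 1) (x$1) * indicator (A 2) (x$2) * indicator (A 3) (x$3) \<partial>lborel)"
    using exhaust_3[of i] by (intro nn_integral_cong) (auto simp: A_def)
  also have "\<dots> = emeasure lborel (A 1) * emeasure lborel (A 2) * emeasure lborel (A 3)"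
    by (subst nn_integral_real3_prod) auto
  also have "\<dots> = 0" using exhaust_3[of i] AN by auto
  finally have "AE (x::real^3) in lborel. indicator N (x $ i) = (0::ennreal)"
    by (subst (asm) nn_integral_0_iff_AE) auto
  then show ?thesis by eventually_elim (use N(1) in \<open>auto simp: indicator_def split: if_splits\<close>)
qed

text \<open>The matrix of the rotation. It shows that the rotated coordinates are jointly continuous
  in \<theta> and x, and supplies the linear form in \<open>E_iso_coh\<close>.\<close>

lemma S_rot_nth:
  "S_rot \<theta> x $ 1 = cos \<theta> * x$1 + sin \<theta> / sqrt 2 * (x$3 - x$2)"
  "S_rot \<theta> x $ 2 = sin \<theta> / sqrt 2 * x$1 + (1 + cos \<theta>) / 2 * x$2 + (1 - cos \<theta>) / 2 * x$3"
  "S_rot \<theta> x $ 3 = - sin \<theta> / sqrt 2 * x$1 + (1 - cos \<theta>) / 2 * x$2 + (1 + cos \<theta>) / 2 * x$3"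
proof -
  define v where "v = (vector [0, 1, 1] :: real^3)"
  have v: "v$1 = 0" "v$2 = 1" "v$3 = 1" by (simp_all add: v_def)
  have "norm v = sqrt 2"
    by (simp add: norm_eq_sqrt_inner inner_vec_def sum_3 v)
  then have k: "sgn v = (1 / sqrt 2) *\<^sub>R v" by (simp add: sgn_div_norm divide_inverse)
  have s: "1 / sqrt 2 * (1 / sqrt 2) = 1/2" by simp
  show "S_rot \<theta> x $ 1 = cos \<theta> * x$1 + sin \<theta> / sqrt 2 * (x$3 - x$2)"
    "S_rot \<theta> x $ 2 = sin \<theta> / sqrt 2 * x$1 + (1 + cos \<theta>) / 2 * x$2 + (1 - cos \<theta>) / 2 * x$3"
    "S_rot \<theta> x $ 3 = - sin \<theta> / sqrt 2 * x$1 + (1 - cos \<theta>) / 2 * x$2 + (1 + cos \<theta>) / 2 * x$3"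
    unfolding S_rot_def rotation_about_def v_def[symmetric] k Let_def
    by (simp_all add: cross3_def v inner_vec_def sum_3 field_simps)
qed

lemma S_rot_nth_measurable [measurable]:
  "(\<lambda>p. S_rot (fst p) (snd p) $ i) \<in> borel_measurable (borel \<Otimes>\<^sub>M borel)"
proof -
  have "(\<lambda>p. S_rot (fst p) (snd p) $ 1) \<in> borel_measurable borel"
    "(\<lambda>p. S_rot (fst p) (snd p) $ 2) \<in> borel_measurable borel"
    "(\<lambda>p. S_rot (fst p) (snd p) $ 3) \<in> borel_measurable borel"
    unfolding S_rot_nth by (intro borel_measurable_continuous_onI continuous_intros; simp)+
  then show ?thesis using exhaust_3[of i] by (auto simp: borel_prod)
qed

section \<open>The functionals of the rotations on L^2\<close>

text \<open>Makes the density a product of one rotated and one conjugated function in L^2 of R^3, so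
  that Cauchy-Schwarz and the invariance of volume apply.\<close>

definition tensor3 :: "(real \<Rightarrow> complex) \<Rightarrow> (real \<Rightarrow> complex) \<Rightarrow> (real \<Rightarrow> complex) \<Rightarrow> real^3 \<Rightarrow> complex" where
  "tensor3 f g h x = f (x$1) * g (x$2) * h (x$3)"

lemma tensor3_measurable [measurable]:
  assumes "f \<in> borel_measurable borel" "g \<in> borel_measurable borel" "h \<in> borel_measurable borel"
  shows "tensor3 f g h \<in> borel_measurable borel"
  unfolding tensor3_def[abs_def] using assms by measurable

lemma L2_borel: "f \<in> L2 \<Longrightarrow> f \<in> borel_measurable borel"
  by (simp add: L2_def)

lemma nn_integral_L2: "f \<in> L2 \<Longrightarrow> (\<integral>\<^sup>+x. ennreal ((cmod (f x))\<^sup>2) \<partial>lborel) = ennreal (sqn f)"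
  by (simp add: L2_def nn_integral_eq_integral)

lemma tensor3_L2:
  assumes "f \<in> L2" "g \<in> L2" "h \<in> L2"
  shows "tensor3 f g h \<in> Lsp 2 lborel" "(LINT x|lborel. (cmod (tensor3 f g h x))\<^sup>2) = sqn f * sqn g * sqn h"
proof -
  note [measurable] = assms[THEN L2_borel]
  have "(\<integral>\<^sup>+x. ennreal ((cmod (tensor3 f g h x))\<^sup>2) \<partial>lborel) =
     (\<integral>\<^sup>+(x::real^3). ennreal ((cmod (f (x$1)))\<^sup>2) * ennreal ((cmod (g (x$2)))\<^sup>2) * ennreal ((cmod (h (x$3)))\<^sup>2) \<partial>lborel)"
    by (simp add: tensor3_def norm_mult power_mult_distrib ennreal_mult)
  also have "\<dots> = ennreal (sqn f * sqn g * sqn h)"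
    by (subst nn_integral_real3_prod) (simp_all add: nn_integral_L2 assms ennreal_mult)
  finally have n: "(\<integral>\<^sup>+x. ennreal ((cmod (tensor3 f g h x))\<^sup>2) \<partial>lborel) = ennreal (sqn f * sqn g * sqn h)" .
  have i: "integrable lborel (\<lambda>x. (cmod (tensor3 f g h x))\<^sup>2)"
    by (rule integrableI_nonneg) (use n in auto)
  then show "tensor3 f g h \<in> Lsp 2 lborel" by (simp add: Lsp_def)
  show "(LINT x|lborel. (cmod (tensor3 f g h x))\<^sup>2) = sqn f * sqn g * sqn h"
    by (rule integral_eq_nn_integral[THEN trans]) (simp_all add: n)
qed

lemma S_rot_measurable [measurable]: "S_rot \<theta> \<in> borel_measurable borel"
  using orthogonal_transformation_S_rot[of \<theta>]
  by (intro borel_measurable_continuous_onI linear_continuous_on)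
    (auto simp: orthogonal_transformation_def linear_conv_bounded_linear)

lemma distr_S_rot: "distr lborel borel (S_rot \<theta>) = lborel"
  by (rule distr_orthogonal[OF orthogonal_transformation_S_rot])

lemma L2_S_rot:
  assumes "F \<in> Lsp 2 lborel"
  shows "(\<lambda>x. F (S_rot \<theta> x)) \<in> Lsp 2 lborel" "(LINT x|lborel. (cmod (F (S_rot \<theta> x)))\<^sup>2) = (LINT x|lborel. (cmod (F x))\<^sup>2)"
proof -
  have [measurable]: "F \<in> borel_measurable borel" using assms by (simp add: Lsp_def)
  have "integrable lborel (\<lambda>x. (cmod (F (S_rot \<theta> x)))\<^sup>2) \<longleftrightarrow> integrable (distr lborel borel (S_rot \<theta>)) (\<lambda>x. (cmod (F x))\<^sup>2)"
    by (subst integrable_distr_eq) auto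
  then show "(\<lambda>x. F (S_rot \<theta> x)) \<in> Lsp 2 lborel" using assms by (simp add: Lsp_def distr_S_rot)
  have "(LINT x|distr lborel borel (S_rot \<theta>). (cmod (F x))\<^sup>2) = (LINT x|lborel. (cmod (F (S_rot \<theta> x)))\<^sup>2)"
    by (subst integral_distr) auto
  then show "(LINT x|lborel. (cmod (F (S_rot \<theta> x)))\<^sup>2) = (LINT x|lborel. (cmod (F x))\<^sup>2)"
    by (simp add: distr_S_rot)
qed

lemma AE_S_rot:
  fixes P :: "real^3 \<Rightarrow> bool"
  assumes "AE x in lborel. P x"
  shows "AE x in lborel. P (S_rot \<theta> x)"
proof -
  have "AE x in distr lborel borel (S_rot \<theta>). P x" unfolding distr_S_rot by (rule assms)
  then show ?thesis by (rule AE_distrD[rotated]) simp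
qed

lemma E_density_eq: "E_density A f1 f2 f3 f4 f5 f6 x = tensor3 f1 f2 f3 (A x) * cnj (tensor3 f4 f5 f6 x)"
  by (simp add: E_density_def tensor3_def)

lemma integrable_E_density:
  assumes "f1 \<in> L2" "f2 \<in> L2" "f3 \<in> L2" "f4 \<in> L2" "f5 \<in> L2" "f6 \<in> L2"
  shows "integrable lborel (E_density (S_rot \<theta>) f1 f2 f3 f4 f5 f6)"
  unfolding E_density_eq[abs_def]
  by (intro integrable_mult_L2 Lsp_cnj L2_S_rot tensor3_L2 assms)

lemma E_iso_bound:
  assumes "f1 \<in> L2" "f2 \<in> L2" "f3 \<in> L2" "f4 \<in> L2" "f5 \<in> L2" "f6 \<in> L2"
  shows "(cmod (E_iso (S_rot \<theta>) f1 f2 f3 f4 f5 f6))\<^sup>2 \<le> (sqn f1 * sqn f2 * sqn f3) * (sqn f4 * sqn f5 * sqn f6)"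
proof -
  have "(cmod (E_iso (S_rot \<theta>) f1 f2 f3 f4 f5 f6))\<^sup>2 \<le>
     (LINT x|lborel. (cmod (tensor3 f1 f2 f3 (S_rot \<theta> x)))\<^sup>2) * (LINT x|lborel. (cmod (cnj (tensor3 f4 f5 f6 x)))\<^sup>2)"
    unfolding E_iso_def E_density_eq
    by (intro Cauchy_Schwarz_Lsp Lsp_cnj L2_S_rot tensor3_L2 assms)
  then show ?thesis using assms by (simp add: L2_S_rot tensor3_L2)
qed

lemma E_density_measurable:
  assumes "f1 \<in> L2" "f2 \<in> L2" "f3 \<in> L2" "f4 \<in> L2" "f5 \<in> L2" "f6 \<in> L2"
  shows "(\<lambda>p. E_density (S_rot (fst p)) f1 f2 f3 f4 f5 f6 (snd p)) \<in> borel_measurable (borel \<Otimes>\<^sub>M borel)"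
proof -
  note [measurable] = assms[THEN L2_borel]
  show ?thesis unfolding E_density_def by measurable
qed

lemma E_iso_measurable:
  assumes "f1 \<in> L2" "f2 \<in> L2" "f3 \<in> L2" "f4 \<in> L2" "f5 \<in> L2" "f6 \<in> L2"
  shows "(\<lambda>\<theta>. E_iso (S_rot \<theta>) f1 f2 f3 f4 f5 f6) \<in> borel_measurable borel"
proof -
  have "(\<lambda>(\<theta>, x). E_density (S_rot \<theta>) f1 f2 f3 f4 f5 f6 x) \<in> borel_measurable (borel \<Otimes>\<^sub>M lborel)"
    using E_density_measurable[OF assms] by (simp add: split_beta' cong: measurable_cong_sets)
  then show ?thesis unfolding E_iso_def by (rule lborel.borel_measurable_lebesgue_integral)
qed

lemma set_integrable_E_iso:
  assumes "f1 \<in> L2" "f2 \<in> L2" "f3 \<in> L2" "f4 \<in> L2" "f5 \<in> L2" "f6 \<in> L2"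
  shows "set_integrable lborel {a..b} (\<lambda>\<theta>. E_iso (S_rot \<theta>) f1 f2 f3 f4 f5 f6)"
proof -
  note [measurable] = E_iso_measurable[OF assms]
  show ?thesis
    unfolding set_integrable_def
  proof (rule integrableI_bounded_set_indicator)
    show "AE x\<in>{a..b} in lborel. norm (E_iso (S_rot x) f1 f2 f3 f4 f5 f6)
        \<le> sqrt ((sqn f1 * sqn f2 * sqn f3) * (sqn f4 * sqn f5 * sqn f6))"
      by (intro AE_I2 impI real_le_rsqrt E_iso_bound assms)
  qed (auto simp: emeasure_lborel_Icc_eq)
qed

section \<open>Gaussian integrals\<close>

lemma integral_cis:
  "(LINT \<alpha>:{0..2*pi}|lborel. cis (of_int m * \<alpha>)) = (if m = 0 then of_real (2 * pi) else 0)"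
proof (cases "m = 0")
  case True
  then show ?thesis by (simp add: set_lebesgue_integral_def scaleR_conv_of_real)
next
  case False
  define k where "k = real_of_int m"
  have k: "k \<noteq> 0" using False by (simp add: k_def)
  have d: "((\<lambda>\<alpha>. cis (k * \<alpha>) / (\<i> * of_real k)) has_vector_derivative cis (k * \<alpha>)) (at \<alpha> within {0..2*pi})" for \<alpha>
  proof -
    have "((\<lambda>z. exp (\<i> * of_real k * z) / (\<i> * of_real k)) has_field_derivative exp (\<i> * of_real k * of_real \<alpha>)) (at (of_real \<alpha>))"
      using k by (auto intro!: derivative_eq_intros)
    from has_vector_derivative_real_field[OF this] show ?thesis
      by (simp add: cis_conv_exp mult.assoc)
  qed
  have "(\<integral>\<alpha>. indicator {0..2*pi} \<alpha> *\<^sub>R cis (k * \<alpha>) \<partial>lborel) = cis (k * (2*pi)) / (\<i> * of_real k) - cis (k * 0) / (\<i> * of_real k)"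
    by (rule integral_FTC_Icc) (use d in \<open>auto intro!: continuous_intros\<close>)
  also have "cis (k * (2*pi)) = 1"
    using cis_multiple_2pi[of k] by (simp add: k_def mult_ac)
  finally show ?thesis using False by (simp add: set_lebesgue_integral_def k_def)
qed

lemma finite_measure_restrict_Icc: "finite_measure (restrict_space lborel {a..b::real})"
  by (rule finite_measureI) (simp add: emeasure_restrict_space space_restrict_space emeasure_lborel_Icc_eq)

lemma integrable_restrict_Icc_bounded:
  fixes f :: "real \<Rightarrow> 'a::{banach,second_countable_topology}"
  assumes "f \<in> borel_measurable borel" "\<And>x. norm (f x) \<le> B"
  shows "integrable (restrict_space lborel {a..b}) f"
proof -
  interpret finite_measure "restrict_space lborel {a..b}" by (rule finite_measure_restrict_Icc)
  show ?thesis
    by (rule integrable_const_bound[where B = B]) (use assms in \<open>auto intro: measurable_restrict_space1\<close>)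
qed

lemma set_lebesgue_integral_restrict:
  fixes f :: "real \<Rightarrow> complex"
  shows "(LINT x:{a..b}|lborel. f x) = (LINT x|restrict_space lborel {a..b}. f x)"
  by (simp add: set_lebesgue_integral_def integral_restrict_space)

text \<open>Expanding the exponential, only the monomials \<open>a\<^sup>k b\<^sup>k\<close> survive the integration.\<close>

lemma circle_integral_exp_eq:
  fixes a b c d :: complex
  assumes "a * b = c * d"
  shows "(LINT \<alpha>:{0..2*pi}|lborel. exp (a * cis \<alpha> + b * cis (- \<alpha>))) =
    (LINT \<alpha>:{0..2*pi}|lborel. exp (c * cis \<alpha> + d * cis (- \<alpha>)))"
proof -
  define M where "M = restrict_space lborel {0..2*pi}"
  interpret M: finite_measure M unfolding M_def by (rule finite_measure_restrict_Icc)
  \<comment> \<open>Expanding the n-th power gives the frequencies k - (n - k) = 2k - n. The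
    integral over the full circle kills all but 2k = n, where the coefficients contribute
    (ab)^k.\<close>
  define I where "I k n = (LINT \<alpha>|M. cis (of_int (2 * int k - int n) * \<alpha>))" for k n :: nat
  have icis: "integrable M (\<lambda>\<alpha>. cis (r * \<alpha>))" for r
    unfolding M_def by (rule integrable_restrict_Icc_bounded[where B = 1])
      (auto intro!: borel_measurable_continuous_onI continuous_intros)
  have binom: "(LINT \<alpha>|M. (a * cis \<alpha> + b * cis (- \<alpha>)) ^ n) = (\<Sum>k\<le>n. of_nat (n choose k) * a ^ k * b ^ (n - k) * I k n)"
    for a b n
  proof -
    have "(a * cis \<alpha> + b * cis (- \<alpha>)) ^ n = (\<Sum>k\<le>n. of_nat (n choose k) * a ^ k * b ^ (n - k) * cis (of_int (2 * int k - int n) * \<alpha>))" for \<alpha>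
    proof -
      have "cis \<alpha> ^ k * cis (- \<alpha>) ^ (n - k) = cis (of_int (2 * int k - int n) * \<alpha>)" if "k \<le> n" for k
        unfolding Complex.DeMoivre cis_mult using that by (intro arg_cong[of _ _ cis]) (simp add: of_nat_diff algebra_simps)
      then show ?thesis
        unfolding binomial_ring by (intro sum.cong refl) (simp add: power_mult_distrib mult_ac)
    qed
    then show ?thesis
      unfolding I_def using icis by simp
  qed
  have I0: "I k n = 0" if "2 * k \<noteq> n" for k n
    using integral_cis[of "2 * int k - int n"] that
    unfolding set_lebesgue_integral_restrict M_def[symmetric] I_def by (simp split: if_splits)
  have pow: "(LINT \<alpha>|M. (a * cis \<alpha> + b * cis (- \<alpha>)) ^ n) = (LINT \<alpha>|M. (c * cis \<alpha> + d * cis (- \<alpha>)) ^ n)" for n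
    unfolding binom
  proof (intro sum.cong refl)
    fix k
    show "of_nat (n choose k) * a ^ k * b ^ (n - k) * I k n = of_nat (n choose k) * c ^ k * d ^ (n - k) * I k n"
    proof (cases "2 * k = n")
      case True
      then have "n - k = k" by simp
      then show ?thesis using assms by (simp add: mult.assoc power_mult_distrib[symmetric])
    qed (simp add: I0)
  qed
  \<comment> \<open>Integration term by term is justified by the convergent majorant B^n / n! with B
    = |a| + |b|, on a circle of finite length.\<close>
  have sums: "(\<lambda>n. (LINT \<alpha>|M. (a * cis \<alpha> + b * cis (- \<alpha>)) ^ n /\<^sub>R fact n)) sums (LINT \<alpha>|M. exp (a * cis \<alpha> + b * cis (- \<alpha>)))"
    for a b
  proof -
    let ?w = "\<lambda>\<alpha>. a * cis \<alpha> + b * cis (- \<alpha>)"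
    define B where "B = cmod a + cmod b"
    have w: "cmod (?w \<alpha>) \<le> B" for \<alpha>
      unfolding B_def by (rule order_trans[OF norm_triangle_ineq]) (simp add: norm_mult)
    have m: "(\<lambda>\<alpha>. ?w \<alpha> ^ n /\<^sub>R fact n) \<in> borel_measurable borel" for n
      by (intro borel_measurable_continuous_onI continuous_intros)
    have bnd: "norm (?w \<alpha> ^ n /\<^sub>R fact n) \<le> B ^ n / fact n" for \<alpha> n
      using power_mono[OF w[of \<alpha>], of n] by (simp add: norm_power divide_inverse mult_ac)
    have int: "integrable M (\<lambda>\<alpha>. ?w \<alpha> ^ n /\<^sub>R fact n)" for n
      unfolding M_def by (rule integrable_restrict_Icc_bounded[OF m bnd])
    have sB: "summable (\<lambda>n. B ^ n / fact n)"
      using summable_exp[of B] by (simp add: divide_inverse mult.commute)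
    have "(\<lambda>n. (LINT \<alpha>|M. ?w \<alpha> ^ n /\<^sub>R fact n)) sums (LINT \<alpha>|M. (\<Sum>n. ?w \<alpha> ^ n /\<^sub>R fact n))"
    proof (rule sums_integral)
      show "AE \<alpha> in M. summable (\<lambda>n. norm (?w \<alpha> ^ n /\<^sub>R fact n))"
        by (intro AE_I2 summable_comparison_test'[OF sB, of 0]) (use bnd in simp)
      show "summable (\<lambda>n. LINT \<alpha>|M. norm (?w \<alpha> ^ n /\<^sub>R fact n))"
      proof (rule summable_comparison_test'[where g = "\<lambda>n. measure M (space M) * (B ^ n / fact n)" and N = 0])
        show "summable (\<lambda>n. measure M (space M) * (B ^ n / fact n))" by (intro summable_mult sB)
        fix n
        have "(LINT \<alpha>|M. norm (?w \<alpha> ^ n /\<^sub>R fact n)) \<le> (LINT \<alpha>|M. B ^ n / fact n)"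
          by (rule integral_mono) (use bnd int in \<open>auto simp del: norm_scaleR\<close>)
        then show "norm (LINT \<alpha>|M. norm (?w \<alpha> ^ n /\<^sub>R fact n)) \<le> measure M (space M) * (B ^ n / fact n)" by simp
      qed
    qed (rule int)
    then show ?thesis by (simp add: exp_def)
  qed
  have "(LINT \<alpha>|M. (a * cis \<alpha> + b * cis (- \<alpha>)) ^ n /\<^sub>R fact n) = (LINT \<alpha>|M. (c * cis \<alpha> + d * cis (- \<alpha>)) ^ n /\<^sub>R fact n)" for n
    unfolding integral_scaleR_right pow ..
  then have "(\<lambda>n. (LINT \<alpha>|M. (a * cis \<alpha> + b * cis (- \<alpha>)) ^ n /\<^sub>R fact n)) sums (LINT \<alpha>|M. exp (c * cis \<alpha> + d * cis (- \<alpha>)))"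
    using sums[of c d] by simp
  from sums_unique2[OF sums[of a b] this] show ?thesis
    unfolding set_lebesgue_integral_restrict M_def[symmetric] .
qed

section \<open>Gaussian integrals of products of coherent states\<close>

lemma has_bochner_integral_four_coh:
  "has_bochner_integral lborel (\<lambda>x. coh p1 x * coh p2 x * (coh q1 x * coh q2 x))
     (of_real (sqrt (pi / 2)) * exp ((p1 + p2 + q1 + q2)\<^sup>2 / 2 - (p1\<^sup>2 + p2\<^sup>2 + q1\<^sup>2 + q2\<^sup>2)))"
proof -
  let ?S = "p1 + p2 + q1 + q2" and ?K = "- (p1\<^sup>2 + p2\<^sup>2 + q1\<^sup>2 + q2\<^sup>2)"
  have e: "coh p1 x * coh p2 x * (coh q1 x * coh q2 x) = exp ?K * exp (- of_real 2 * (of_real x)\<^sup>2 + (2 * ?S) * of_real x)" for x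
    unfolding coh_def mult_exp_exp by (rule arg_cong[of _ _ exp]) (simp add: algebra_simps)
  have v: "exp ?K * (of_real (sqrt (pi / 2)) * exp ((2 * ?S)\<^sup>2 / (4 * of_real 2)))
     = of_real (sqrt (pi / 2)) * exp (?S\<^sup>2 / 2 - (p1\<^sup>2 + p2\<^sup>2 + q1\<^sup>2 + q2\<^sup>2))"
    unfolding mult.left_commute[of "exp ?K"] mult_exp_exp
    by (rule arg_cong[of _ _ "\<lambda>z. of_real (sqrt (pi / 2)) * exp z"]) (simp add: power2_eq_square field_simps)
  show ?thesis
    unfolding e
    by (rule has_bochner_integral_mult_right[OF has_bochner_integral_gaussian[of 2 "2 * ?S"], of "exp ?K", unfolded v]) simp
qed

lemma pair_integral_mult:
  fixes f :: "'a::euclidean_space \<Rightarrow> complex" and g :: "'b::euclidean_space \<Rightarrow> complex"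
  assumes f: "integrable lborel f" and g: "integrable lborel g"
  shows "integrable lborel (\<lambda>p. f (fst p) * g (snd p))"
    "(LINT p|lborel. f (fst p) * g (snd p)) = (LINT x|lborel. f x) * (LINT x|lborel. g x)"
proof -
  have [measurable]: "f \<in> borel_measurable borel" "g \<in> borel_measurable borel" using f g by auto
  have i: "integrable (lborel \<Otimes>\<^sub>M lborel) (\<lambda>p. f (fst p) * g (snd p))"
    by (rule lborel_pair.Fubini_integrable) (use f g in \<open>auto simp: norm_mult intro!: integrable_mult_left\<close>)
  then show "integrable lborel (\<lambda>p. f (fst p) * g (snd p))" by (simp add: lborel_prod)
  have "(LINT p|(lborel \<Otimes>\<^sub>M lborel). f (fst p) * g (snd p)) = (LINT x|lborel. LINT y|lborel. f x * g y)"
    using lborel_pair.integral_fst'[OF i] by simp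
  then show "(LINT p|lborel. f (fst p) * g (snd p)) = (LINT x|lborel. f x) * (LINT x|lborel. g x)"
    by (simp add: lborel_prod)
qed

lemma integral_real3:
  fixes g :: "real^3 \<Rightarrow> complex"
  assumes "g \<in> borel_measurable borel"
  shows "(LINT x|lborel. g x) = (LINT p|lborel. g (vec3 p))"
  using assms by (subst distr_vec3[symmetric], subst integral_distr) auto

lemma integral_real3_prod:
  fixes g1 g2 g3 :: "real \<Rightarrow> complex"
  assumes "integrable lborel g1" "integrable lborel g2" "integrable lborel g3"
  shows "(LINT x|lborel. g1 (x$(1::3)) * g2 (x$2) * g3 (x$3)) = (LINT x|lborel. g1 x) * (LINT x|lborel. g2 x) * (LINT x|lborel. g3 x)"
proof -
  have [measurable]: "g1 \<in> borel_measurable borel" "g2 \<in> borel_measurable borel" "g3 \<in> borel_measurable borel"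
    using assms by auto
  have "(LINT x|lborel. g1 (x$(1::3)) * g2 (x$2) * g3 (x$3)) = (LINT p|lborel. g3 (fst p) * (g1 (fst (snd p)) * g2 (snd (snd p))))"
    by (subst integral_real3) (auto simp: vec3_def mult_ac)
  also have "\<dots> = (LINT x|lborel. g3 x) * ((LINT x|lborel. g1 x) * (LINT x|lborel. g2 x))"
    using pair_integral_mult[OF assms(3) pair_integral_mult(1)[OF assms(1,2)]] pair_integral_mult(2)[OF assms(1,2)] by simp
  finally show ?thesis by (simp add: mult_ac)
qed

lemma gaussian_eq_coh: "gaussian = coh 0"
  by (simp add: fun_eq_iff gaussian_def coh_def flip: exp_of_real)

lemma gaussian_L2: "gaussian \<in> L2"
  unfolding gaussian_eq_coh by (rule coh_L2)

lemma S_rot_norm: "(S_rot \<theta> x $ 1)\<^sup>2 + (S_rot \<theta> x $ 2)\<^sup>2 + (S_rot \<theta> x $ 3)\<^sup>2 = (x$1)\<^sup>2 + (x$2)\<^sup>2 + (x$3)\<^sup>2"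
proof -
  have "norm (S_rot \<theta> x) = norm x"
    using orthogonal_transformation_S_rot by (rule orthogonal_transformation_norm)
  then have "S_rot \<theta> x \<bullet> S_rot \<theta> x = x \<bullet> x" by (simp add: norm_eq)
  then show ?thesis by (simp add: inner_vec_def sum_3 power2_eq_square)
qed

text \<open>The rotation preserves |x|^2, so the six Gaussian factors combine to e^(-|x|^2) and only
  the linear form sees the angle; the integral then splits over the coordinates. Conjugated
  parameters in the last two slots make the result holomorphic in all four.\<close>

lemma E_iso_coh:
  "E_iso (S_rot \<theta>) gaussian (coh s1) (coh s2) gaussian (coh (cnj r1)) (coh (cnj r2)) =
     of_real (pi * sqrt pi) * exp ((s1 + s2) * (r1 + r2) + (s1 - s2) * (r1 - r2) * of_real (cos \<theta>))"
proof -
  define c where "c = complex_of_real (cos \<theta>)"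
  define \<sigma> where "\<sigma> = complex_of_real (sin \<theta> / sqrt 2)"
  have "(cos \<theta>)\<^sup>2 + 2 * (sin \<theta> / sqrt 2)\<^sup>2 = 1" by (simp add: power_divide)
  from arg_cong[OF this, of complex_of_real] have cs: "c\<^sup>2 + 2 * \<sigma>\<^sup>2 = 1"
    unfolding c_def \<sigma>_def by (simp only: of_real_1 of_real_add of_real_mult of_real_numeral of_real_power)
  \<comment> \<open>The coefficient vector of the linear form is b = R^T (0, s1, s2) + (0, r1, r2)
    for the rotation matrix R. As R is orthogonal, the bilinear square of b minus the squares in K
    leaves the cross term, twice the product of R^T (0, s1, s2) with (0, r1, r2).\<close>
  define b1 where "b1 = \<sigma> * (s1 - s2)"
  define b2 where "b2 = (1 + c) / 2 * s1 + (1 - c) / 2 * s2 + r1"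
  define b3 where "b3 = (1 - c) / 2 * s1 + (1 + c) / 2 * s2 + r2"
  define K where "K = - (s1\<^sup>2 + s2\<^sup>2 + r1\<^sup>2 + r2\<^sup>2)"
  have dens: "E_density (S_rot \<theta>) gaussian (coh s1) (coh s2) gaussian (coh (cnj r1)) (coh (cnj r2)) x =
     exp K * (gweight (2 * b1) (x$1) * gweight (2 * b2) (x$2) * gweight (2 * b3) (x$3))" for x
  proof -
    define y1 y2 y3 where "y1 = complex_of_real (S_rot \<theta> x $ 1)" and "y2 = complex_of_real (S_rot \<theta> x $ 2)"
      and "y3 = complex_of_real (S_rot \<theta> x $ 3)"
    define x1 x2 x3 where "x1 = complex_of_real (x $ 1)" and "x2 = complex_of_real (x $ 2)"
      and "x3 = complex_of_real (x $ 3)"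
    have n: "y1\<^sup>2 + y2\<^sup>2 + y3\<^sup>2 = x1\<^sup>2 + x2\<^sup>2 + x3\<^sup>2"
      unfolding y1_def y2_def y3_def x1_def x2_def x3_def using arg_cong[OF S_rot_norm[of \<theta> x], of complex_of_real]
      by (simp only: of_real_add of_real_power)
    have y2: "y2 = \<sigma> * x1 + (1 + c) / 2 * x2 + (1 - c) / 2 * x3"
      unfolding y2_def S_rot_nth x1_def x2_def x3_def c_def \<sigma>_def by simp
    have y3: "y3 = - \<sigma> * x1 + (1 - c) / 2 * x2 + (1 + c) / 2 * x3"
      unfolding y3_def S_rot_nth x1_def x2_def x3_def c_def \<sigma>_def by simp
    have l: "s1 * y2 + s2 * y3 + r1 * x2 + r2 * x3 = b1 * x1 + b2 * x2 + b3 * x3"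
      unfolding y2 y3 b1_def b2_def b3_def by (simp add: field_simps)
    have "(- y1\<^sup>2 / 2) + (- y2\<^sup>2 / 2 + 2 * s1 * y2 - s1\<^sup>2) + (- y3\<^sup>2 / 2 + 2 * s2 * y3 - s2\<^sup>2)
        + ((- x1\<^sup>2 / 2) + (- x2\<^sup>2 / 2 + 2 * r1 * x2 - r1\<^sup>2) + (- x3\<^sup>2 / 2 + 2 * r2 * x3 - r2\<^sup>2))
       = - (y1\<^sup>2 + y2\<^sup>2 + y3\<^sup>2) / 2 - (x1\<^sup>2 + x2\<^sup>2 + x3\<^sup>2) / 2 + 2 * (s1 * y2 + s2 * y3 + r1 * x2 + r2 * x3) + K"
      by (simp add: K_def field_simps)
    also have "\<dots> = K + ((- 1 * x1\<^sup>2 + 2 * b1 * x1) + (- 1 * x2\<^sup>2 + 2 * b2 * x2) + (- 1 * x3\<^sup>2 + 2 * b3 * x3))"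
      unfolding n l by (simp add: field_simps)
    finally show ?thesis
      unfolding E_density_def gaussian_eq_coh complex_cnj_mult cnj_coh complex_cnj_cnj complex_cnj_zero
      unfolding coh_def gweight_def mult_exp_exp
        y1_def[symmetric] y2_def[symmetric] y3_def[symmetric] x1_def[symmetric] x2_def[symmetric] x3_def[symmetric]
      by simp
  qed
  have gw: "integrable lborel (gweight b)" "(LINT x|lborel. gweight b x) = of_real (sqrt pi) * exp (b\<^sup>2 / 4)" for b
    using has_bochner_integral_gweight[of b] by (auto simp: has_bochner_integral_iff)
  have "E_iso (S_rot \<theta>) gaussian (coh s1) (coh s2) gaussian (coh (cnj r1)) (coh (cnj r2)) =
     exp K * ((of_real (sqrt pi) * exp (b1\<^sup>2)) * (of_real (sqrt pi) * exp (b2\<^sup>2)) * (of_real (sqrt pi) * exp (b3\<^sup>2)))"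
    unfolding E_iso_def dens integral_mult_right_zero
    by (subst integral_real3_prod) (simp_all add: gw power_mult_distrib)
  also have "\<dots> = of_real (sqrt pi * sqrt pi * sqrt pi) * exp (K + b1\<^sup>2 + b2\<^sup>2 + b3\<^sup>2)"
    by (simp add: exp_add mult_ac del: real_sqrt_mult_self)
  also have "K + b1\<^sup>2 + b2\<^sup>2 + b3\<^sup>2 = (s1 + s2) * (r1 + r2) + (s1 - s2) * (r1 - r2) * c"
  proof -
    have \<sigma>2: "\<sigma>\<^sup>2 = (1 - c\<^sup>2) / 2" using cs by (simp add: field_simps)
    have b1_sq: "b1\<^sup>2 = (1 - c\<^sup>2) / 2 * (s1 - s2)\<^sup>2" by (simp add: b1_def power_mult_distrib \<sigma>2)
    show ?thesis
      unfolding K_def b2_def b3_def b1_sq by (simp add: power2_eq_square field_simps)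
  qed
  finally show ?thesis by (simp add: c_def)
qed

section \<open>The identity for coherent states\<close>

interpretation Icc: finite_measure "restrict_space lborel {a..b::real}" for a b
  by (rule finite_measure_restrict_Icc)

interpretation Icc_line: pair_sigma_finite "restrict_space lborel {a..b::real}" "lborel :: real measure" for a b
  by (rule pair_sigma_finite.intro; unfold_locales)

abbreviation slab :: "(real \<times> real) measure" where
  "slab \<equiv> restrict_space lborel {0..pi/2} \<Otimes>\<^sub>M lborel"

abbreviation circle :: "real measure" where
  "circle \<equiv> restrict_space lborel {0..2*pi}"

abbreviation joint :: "(real \<Rightarrow> real \<Rightarrow> 'a) \<Rightarrow> real \<times> real \<Rightarrow> 'a" where
  "joint u \<equiv> \<lambda>p. u (fst p) (snd p)"

lemma measurable_restrict_Icc: "f \<in> borel_measurable borel \<Longrightarrow> f \<in> borel_measurable (restrict_space lborel {a..b::real})"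
  by (rule measurable_restrict_space1) simp

lemma Icc_line_measurable:
  assumes "f \<in> measurable (borel \<Otimes>\<^sub>M borel) N"
  shows "f \<in> measurable (restrict_space lborel {a..b::real} \<Otimes>\<^sub>M (lborel :: real measure)) N"
proof -
  let ?M = "restrict_space lborel {a..b::real} \<Otimes>\<^sub>M (lborel :: real measure)"
  have i: "(\<lambda>x. x) \<in> measurable (restrict_space lborel {a..b::real}) borel"
    by (rule measurable_restrict_Icc) simp
  have f: "fst \<in> measurable ?M borel"
    by (rule measurable_compose[OF measurable_fst i])
  have s: "snd \<in> measurable ?M borel"
    by (rule measurable_compose[OF measurable_snd, of "\<lambda>x. x"]) simp
  have "(\<lambda>p. p) \<in> measurable ?M (borel \<Otimes>\<^sub>M borel)"
    using measurable_Pair[OF f s] by simp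
  from measurable_compose[OF this assms] show ?thesis .
qed

lemma gaussian_bounded_Lsp4:
  assumes u: "joint u \<in> borel_measurable (borel \<Otimes>\<^sub>M borel)"
    and b: "\<And>t x. cmod (u t x) \<le> C * exp (- x\<^sup>2 / 4)"
  shows "joint u \<in> Lsp 4 slab"
proof -
  have g: "integrable lborel (\<lambda>x::real. exp (- x\<^sup>2))"
    using integrable_real_gweight[of 0] by simp
  have m: "(\<lambda>p. exp (- (snd p)\<^sup>2) :: real) \<in> borel_measurable (borel \<Otimes>\<^sub>M borel)" by measurable
  have "integrable slab (\<lambda>p. exp (- (snd p)\<^sup>2) :: real)"
    by (rule Icc_line.Fubini_integrable) (use g Icc_line_measurable[OF m] in auto)
  then have "integrable slab (\<lambda>p. C ^ 4 * exp (- (snd p)\<^sup>2))" by simp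
  then have "integrable slab (\<lambda>p. cmod (u (fst p) (snd p)) ^ 4)"
  proof (rule Bochner_Integration.integrable_bound)
    show "(\<lambda>p. cmod (u (fst p) (snd p)) ^ 4) \<in> borel_measurable slab"
      using Icc_line_measurable[OF u] by measurable
    show "AE p in slab. norm (cmod (u (fst p) (snd p)) ^ 4) \<le> norm (C ^ 4 * exp (- (snd p)\<^sup>2))"
    proof (rule AE_I2)
      fix p :: "real \<times> real"
      have "cmod (u (fst p) (snd p)) ^ 4 \<le> (C * exp (- (snd p)\<^sup>2 / 4)) ^ 4"
        by (intro power_mono b) auto
      also have "\<dots> = C ^ 4 * exp (- (snd p)\<^sup>2)"
        by (simp add: power_mult_distrib exp_of_nat_mult[symmetric])
      finally show "norm (cmod (u (fst p) (snd p)) ^ 4) \<le> norm (C ^ 4 * exp (- (snd p)\<^sup>2))" by simp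
    qed
  qed
  then show ?thesis using Icc_line_measurable[OF u] by (simp add: Lsp_def)
qed

lemma evolves_Lsp4: "evolves f u \<Longrightarrow> joint u \<in> Lsp 4 slab"
  using evolves_gaussian_bound[of f u] evolves_measurable[of f u] gaussian_bounded_Lsp4 by blast

text \<open>The quartic functional without its factor 2/pi, for flows given pointwise. As a single
  integral over the product space it admits dominated convergence in (t, x) at once; Fubini links it
  to the iterated integral in \<open>E4\<close>.\<close>

definition quartic :: "(real \<Rightarrow> real \<Rightarrow> complex) \<Rightarrow> (real \<Rightarrow> real \<Rightarrow> complex) \<Rightarrow> (real \<Rightarrow> real \<Rightarrow> complex) \<Rightarrow>
    (real \<Rightarrow> real \<Rightarrow> complex) \<Rightarrow> complex" where
  "quartic u1 u2 u3 u4 = (LINT p|slab. u1 (fst p) (snd p) * u2 (fst p) (snd p) * cnj (u3 (fst p) (snd p) * u4 (fst p) (snd p)))"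

definition rot_average :: "(real \<Rightarrow> complex) \<Rightarrow> (real \<Rightarrow> complex) \<Rightarrow> (real \<Rightarrow> complex) \<Rightarrow> (real \<Rightarrow> complex) \<Rightarrow> complex" where
  "rot_average f1 f2 f3 f4 = (LINT \<theta>:{0..2*pi}|lborel. E_iso (S_rot \<theta>) gaussian f1 f2 gaussian f3 f4)"

text \<open>Keeps each datum next to its flow, so that the identity can be extended by linearity one
  pair at a time.\<close>

definition quartic_identity where
  "quartic_identity f1 u1 f2 u2 f3 u3 f4 u4 \<longleftrightarrow>
    of_real (2 / pi) * quartic u1 u2 u3 u4 = of_real (1 / (2 * sqrt 2 * pi\<^sup>2)) * rot_average f1 f2 f3 f4"

section \<open>Multilinearity of both sides\<close>

lemma E_density_lincomb:
  shows "E_density A gaussian (\<lambda>x. a * f x + b * g x) f2 gaussian f3 f4 = (\<lambda>x. a * E_density A gaussian f f2 gaussian f3 f4 x + b * E_density A gaussian g f2 gaussian f3 f4 x)"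
    "E_density A gaussian f1 (\<lambda>x. a * f x + b * g x) gaussian f3 f4 = (\<lambda>x. a * E_density A gaussian f1 f gaussian f3 f4 x + b * E_density A gaussian f1 g gaussian f3 f4 x)"
    "E_density A gaussian f1 f2 gaussian (\<lambda>x. a * f x + b * g x) f4 = (\<lambda>x. cnj a * E_density A gaussian f1 f2 gaussian f f4 x + cnj b * E_density A gaussian f1 f2 gaussian g f4 x)"
    "E_density A gaussian f1 f2 gaussian f3 (\<lambda>x. a * f x + b * g x) = (\<lambda>x. cnj a * E_density A gaussian f1 f2 gaussian f3 f x + cnj b * E_density A gaussian f1 f2 gaussian f3 g x)"
  by (simp_all add: fun_eq_iff E_density_def algebra_simps)

lemma E_iso_lincomb:
  assumes L: "f1 \<in> L2" "f2 \<in> L2" "f3 \<in> L2" "f4 \<in> L2" "f \<in> L2" "g \<in> L2"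
  shows "E_iso (S_rot \<theta>) gaussian (\<lambda>x. a * f x + b * g x) f2 gaussian f3 f4 = a * E_iso (S_rot \<theta>) gaussian f f2 gaussian f3 f4 + b * E_iso (S_rot \<theta>) gaussian g f2 gaussian f3 f4"
    "E_iso (S_rot \<theta>) gaussian f1 (\<lambda>x. a * f x + b * g x) gaussian f3 f4 = a * E_iso (S_rot \<theta>) gaussian f1 f gaussian f3 f4 + b * E_iso (S_rot \<theta>) gaussian f1 g gaussian f3 f4"
    "E_iso (S_rot \<theta>) gaussian f1 f2 gaussian (\<lambda>x. a * f x + b * g x) f4 = cnj a * E_iso (S_rot \<theta>) gaussian f1 f2 gaussian f f4 + cnj b * E_iso (S_rot \<theta>) gaussian f1 f2 gaussian g f4"
    "E_iso (S_rot \<theta>) gaussian f1 f2 gaussian f3 (\<lambda>x. a * f x + b * g x) = cnj a * E_iso (S_rot \<theta>) gaussian f1 f2 gaussian f3 f + cnj b * E_iso (S_rot \<theta>) gaussian f1 f2 gaussian f3 g"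
  unfolding E_iso_def E_density_lincomb
  by (simp_all add: integrable_E_density[OF gaussian_L2 _ _ gaussian_L2] L)

lemma rot_average_lincomb:
  assumes L: "f1 \<in> L2" "f2 \<in> L2" "f3 \<in> L2" "f4 \<in> L2" "f \<in> L2" "g \<in> L2"
  shows "rot_average (\<lambda>x. a * f x + b * g x) f2 f3 f4 = a * rot_average f f2 f3 f4 + b * rot_average g f2 f3 f4"
    "rot_average f1 (\<lambda>x. a * f x + b * g x) f3 f4 = a * rot_average f1 f f3 f4 + b * rot_average f1 g f3 f4"
    "rot_average f1 f2 (\<lambda>x. a * f x + b * g x) f4 = cnj a * rot_average f1 f2 f f4 + cnj b * rot_average f1 f2 g f4"
    "rot_average f1 f2 f3 (\<lambda>x. a * f x + b * g x) = cnj a * rot_average f1 f2 f3 f + cnj b * rot_average f1 f2 f3 g"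
  unfolding rot_average_def E_iso_lincomb[OF L]
  by (simp_all add: set_integrable_E_iso[OF gaussian_L2 _ _ gaussian_L2] L set_integral_add set_integrable_mult_right)

lemma four_product_lincomb:
  fixes u1 u2 u3 u4 u v a b :: complex
  shows "(a * u + b * v) * u2 * cnj (u3 * u4) = a * (u * u2 * cnj (u3 * u4)) + b * (v * u2 * cnj (u3 * u4))"
    "u1 * (a * u + b * v) * cnj (u3 * u4) = a * (u1 * u * cnj (u3 * u4)) + b * (u1 * v * cnj (u3 * u4))"
    "u1 * u2 * cnj ((a * u + b * v) * u4) = cnj a * (u1 * u2 * cnj (u * u4)) + cnj b * (u1 * u2 * cnj (v * u4))"
    "u1 * u2 * cnj (u3 * (a * u + b * v)) = cnj a * (u1 * u2 * cnj (u3 * u)) + cnj b * (u1 * u2 * cnj (u3 * v))"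
  by (simp_all add: algebra_simps)

lemma integral_lincomb:
  fixes F G :: "'a \<Rightarrow> complex"
  assumes "integrable M F" "integrable M G"
  shows "(LINT p|M. a * F p + b * G p) = a * (LINT p|M. F p) + b * (LINT p|M. G p)"
  using assms by simp

lemma quartic_lincomb:
  assumes "joint u1 \<in> Lsp 4 slab" "joint u2 \<in> Lsp 4 slab"
    "joint u3 \<in> Lsp 4 slab" "joint u4 \<in> Lsp 4 slab"
    "joint u \<in> Lsp 4 slab" "joint v \<in> Lsp 4 slab"
  shows "quartic (\<lambda>t x. a * u t x + b * v t x) u2 u3 u4 = a * quartic u u2 u3 u4 + b * quartic v u2 u3 u4"
    "quartic u1 (\<lambda>t x. a * u t x + b * v t x) u3 u4 = a * quartic u1 u u3 u4 + b * quartic u1 v u3 u4"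
    "quartic u1 u2 (\<lambda>t x. a * u t x + b * v t x) u4 = cnj a * quartic u1 u2 u u4 + cnj b * quartic u1 u2 v u4"
    "quartic u1 u2 u3 (\<lambda>t x. a * u t x + b * v t x) = cnj a * quartic u1 u2 u3 u + cnj b * quartic u1 u2 u3 v"
  unfolding quartic_def four_product_lincomb
  by (rule integral_lincomb; rule integrable_mult_L4; rule assms)+

lemma lincomb_eq_lincomb:
  fixes x y :: "'a::comm_ring"
  assumes "c * x = d * x'" "c * y = d * y'"
  shows "c * (a * x + b * y) = d * (a * x' + b * y')"
  using assms by (simp only: distrib_left mult.left_commute[of c] mult.left_commute[of d])

lemma quartic_identity_lincomb:
  assumes "evolves f1 u1" "evolves f2 u2" "evolves f3 u3" "evolves f4 u4" "evolves f u" "evolves g v"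
  shows "quartic_identity f u f2 u2 f3 u3 f4 u4 \<Longrightarrow> quartic_identity g v f2 u2 f3 u3 f4 u4 \<Longrightarrow>
      quartic_identity (\<lambda>x. a * f x + b * g x) (\<lambda>t x. a * u t x + b * v t x) f2 u2 f3 u3 f4 u4"
    "quartic_identity f1 u1 f u f3 u3 f4 u4 \<Longrightarrow> quartic_identity f1 u1 g v f3 u3 f4 u4 \<Longrightarrow>
      quartic_identity f1 u1 (\<lambda>x. a * f x + b * g x) (\<lambda>t x. a * u t x + b * v t x) f3 u3 f4 u4"
    "quartic_identity f1 u1 f2 u2 f u f4 u4 \<Longrightarrow> quartic_identity f1 u1 f2 u2 g v f4 u4 \<Longrightarrow>
      quartic_identity f1 u1 f2 u2 (\<lambda>x. a * f x + b * g x) (\<lambda>t x. a * u t x + b * v t x) f4 u4"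
    "quartic_identity f1 u1 f2 u2 f3 u3 f u \<Longrightarrow> quartic_identity f1 u1 f2 u2 f3 u3 g v \<Longrightarrow>
      quartic_identity f1 u1 f2 u2 f3 u3 (\<lambda>x. a * f x + b * g x) (\<lambda>t x. a * u t x + b * v t x)"
  unfolding quartic_identity_def rot_average_lincomb[OF assms[THEN evolves_L2[THEN conjunct1]]]
    quartic_lincomb[OF assms[THEN evolves_Lsp4]]
  by (rule lincomb_eq_lincomb; assumption)+

section \<open>Evaluation of both sides on coherent flows\<close>

definition coh_flow :: "complex \<Rightarrow> real \<Rightarrow> real \<Rightarrow> complex" where
  "coh_flow s t x = exp (\<i> * of_real t) * coh (exp (2 * \<i> * of_real t) * s) x"

lemma evolves_coh_flow: "evolves (coh s) (coh_flow s)"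
  unfolding coh_flow_def[abs_def] by (rule evolves_coh)

lemma integral_scale_4: "(LINT t:{0..pi/2}|lborel. F (4 * t)) = (LINT \<alpha>:{0..2*pi}|lborel. F \<alpha>) / 4"
  for F :: "real \<Rightarrow> complex"
proof -
  have "indicator {0..2*pi} (4 * t) = (indicator {0..pi/2} t :: real)" for t
    by (auto simp: indicator_def)
  then show ?thesis
    unfolding set_lebesgue_integral_def
    by (subst (2) lborel_integral_real_affine[of 4 _ 0]) (simp_all add: scaleR_conv_of_real)
qed

text \<open>The phases e^(it) of the four factors cancel, two of them being conjugated, and the
  angle also cancels in products of an s with an r. Products within a pair keep e^(4it) or its
  inverse, and 4t runs once over the circle.\<close>

lemma quartic_coh_flow:
  "quartic (coh_flow s1) (coh_flow s2) (coh_flow (cnj r1)) (coh_flow (cnj r2)) =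
    of_real (sqrt (pi / 2)) * exp ((s1 + s2) * (r1 + r2)) / 4 *
      (LINT \<alpha>:{0..2*pi}|lborel. exp (- (s1 - s2)\<^sup>2 / 2 * cis \<alpha> + - (r1 - r2)\<^sup>2 / 2 * cis (- \<alpha>)))"
proof -
  let ?G = "\<lambda>p. coh_flow s1 (fst p) (snd p) * coh_flow s2 (fst p) (snd p) * cnj (coh_flow (cnj r1) (fst p) (snd p) * coh_flow (cnj r2) (fst p) (snd p))"
  have i: "integrable slab ?G"
    by (intro integrable_mult_L4 evolves_Lsp4[OF evolves_coh_flow])
  have inner: "(LINT x|lborel. ?G (t, x)) = of_real (sqrt (pi / 2)) * exp ((s1 + s2) * (r1 + r2)) *
       exp (- (s1 - s2)\<^sup>2 / 2 * cis (4 * t) + - (r1 - r2)\<^sup>2 / 2 * cis (- (4 * t)))" for t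
  proof -
    define z where "z = exp (2 * \<i> * of_real t)"
    define w where "w = exp (- (2 * \<i> * of_real t))"
    have zw: "z * w = 1" by (simp add: z_def w_def mult_exp_exp)
    have zc: "cnj z = w" by (simp add: z_def w_def exp_cnj)
    have z2: "z\<^sup>2 = cis (4 * t)" and w2: "w\<^sup>2 = cis (- (4 * t))"
      by (simp_all add: z_def w_def cis_conv_exp exp_double[symmetric] mult_ac)
    have "?G (t, x) = coh (z * s1) x * coh (z * s2) x * (coh (w * r1) x * coh (w * r2) x)" for x
    proof -
      have "?G (t, x) = (exp (\<i> * of_real t) * exp (\<i> * of_real t) * (exp (- (\<i> * of_real t)) * exp (- (\<i> * of_real t)))) *
          (coh (z * s1) x * coh (z * s2) x * (coh (w * r1) x * coh (w * r2) x))"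
        by (simp add: coh_flow_def cnj_coh exp_cnj z_def w_def mult_ac)
      also have "exp (\<i> * of_real t) * exp (\<i> * of_real t) * (exp (- (\<i> * of_real t)) * exp (- (\<i> * of_real t))) = 1"
        by (simp add: mult_exp_exp)
      finally show ?thesis by simp
    qed
    then have "(LINT x|lborel. ?G (t, x)) = of_real (sqrt (pi / 2)) *
        exp ((z * s1 + z * s2 + w * r1 + w * r2)\<^sup>2 / 2 - ((z * s1)\<^sup>2 + (z * s2)\<^sup>2 + (w * r1)\<^sup>2 + (w * r2)\<^sup>2))"
      using has_bochner_integral_four_coh[of "z * s1" "z * s2" "w * r1" "w * r2"]
      by (simp add: has_bochner_integral_iff)
    also have "(z * s1 + z * s2 + w * r1 + w * r2)\<^sup>2 / 2 - ((z * s1)\<^sup>2 + (z * s2)\<^sup>2 + (w * r1)\<^sup>2 + (w * r2)\<^sup>2)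
       = (z * w) * ((s1 + s2) * (r1 + r2)) + (- (s1 - s2)\<^sup>2 / 2 * z\<^sup>2 + - (r1 - r2)\<^sup>2 / 2 * w\<^sup>2)"
      by (simp add: power2_eq_square field_simps)
    finally show ?thesis by (simp add: zw z2 w2 exp_add mult.assoc)
  qed
  have "quartic (coh_flow s1) (coh_flow s2) (coh_flow (cnj r1)) (coh_flow (cnj r2)) =
     (LINT t|restrict_space lborel {0..pi/2}. LINT x|lborel. ?G (t, x))"
    unfolding quartic_def using Icc_line.integral_fst'[OF i] by simp
  also have "\<dots> = of_real (sqrt (pi / 2)) * exp ((s1 + s2) * (r1 + r2)) *
     (LINT t:{0..pi/2}|lborel. exp (- (s1 - s2)\<^sup>2 / 2 * cis (4 * t) + - (r1 - r2)\<^sup>2 / 2 * cis (- (4 * t))))"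
    unfolding inner set_lebesgue_integral_restrict by (rule integral_mult_right_zero)
  finally show ?thesis
    unfolding integral_scale_4[of "\<lambda>\<alpha>. exp (- (s1 - s2)\<^sup>2 / 2 * cis \<alpha> + - (r1 - r2)\<^sup>2 / 2 * cis (- \<alpha>))"]
    by simp
qed

lemma rot_average_coh:
  "rot_average (coh s1) (coh s2) (coh (cnj r1)) (coh (cnj r2)) =
    of_real (pi * sqrt pi) * exp ((s1 + s2) * (r1 + r2)) *
      (LINT \<alpha>:{0..2*pi}|lborel. exp (- (s1 - s2)\<^sup>2 / 2 * cis \<alpha> + - (r1 - r2)\<^sup>2 / 2 * cis (- \<alpha>)))"
proof -
  have c: "(s1 - s2) * (r1 - r2) * of_real (cos \<alpha>) = (s1 - s2) * (r1 - r2) / 2 * cis \<alpha> + (s1 - s2) * (r1 - r2) / 2 * cis (- \<alpha>)" for \<alpha>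
  proof -
    have "cis \<alpha> + cis (- \<alpha>) = 2 * of_real (cos \<alpha>)" by (simp add: complex_eq_iff)
    then have "complex_of_real (cos \<alpha>) = (cis \<alpha> + cis (- \<alpha>)) / 2" by simp
    then show ?thesis by (simp only:) (simp add: field_simps)
  qed
  have E: "E_iso (S_rot \<theta>) gaussian (coh s1) (coh s2) gaussian (coh (cnj r1)) (coh (cnj r2)) =
     of_real (pi * sqrt pi) * exp ((s1 + s2) * (r1 + r2)) *
       exp ((s1 - s2) * (r1 - r2) / 2 * cis \<theta> + (s1 - s2) * (r1 - r2) / 2 * cis (- \<theta>))" for \<theta>
    unfolding E_iso_coh c by (simp only: exp_add[of "(s1 + s2) * (r1 + r2)"] mult.assoc)
  have "rot_average (coh s1) (coh s2) (coh (cnj r1)) (coh (cnj r2)) = of_real (pi * sqrt pi) * exp ((s1 + s2) * (r1 + r2)) *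
     (LINT \<alpha>:{0..2*pi}|lborel. exp ((s1 - s2) * (r1 - r2) / 2 * cis \<alpha> + (s1 - s2) * (r1 - r2) / 2 * cis (- \<alpha>)))"
    unfolding rot_average_def E set_lebesgue_integral_restrict by (rule integral_mult_right_zero)
  \<comment> \<open>On either side the product of the two coefficients is ((s1 - s2)(r1 - r2))^2 /
    4.\<close>
  also have "(LINT \<alpha>:{0..2*pi}|lborel. exp ((s1 - s2) * (r1 - r2) / 2 * cis \<alpha> + (s1 - s2) * (r1 - r2) / 2 * cis (- \<alpha>)))
     = (LINT \<alpha>:{0..2*pi}|lborel. exp (- (s1 - s2)\<^sup>2 / 2 * cis \<alpha> + - (r1 - r2)\<^sup>2 / 2 * cis (- \<alpha>)))"
    by (rule circle_integral_exp_eq) (simp add: power2_eq_square)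
  finally show ?thesis .
qed

lemma quartic_identity_coh: "quartic_identity (coh s1) (coh_flow s1) (coh s2) (coh_flow s2) (coh s3) (coh_flow s3) (coh s4) (coh_flow s4)"
proof -
  \<comment> \<open>On the left the normalisation, the integral over the line and the rescaling of
    time; on the right the constant of the representation and the pi^(3/2) of the integral over R^3.
    The common factors X and Y drop out, so this equation fixes the constant.\<close>
  have "2 / pi * (sqrt (pi / 2) / 4) = 1 / (2 * sqrt 2 * pi\<^sup>2) * (pi * sqrt pi)"
    by (simp add: real_sqrt_divide power2_eq_square)
  then have "complex_of_real (2 / pi) * (of_real (sqrt (pi / 2)) / 4) = of_real (1 / (2 * sqrt 2 * pi\<^sup>2)) * of_real (pi * sqrt pi)"
    by (metis of_real_divide of_real_mult of_real_numeral)
  moreover have "A * (B * X / 4 * Y) = C * (D * X * Y)" if "A * (B / 4) = C * D" for A B C D X Y :: complex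
  proof -
    have "A * (B * X / 4 * Y) = (A * (B / 4)) * (X * Y)" by simp
    then show ?thesis unfolding that by (simp only: mult.assoc)
  qed
  ultimately have "complex_of_real (2 / pi) * (of_real (sqrt (pi / 2)) * X / 4 * Y) = of_real (1 / (2 * sqrt 2 * pi\<^sup>2)) * (of_real (pi * sqrt pi) * X * Y)" for X Y
    by blast
  then show ?thesis
    unfolding quartic_identity_def quartic_coh_flow[of s1 s2 "cnj s3" "cnj s4", unfolded complex_cnj_cnj]
      rot_average_coh[of s1 s2 "cnj s3" "cnj s4", unfolded complex_cnj_cnj] .
qed

text \<open>One induction per slot: the slots already treated are arbitrary and those still to come
  hold coherent states, so each induction takes its base case from the previous one.\<close>

lemma evolves_quartic_identity:
  assumes "evolves f1 u1" "evolves f2 u2" "evolves f3 u3" "evolves f4 u4"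
  shows "quartic_identity f1 u1 f2 u2 f3 u3 f4 u4"
proof -
  note lin = quartic_identity_lincomb and coh = evolves_coh_flow
  have 1: "quartic_identity f1 u1 (coh s2) (coh_flow s2) (coh s3) (coh_flow s3) (coh s4) (coh_flow s4)"
    if "evolves f1 u1" for f1 u1 s2 s3 s4
    using that
  proof (induction rule: evolves.induct)
    case (evolves_coh s)
    show ?case using quartic_identity_coh[of s] unfolding coh_flow_def[of s, abs_def] .
  next
    case (evolves_lin f u g v a b)
    show ?case
      by (rule lin(1)[OF evolves_lin.hyps(1) coh coh coh evolves_lin.hyps evolves_lin.IH])
  qed
  have 2: "quartic_identity f1 u1 f2 u2 (coh s3) (coh_flow s3) (coh s4) (coh_flow s4)"
    if e1: "evolves f1 u1" and "evolves f2 u2" for f1 u1 f2 u2 s3 s4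
    using that(2)
  proof (induction rule: evolves.induct)
    case (evolves_coh s)
    show ?case using 1[OF e1, of s] unfolding coh_flow_def[of s, abs_def] .
  next
    case (evolves_lin f u g v a b)
    show ?case
      by (rule lin(2)[OF e1 evolves_lin.hyps(1) coh coh evolves_lin.hyps evolves_lin.IH])
  qed
  have 3: "quartic_identity f1 u1 f2 u2 f3 u3 (coh s4) (coh_flow s4)"
    if e: "evolves f1 u1" "evolves f2 u2" and "evolves f3 u3" for f1 u1 f2 u2 f3 u3 s4
    using that(3)
  proof (induction rule: evolves.induct)
    case (evolves_coh s)
    show ?case using 2[OF e, of s] unfolding coh_flow_def[of s, abs_def] .
  next
    case (evolves_lin f u g v a b)
    show ?case
      by (rule lin(3)[OF e evolves_lin.hyps(1) coh evolves_lin.hyps evolves_lin.IH])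
  qed
  show ?thesis
    using assms(4)
  proof (induction rule: evolves.induct)
    case (evolves_coh s)
    show ?case using 3[OF assms(1-3), of s] unfolding coh_flow_def[of s, abs_def] .
  next
    case (evolves_lin f u g v a b)
    show ?case
      by (rule lin(4)[OF assms(1-3) evolves_lin.hyps(1) evolves_lin.hyps evolves_lin.IH])
  qed
qed

text \<open>The identity itself supplies the Strichartz estimate needed to pass to the limit.\<close>

lemma evolves_Strichartz:
  obtains K where "0 \<le> K" "\<And>f u. evolves f u \<Longrightarrow> (LINT p|slab. cmod (u (fst p) (snd p)) ^ 4) \<le> K * (sqn f)\<^sup>2"
proof -
  \<comment> \<open>The circle contributes its length 2 pi. The norm of the Gaussian enters once,
    because the Cauchy-Schwarz bound is the square root of a product with two such factors; the rest
    converts the constants of the identity.\<close>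
  define K where "K = pi / 2 * (1 / (2 * sqrt 2 * pi\<^sup>2)) * (2 * pi * sqn gaussian)"
  have K: "0 \<le> K" by (simp add: K_def)
  have "(LINT p|slab. cmod (u (fst p) (snd p)) ^ 4) \<le> K * (sqn f)\<^sup>2" if e: "evolves f u" for f u
  proof -
    have f: "f \<in> L2" using evolves_L2[OF e] by simp
    \<comment> \<open>With four equal arguments the integrand is |u|^4, so the identity controls the
      L^4 norm itself.\<close>
    have "u (fst p) (snd p) * u (fst p) (snd p) * cnj (u (fst p) (snd p) * u (fst p) (snd p)) = complex_of_real (cmod (u (fst p) (snd p)) ^ 4)" for p
    proof -
      have "(z * z) * cnj (z * z) = of_real ((cmod (z * z))\<^sup>2)" for z
        by (rule complex_norm_square[symmetric])
      also have "(cmod (z * z))\<^sup>2 = cmod z ^ 4" for z by (simp add: norm_mult power2_eq_square power4_eq_xxxx)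
      finally show ?thesis .
    qed
    then have q: "quartic u u u u = of_real (LINT p|slab. cmod (u (fst p) (snd p)) ^ 4)"
      unfolding quartic_def by (simp only: integral_complex_of_real)
    have bnd: "cmod (E_iso (S_rot \<theta>) gaussian f f gaussian f f) \<le> sqn gaussian * (sqn f)\<^sup>2" for \<theta>
    proof (rule power2_le_imp_le)
      show "(cmod (E_iso (S_rot \<theta>) gaussian f f gaussian f f))\<^sup>2 \<le> (sqn gaussian * (sqn f)\<^sup>2)\<^sup>2"
        using E_iso_bound[OF gaussian_L2 f f gaussian_L2 f f, of \<theta>] by (simp add: power2_eq_square mult_ac)
    qed simp
    have "cmod (rot_average f f f f) \<le> (LINT \<theta>|circle. sqn gaussian * (sqn f)\<^sup>2)"
      unfolding rot_average_def set_lebesgue_integral_restrict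
      by (rule Bochner_Integration.integral_norm_bound_integral)
        (use bnd integrable_restrict_Icc_bounded[OF E_iso_measurable[OF gaussian_L2 f f gaussian_L2 f f] bnd] in auto)
    also have "\<dots> = 2 * pi * sqn gaussian * (sqn f)\<^sup>2"
      by (simp add: measure_restrict_space)
    finally have r: "cmod (rot_average f f f f) \<le> 2 * pi * sqn gaussian * (sqn f)\<^sup>2" .
    have "of_real (2 / pi) * quartic u u u u = of_real (1 / (2 * sqrt 2 * pi\<^sup>2)) * rot_average f f f f"
      using evolves_quartic_identity[OF e e e e] by (simp add: quartic_identity_def)
    then have "cmod (of_real (2 / pi) * quartic u u u u) = cmod (of_real (1 / (2 * sqrt 2 * pi\<^sup>2)) * rot_average f f f f)"
      by simp
    then have "2 / pi * (LINT p|slab. cmod (u (fst p) (snd p)) ^ 4) = 1 / (2 * sqrt 2 * pi\<^sup>2) * cmod (rot_average f f f f)"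
      unfolding norm_mult q norm_of_real by simp
    also have "\<dots> \<le> 1 / (2 * sqrt 2 * pi\<^sup>2) * (2 * pi * sqn gaussian * (sqn f)\<^sup>2)"
      by (intro mult_left_mono r) auto
    finally have "(LINT p|slab. cmod (u (fst p) (snd p)) ^ 4) \<le> pi / 2 * (1 / (2 * sqrt 2 * pi\<^sup>2) * (2 * pi * sqn gaussian * (sqn f)\<^sup>2))"
      by (simp add: field_simps)
    then show ?thesis by (simp add: K_def mult_ac)
  qed
  then show ?thesis using K that by blast
qed

section \<open>Passage to the limit\<close>

text \<open>Here the limit is known in advance: summing the errors \<open>f - w k\<close> instead of
  the increments makes the pointwise limit f itself and still yields a common majorant.\<close>

lemma Lsp_approx_converges:
  assumes f: "f \<in> Lsp 2 M" and w: "\<And>k. w k \<in> Lsp 2 M"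
    and s: "\<And>k. (LINT x|M. (cmod (f x - w k x))\<^sup>2) \<le> (1/8) ^ k"
  obtains h where "(\<lambda>x. complex_of_real (h x)) \<in> Lsp 2 M"
    "AE x in M. (\<lambda>k. w k x) \<longlonglongrightarrow> f x \<and> (\<forall>k. cmod (w k x) \<le> h x) \<and> cmod (f x) \<le> h x"
proof -
  have d: "(\<lambda>x. f x - w k x) \<in> Lsp 2 M" for k using f w by (intro Lsp_diff)
  have "summable (\<lambda>k. (2\<^sup>2) ^ k * (LINT x|M. (cmod (f x - w k x))\<^sup>2))"
  proof (rule summable_comparison_test'[where g = "\<lambda>k. (1/2::real) ^ k" and N = 0])
    fix k
    have "(2\<^sup>2) ^ k * (LINT x|M. (cmod (f x - w k x))\<^sup>2) \<le> 4 ^ k * (1/8) ^ k"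
      using s[of k] by (intro mult_mono) auto
    also have "\<dots> = (1/2) ^ k" by (simp add: power_mult_distrib[symmetric])
    finally show "norm ((2\<^sup>2) ^ k * (LINT x|M. (cmod (f x - w k x))\<^sup>2)) \<le> (1/2) ^ k" by simp
  qed (auto intro: summable_geometric)
  note S = series_Lsp[OF d _ this, simplified]
  define h where "h x = cmod (f x) + (\<Sum>k. cmod (f x - w k x))" for x
  have "(\<lambda>x. complex_of_real (cmod (f x))) \<in> Lsp 2 M"
    by (rule Lsp_bound[OF f]) (use Lsp_measurable[OF f] in auto)
  from Lsp_add[OF this S(2)] have h: "(\<lambda>x. complex_of_real (h x)) \<in> Lsp 2 M"
    by (simp add: h_def)
  have "AE x in M. (\<lambda>k. w k x) \<longlonglongrightarrow> f x \<and> (\<forall>k. cmod (w k x) \<le> h x) \<and> cmod (f x) \<le> h x"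
    using S(1)
  proof eventually_elim
    case (elim x)
    have "(\<lambda>k. cmod (f x - w k x)) \<longlonglongrightarrow> 0" using elim by (rule summable_LIMSEQ_zero)
    then have "(\<lambda>k. f x - (f x - w k x)) \<longlonglongrightarrow> f x - 0"
      by (intro tendsto_diff tendsto_const) (simp add: tendsto_norm_zero_iff)
    moreover have "cmod (w k x) \<le> h x" for k
    proof -
      have "cmod (w k x) \<le> cmod (f x) + cmod (f x - w k x)"
        using norm_triangle_ineq4[of "f x" "f x - w k x"] by simp
      moreover have "cmod (f x - w k x) \<le> (\<Sum>k. cmod (f x - w k x))"
        using sum_le_suminf[OF elim, of "{k}"] by simp
      ultimately show ?thesis by (simp add: h_def)
    qed
    moreover have "0 \<le> (\<Sum>k. cmod (f x - w k x))" using elim by (intro suminf_nonneg) auto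
    ultimately show ?case by (simp add: h_def)
  qed
  with h that show ?thesis by blast
qed

lemma L2_norm_tendsto_iff: "(\<lambda>N. L2_norm (w N)) \<longlonglongrightarrow> 0 \<longleftrightarrow> (\<lambda>N. sqn (w N)) \<longlonglongrightarrow> 0"
proof
  assume "(\<lambda>N. L2_norm (w N)) \<longlonglongrightarrow> 0"
  then have "(\<lambda>N. (L2_norm (w N))\<^sup>2) \<longlonglongrightarrow> 0\<^sup>2" by (rule tendsto_power)
  then show "(\<lambda>N. sqn (w N)) \<longlonglongrightarrow> 0" by (simp add: L2_norm_def)
next
  assume "(\<lambda>N. sqn (w N)) \<longlonglongrightarrow> 0"
  then have "(\<lambda>N. sqrt (sqn (w N))) \<longlonglongrightarrow> sqrt 0" by (rule tendsto_real_sqrt)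
  then show "(\<lambda>N. L2_norm (w N)) \<longlonglongrightarrow> 0" by (simp add: L2_norm_def)
qed

text \<open>\<open>propagator\<close> is a choice among the L^2 limits of the truncations. An
  explicit limit u shows that one exists, and uniqueness of limits makes the chosen one agree with
  it almost everywhere.\<close>

lemma propagator_AE_eqI:
  assumes u: "u \<in> L2" and lim: "(\<lambda>N. sqn (\<lambda>x. u x - propagator_partial N t f x)) \<longlonglongrightarrow> 0"
  shows "propagator t f \<in> L2" "AE x in lborel. propagator t f x = u x"
proof -
  let ?P = "\<lambda>u. u \<in> L2 \<and> (\<lambda>N. L2_norm (\<lambda>x. u x - propagator_partial N t f x)) \<longlonglongrightarrow> 0"
  have "?P (propagator t f)"
    unfolding propagator_def by (rule someI[of ?P u]) (use u lim in \<open>simp add: L2_norm_tendsto_iff\<close>)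
  then have p: "propagator t f \<in> L2" "(\<lambda>N. sqn (\<lambda>x. propagator t f x - propagator_partial N t f x)) \<longlonglongrightarrow> 0"
    by (simp_all add: L2_norm_tendsto_iff)
  show "propagator t f \<in> L2" by (rule p)
  have d: "(\<lambda>x. propagator t f x - u x) \<in> Lsp 2 lborel"
    using p u by (intro Lsp_diff) (auto simp: L2_eq_Lsp)
  have "sqn (\<lambda>x. propagator t f x - u x) \<le> 2 * sqn (\<lambda>x. propagator t f x - propagator_partial N t f x) +
      2 * sqn (\<lambda>x. u x - propagator_partial N t f x)" for N
  proof -
    have "sqn (\<lambda>x. (propagator t f x - propagator_partial N t f x) + (propagator_partial N t f x - u x)) \<le>
      2 * sqn (\<lambda>x. propagator t f x - propagator_partial N t f x) + 2 * sqn (\<lambda>x. propagator_partial N t f x - u x)"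
      using p u propagator_partial_L2[of N t f] by (intro integral_square_add_le Lsp_diff) (auto simp: L2_eq_Lsp)
    then show ?thesis by (simp add: norm_minus_commute)
  qed
  moreover have "(\<lambda>N. 2 * sqn (\<lambda>x. propagator t f x - propagator_partial N t f x) +
      2 * sqn (\<lambda>x. u x - propagator_partial N t f x)) \<longlonglongrightarrow> 2 * 0 + 2 * 0"
    by (intro tendsto_add tendsto_mult tendsto_const p lim)
  ultimately have "sqn (\<lambda>x. propagator t f x - u x) \<le> 2 * 0 + 2 * 0"
    by (intro LIMSEQ_le_const) auto
  moreover have "0 \<le> sqn (\<lambda>x. propagator t f x - u x)" by simp
  ultimately have "sqn (\<lambda>x. propagator t f x - u x) = 0" by linarith
  from integral_square_zero_AE[OF d this] show "AE x in lborel. propagator t f x = u x" by simp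
qed

text \<open>Collects what the passage to the limit needs: data g with majorant h on the line, flows
  u with majorant H in L^4 of space-time, and a limit U on space-time that represents the propagator
  at every single t. The last point links the unrelated representatives in \<open>propagator\<close>
  at different times.\<close>

definition approximation where
  "approximation f g u U h H \<longleftrightarrow>
    (\<forall>k. evolves (g k) (u k)) \<and>
    (\<lambda>x. complex_of_real (h x)) \<in> L2 \<and>
    (AE x in lborel. (\<lambda>k. g k x) \<longlonglongrightarrow> f x \<and> (\<forall>k. cmod (g k x) \<le> h x)) \<and>
    (\<lambda>p. complex_of_real (H p)) \<in> Lsp 4 slab \<and>
    (AE p in slab. (\<lambda>k. u k (fst p) (snd p)) \<longlonglongrightarrow> U (fst p) (snd p) \<and> (\<forall>k. cmod (u k (fst p) (snd p)) \<le> H p)) \<and>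
    joint U \<in> Lsp 4 slab \<and>
    (\<forall>t. U t \<in> L2) \<and> (\<forall>t. propagator t f \<in> L2) \<and> (\<forall>t. AE x in lborel. propagator t f x = U t x)"

lemma approximationD:
  assumes "approximation f g u U h H"
  shows "evolves (g k) (u k)" "(\<lambda>x. complex_of_real (h x)) \<in> L2"
    "AE x in lborel. (\<lambda>k. g k x) \<longlonglongrightarrow> f x \<and> (\<forall>k. cmod (g k x) \<le> h x)"
    "(\<lambda>p. complex_of_real (H p)) \<in> Lsp 4 slab"
    "AE p in slab. (\<lambda>k. u k (fst p) (snd p)) \<longlonglongrightarrow> U (fst p) (snd p) \<and> (\<forall>k. cmod (u k (fst p) (snd p)) \<le> H p)"
    "joint U \<in> Lsp 4 slab"
    "U t \<in> L2" "propagator t f \<in> L2" "AE x in lborel. propagator t f x = U t x"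
  using assms unfolding approximation_def by blast+

lemma L2_approximation:
  assumes f: "f \<in> L2"
  shows "\<exists>g u U h H. approximation f g u U h H"
proof -
  have "\<forall>k. \<exists>g u. evolves g u \<and> sqn (\<lambda>x. f x - g x) < (1/8) ^ k"
    using evolves_dense[OF f] by simp
  then obtain g u where e: "\<And>k. evolves (g k) (u k)" and gk: "\<And>k. sqn (\<lambda>x. f x - g k x) < (1/8) ^ k"
    by metis
  have gL: "g k \<in> L2" and uL: "u k t \<in> L2" for k t using evolves_L2[OF e] by auto
  have ed: "evolves (\<lambda>x. g (Suc k) x - g k x) (\<lambda>t x. u (Suc k) t x - u k t x)" for k
    using evolves_lin[OF e[of "Suc k"] e[of k], of 1 "-1"] by simp
  have gd: "sqn (\<lambda>x. g (Suc k) x - g k x) \<le> 4 * (1/8) ^ k" for k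
  proof -
    have "sqn (\<lambda>x. (g (Suc k) x - f x) + (f x - g k x)) \<le> 2 * sqn (\<lambda>x. g (Suc k) x - f x) + 2 * sqn (\<lambda>x. f x - g k x)"
      using f gL by (intro integral_square_add_le Lsp_diff) (auto simp: L2_eq_Lsp)
    then have "sqn (\<lambda>x. g (Suc k) x - g k x) \<le> 2 * sqn (\<lambda>x. f x - g (Suc k) x) + 2 * sqn (\<lambda>x. f x - g k x)"
      by (simp add: norm_minus_commute)
    also have "\<dots> \<le> 2 * (1/8) ^ Suc k + 2 * (1/8) ^ k" using gk[of k] gk[of "Suc k"] by linarith
    also have "\<dots> \<le> 4 * (1/8) ^ k" by simp
    finally show ?thesis .
  qed
  \<comment> \<open>The limit is taken at every point (t, x), so one function serves both as L^2
    limit at each fixed t and as L^4 limit on space-time.\<close>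
  define U where "U t x = lim (\<lambda>k. u k t x)" for t x
  obtain h where h: "(\<lambda>x. complex_of_real (h x)) \<in> L2"
    "AE x in lborel. (\<lambda>k. g k x) \<longlonglongrightarrow> f x \<and> (\<forall>k. cmod (g k x) \<le> h x) \<and> cmod (f x) \<le> h x"
    by (rule Lsp_approx_converges[of f lborel g]) (use f gL gk in \<open>auto simp: L2_eq_Lsp less_imp_le\<close>)
  have t: "U t \<in> L2 \<and> (\<lambda>k. sqn (\<lambda>x. U t x - u k t x)) \<longlonglongrightarrow> 0" for t
  proof -
    have "summable (\<lambda>k. (2\<^sup>2) ^ k * sqn (\<lambda>x. u (Suc k) t x - u k t x))"
    proof (rule summable_comparison_test'[where g = "\<lambda>k. 8 * (1/2::real) ^ k" and N = 0])
      fix k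
      have "sqn (\<lambda>x. u (Suc k) t x - u k t x) \<le> 8 * (1/8) ^ k"
        using evolves_sqn[OF ed[of k], of t] gd[of k] by linarith
      then have "(2\<^sup>2) ^ k * sqn (\<lambda>x. u (Suc k) t x - u k t x) \<le> 4 ^ k * (8 * (1/8) ^ k)"
        by (intro mult_mono) auto
      also have "\<dots> = 8 * (1/2) ^ k" by (simp add: power_mult_distrib[symmetric])
      finally show "norm ((2\<^sup>2) ^ k * sqn (\<lambda>x. u (Suc k) t x - u k t x)) \<le> 8 * (1/2) ^ k" by simp
    qed (auto intro: summable_mult summable_geometric)
    then have s: "summable (\<lambda>k. (2\<^sup>2) ^ k * (LINT x|lborel. (cmod (u (Suc k) t x - u k t x))\<^sup>2))" .
    note L = Lsp_lim_dominated[of "\<lambda>k. u k t" 2 lborel, OF uL[unfolded L2_eq_Lsp] zero_less_numeral s, folded U_def]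
    show ?thesis
      using dominated_convergence_square[of "\<lambda>k. u k t" lborel "U t", OF uL[unfolded L2_eq_Lsp] L(3) L(1) L(2)] L(3)
      by (simp add: L2_eq_Lsp)
  qed
  obtain K where K: "0 \<le> K" "\<And>f u. evolves f u \<Longrightarrow> (LINT p|slab. cmod (u (fst p) (snd p)) ^ 4) \<le> K * (sqn f)\<^sup>2"
    by (rule evolves_Strichartz) blast
  \<comment> \<open>The Strichartz bound squares 4 (1/8)^k into 16 (1/64)^k, which leaves 4^(-k)
    after the weight 16^k.\<close>
  have s4: "summable (\<lambda>k. (2 ^ 4) ^ k * (LINT p|slab. cmod (u (Suc k) (fst p) (snd p) - u k (fst p) (snd p)) ^ 4))"
  proof (rule summable_comparison_test'[where g = "\<lambda>k. 16 * K * (1/4::real) ^ k" and N = 0])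
    fix k
    have "(LINT p|slab. cmod (u (Suc k) (fst p) (snd p) - u k (fst p) (snd p)) ^ 4) \<le> K * (sqn (\<lambda>x. g (Suc k) x - g k x))\<^sup>2"
      using K(2)[OF ed[of k]] .
    also have "\<dots> \<le> K * (4 * (1/8) ^ k)\<^sup>2"
      by (intro mult_left_mono power_mono gd K) auto
    finally have "(2 ^ 4) ^ k * (LINT p|slab. cmod (u (Suc k) (fst p) (snd p) - u k (fst p) (snd p)) ^ 4) \<le> 16 ^ k * (K * (4 * (1/8) ^ k)\<^sup>2)"
      by (intro mult_mono) auto
    also have "(4 * (1/8::real) ^ k)\<^sup>2 = 16 * (1/64) ^ k"
      by (simp add: power_mult_distrib power2_eq_square flip: power_mult_distrib)
    also have "16 ^ k * (K * (16 * (1/64) ^ k)) = 16 * K * (16 * (1/64)) ^ k"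
      unfolding power_mult_distrib by simp
    finally show "norm ((2 ^ 4) ^ k * (LINT p|slab. cmod (u (Suc k) (fst p) (snd p) - u k (fst p) (snd p)) ^ 4)) \<le> 16 * K * (1/4) ^ k"
      by simp
  qed (auto intro: summable_mult summable_geometric)
  note L4 = Lsp_lim_dominated[of "\<lambda>k p. u k (fst p) (snd p)" 4 slab, OF evolves_Lsp4[OF e] zero_less_numeral s4, folded U_def]
  have pr: "propagator t f \<in> L2" "AE x in lborel. propagator t f x = U t x" for t
  proof -
    \<comment> \<open>Three errors: U against the flow \<open>u k\<close>, this flow against its own
      truncation, and truncations of \<open>g k\<close> against those of f, the last controlled
      uniformly in N by Bessel's inequality. Splitting squares twice produces the factors 4, 4 and
      2; k is fixed before N.\<close>
    have lim: "(\<lambda>N. sqn (\<lambda>x. U t x - propagator_partial N t f x)) \<longlonglongrightarrow> 0"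
    proof (rule LIMSEQ_I)
      fix r :: real assume r: "r > 0"
      have "(\<lambda>k. 4 * sqn (\<lambda>x. U t x - u k t x) + 2 * sqn (\<lambda>x. f x - g k x)) \<longlonglongrightarrow> 4 * 0 + 2 * 0"
      proof (intro tendsto_add tendsto_mult tendsto_const conjunct2[OF t])
        show "(\<lambda>k. sqn (\<lambda>x. f x - g k x)) \<longlonglongrightarrow> 0"
        proof (rule Lim_null_comparison)
          show "\<forall>\<^sub>F k in sequentially. norm (sqn (\<lambda>x. f x - g k x)) \<le> (1/8) ^ k"
            using gk by (simp add: less_imp_le)
          show "(\<lambda>k. (1/8::real) ^ k) \<longlonglongrightarrow> 0" by (rule LIMSEQ_power_zero) simp
        qed
      qed
      then have "\<forall>\<^sub>F k in sequentially. 4 * sqn (\<lambda>x. U t x - u k t x) + 2 * sqn (\<lambda>x. f x - g k x) < r / 2"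
        by (rule order_tendstoD) (use r in simp)
      then obtain k where k: "4 * sqn (\<lambda>x. U t x - u k t x) + 2 * sqn (\<lambda>x. f x - g k x) < r / 2"
        by (auto simp: eventually_sequentially)
      have "\<forall>\<^sub>F N in sequentially. sqn (\<lambda>x. u k t x - propagator_partial N t (g k) x) < r / 8"
        by (rule order_tendstoD(2)[OF evolves_propagator_partial[OF e]]) (use r in simp)
      then obtain N0 where N0: "\<And>N. N \<ge> N0 \<Longrightarrow> sqn (\<lambda>x. u k t x - propagator_partial N t (g k) x) < r / 8"
        by (auto simp: eventually_sequentially)
      have "sqn (\<lambda>x. U t x - propagator_partial N t f x) < r" if "N \<ge> N0" for N
      proof -
        note P = propagator_partial_L2[unfolded L2_eq_Lsp]
        have A: "(\<lambda>x. U t x - u k t x) \<in> Lsp 2 lborel" "(\<lambda>x. u k t x - propagator_partial N t (g k) x) \<in> Lsp 2 lborel"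
          using t[of t] uL P by (auto simp: L2_eq_Lsp intro!: Lsp_diff)
        have D: "propagator_partial N t (\<lambda>x. g k x - f x) = (\<lambda>x. propagator_partial N t (g k) x - propagator_partial N t f x)"
          using propagator_partial_lincomb[OF gL f, of N t 1 k "-1"] by (simp add: fun_eq_iff)
        have "sqn (\<lambda>x. ((U t x - u k t x) + (u k t x - propagator_partial N t (g k) x)) + propagator_partial N t (\<lambda>x. g k x - f x) x)
          \<le> 2 * sqn (\<lambda>x. (U t x - u k t x) + (u k t x - propagator_partial N t (g k) x)) + 2 * sqn (propagator_partial N t (\<lambda>x. g k x - f x))"
          by (intro integral_square_add_le Lsp_add A P)
        also have "\<dots> \<le> 2 * (2 * sqn (\<lambda>x. U t x - u k t x) + 2 * sqn (\<lambda>x. u k t x - propagator_partial N t (g k) x)) + 2 * sqn (\<lambda>x. g k x - f x)"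
          using gL f by (intro add_mono mult_left_mono integral_square_add_le A sqn_propagator_partial) (auto simp: L2_eq_Lsp intro!: Lsp_diff)
        also have "\<dots> < r" using k N0[OF that] by (simp add: norm_minus_commute[of "g k _"])
        finally show ?thesis unfolding D by simp
      qed
      then show "\<exists>N0. \<forall>N\<ge>N0. norm (sqn (\<lambda>x. U t x - propagator_partial N t f x) - 0) < r" by auto
    qed
    show "propagator t f \<in> L2" "AE x in lborel. propagator t f x = U t x"
      using propagator_AE_eqI[OF conjunct1[OF t] lim] by auto
  qed
  let ?H = "\<lambda>p. cmod (u 0 (fst p) (snd p)) + (\<Sum>k. cmod (u (Suc k) (fst p) (snd p) - u k (fst p) (snd p)))"
  have "AE p in slab. (\<lambda>k. u k (fst p) (snd p)) \<longlonglongrightarrow> U (fst p) (snd p) \<and> (\<forall>k. cmod (u k (fst p) (snd p)) \<le> ?H p)"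
    using L4(2) by eventually_elim simp
  moreover have "AE x in lborel. (\<lambda>k. g k x) \<longlonglongrightarrow> f x \<and> (\<forall>k. cmod (g k x) \<le> h x)"
    using h(2) by eventually_elim simp
  ultimately have "approximation f g u U h ?H"
    unfolding approximation_def using e h(1) L4(1) L4(3) t pr by simp
  then show ?thesis by blast
qed

section \<open>Continuity of both sides along dominated sequences\<close>

lemma sqn_mono:
  fixes h :: "real \<Rightarrow> real"
  assumes "(\<lambda>x. complex_of_real (h x)) \<in> L2" "g \<in> L2" "AE x in lborel. P x \<and> (\<forall>k. cmod (w k x) \<le> h x)" "g = w j"
  shows "sqn g \<le> sqn (\<lambda>x. complex_of_real (h x))"
proof (rule integral_mono_AE)
  show "AE x in lborel. (cmod (g x))\<^sup>2 \<le> (cmod (complex_of_real (h x)))\<^sup>2"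
    using assms(3)
  proof eventually_elim
    case (elim x)
    then have "cmod (g x) \<le> h x" by (simp add: assms(4))
    then show ?case by (intro power_mono) auto
  qed
qed (use assms in \<open>auto simp: L2_def\<close>)

lemma E_iso_tendsto:
  fixes h1 h2 h3 h4 :: "real \<Rightarrow> real"
  assumes f: "f1 \<in> L2" "f2 \<in> L2" "f3 \<in> L2" "f4 \<in> L2"
    and g: "\<And>k. g1 k \<in> L2" "\<And>k. g2 k \<in> L2" "\<And>k. g3 k \<in> L2" "\<And>k. g4 k \<in> L2"
    and h: "(\<lambda>x. complex_of_real (h1 x)) \<in> L2" "(\<lambda>x. complex_of_real (h2 x)) \<in> L2"
      "(\<lambda>x. complex_of_real (h3 x)) \<in> L2" "(\<lambda>x. complex_of_real (h4 x)) \<in> L2"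
    and AE: "AE x in lborel. (\<lambda>k. g1 k x) \<longlonglongrightarrow> f1 x \<and> (\<forall>k. cmod (g1 k x) \<le> h1 x)"
      "AE x in lborel. (\<lambda>k. g2 k x) \<longlonglongrightarrow> f2 x \<and> (\<forall>k. cmod (g2 k x) \<le> h2 x)"
      "AE x in lborel. (\<lambda>k. g3 k x) \<longlonglongrightarrow> f3 x \<and> (\<forall>k. cmod (g3 k x) \<le> h3 x)"
      "AE x in lborel. (\<lambda>k. g4 k x) \<longlonglongrightarrow> f4 x \<and> (\<forall>k. cmod (g4 k x) \<le> h4 x)"
  shows "(\<lambda>k. E_iso (S_rot \<theta>) gaussian (g1 k) (g2 k) gaussian (g3 k) (g4 k)) \<longlonglongrightarrow> E_iso (S_rot \<theta>) gaussian f1 f2 gaussian f3 f4"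
  unfolding E_iso_def
proof (rule integral_dominated_convergence)
  let ?w = "\<lambda>x. norm (E_density (S_rot \<theta>) gaussian (\<lambda>x. h1 x) (\<lambda>x. h2 x) gaussian (\<lambda>x. h3 x) (\<lambda>x. h4 x) x)"
  show "integrable lborel ?w"
    by (intro integrable_norm integrable_E_density gaussian_L2 h)
  show "E_density (S_rot \<theta>) gaussian f1 f2 gaussian f3 f4 \<in> borel_measurable lborel"
    by (intro borel_measurable_integrable integrable_E_density gaussian_L2 f)
  show "E_density (S_rot \<theta>) gaussian (g1 k) (g2 k) gaussian (g3 k) (g4 k) \<in> borel_measurable lborel" for k
    by (intro borel_measurable_integrable integrable_E_density gaussian_L2 g)
  \<comment> \<open>Convergence off a null set of the line is lifted to R^3 along the coordinate at
    which each function is evaluated. The first two functions are evaluated at the rotated point, so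
    their null sets are also carried through the rotation.\<close>
  note A = AE_S_rot[OF AE_component[OF AE(1), of 2], of \<theta>] AE_S_rot[OF AE_component[OF AE(2), of 3], of \<theta>]
    AE_component[OF AE(3), of 2] AE_component[OF AE(4), of 3]
  show "AE x in lborel. (\<lambda>k. E_density (S_rot \<theta>) gaussian (g1 k) (g2 k) gaussian (g3 k) (g4 k) x) \<longlonglongrightarrow>
      E_density (S_rot \<theta>) gaussian f1 f2 gaussian f3 f4 x"
    using A by eventually_elim (auto simp: E_density_def intro!: tendsto_intros)
  show "AE x in lborel. norm (E_density (S_rot \<theta>) gaussian (g1 k) (g2 k) gaussian (g3 k) (g4 k) x) \<le> ?w x" for k
    using A
  proof eventually_elim
    case (elim x)
    have *: "cmod (g1 k (S_rot \<theta> x $ 2)) \<le> \<bar>h1 (S_rot \<theta> x $ 2)\<bar>" "cmod (g2 k (S_rot \<theta> x $ 3)) \<le> \<bar>h2 (S_rot \<theta> x $ 3)\<bar>"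
      "cmod (g3 k (x $ 2)) \<le> \<bar>h3 (x $ 2)\<bar>" "cmod (g4 k (x $ 3)) \<le> \<bar>h4 (x $ 3)\<bar>"
      using elim by (auto intro: order_trans[OF _ abs_ge_self])
    show ?case unfolding E_density_def norm_mult complex_mod_cnj norm_of_real
      by (intro mult_mono *) auto
  qed
qed

text \<open>Dominated convergence twice: on R^3 for each fixed \<theta>, and then on the circle,
  where the majorant is the Cauchy-Schwarz bound for h1 to h4, a constant free of \<theta> and
  k.\<close>

lemma rot_average_tendsto:
  fixes h1 h2 h3 h4 :: "real \<Rightarrow> real"
  assumes f: "f1 \<in> L2" "f2 \<in> L2" "f3 \<in> L2" "f4 \<in> L2"
    and g: "\<And>k. g1 k \<in> L2" "\<And>k. g2 k \<in> L2" "\<And>k. g3 k \<in> L2" "\<And>k. g4 k \<in> L2"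
    and h: "(\<lambda>x. complex_of_real (h1 x)) \<in> L2" "(\<lambda>x. complex_of_real (h2 x)) \<in> L2"
      "(\<lambda>x. complex_of_real (h3 x)) \<in> L2" "(\<lambda>x. complex_of_real (h4 x)) \<in> L2"
    and AE: "AE x in lborel. (\<lambda>k. g1 k x) \<longlonglongrightarrow> f1 x \<and> (\<forall>k. cmod (g1 k x) \<le> h1 x)"
      "AE x in lborel. (\<lambda>k. g2 k x) \<longlonglongrightarrow> f2 x \<and> (\<forall>k. cmod (g2 k x) \<le> h2 x)"
      "AE x in lborel. (\<lambda>k. g3 k x) \<longlonglongrightarrow> f3 x \<and> (\<forall>k. cmod (g3 k x) \<le> h3 x)"
      "AE x in lborel. (\<lambda>k. g4 k x) \<longlonglongrightarrow> f4 x \<and> (\<forall>k. cmod (g4 k x) \<le> h4 x)"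
  shows "(\<lambda>k. rot_average (g1 k) (g2 k) (g3 k) (g4 k)) \<longlonglongrightarrow> rot_average f1 f2 f3 f4"
  unfolding rot_average_def set_lebesgue_integral_restrict
proof (rule integral_dominated_convergence)
  let ?B = "sqrt ((sqn gaussian * sqn (\<lambda>x. complex_of_real (h1 x)) * sqn (\<lambda>x. complex_of_real (h2 x))) *
      (sqn gaussian * sqn (\<lambda>x. complex_of_real (h3 x)) * sqn (\<lambda>x. complex_of_real (h4 x))))"
  show "integrable (circle) (\<lambda>\<theta>. ?B)" by simp
  show "(\<lambda>\<theta>. E_iso (S_rot \<theta>) gaussian f1 f2 gaussian f3 f4) \<in> borel_measurable (circle)"
    by (intro measurable_restrict_Icc E_iso_measurable gaussian_L2 f)
  show "(\<lambda>\<theta>. E_iso (S_rot \<theta>) gaussian (g1 k) (g2 k) gaussian (g3 k) (g4 k)) \<in> borel_measurable (circle)" for k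
    by (intro measurable_restrict_Icc E_iso_measurable gaussian_L2 g)
  show "AE \<theta> in circle. (\<lambda>k. E_iso (S_rot \<theta>) gaussian (g1 k) (g2 k) gaussian (g3 k) (g4 k))
      \<longlonglongrightarrow> E_iso (S_rot \<theta>) gaussian f1 f2 gaussian f3 f4"
    by (intro AE_I2 E_iso_tendsto[OF f g h AE])
  show "AE \<theta> in circle. norm (E_iso (S_rot \<theta>) gaussian (g1 k) (g2 k) gaussian (g3 k) (g4 k)) \<le> ?B" for k
  proof (intro AE_I2 real_le_rsqrt order_trans[OF E_iso_bound] gaussian_L2 g)
    have m: "sqn (g1 k) \<le> sqn (\<lambda>x. complex_of_real (h1 x))" "sqn (g2 k) \<le> sqn (\<lambda>x. complex_of_real (h2 x))"
      "sqn (g3 k) \<le> sqn (\<lambda>x. complex_of_real (h3 x))" "sqn (g4 k) \<le> sqn (\<lambda>x. complex_of_real (h4 x))"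
      by (rule sqn_mono[OF h(1) g(1) AE(1) refl] sqn_mono[OF h(2) g(2) AE(2) refl]
          sqn_mono[OF h(3) g(3) AE(3) refl] sqn_mono[OF h(4) g(4) AE(4) refl])+
    show "(sqn gaussian * sqn (g1 k) * sqn (g2 k)) * (sqn gaussian * sqn (g3 k) * sqn (g4 k)) \<le>
      (sqn gaussian * sqn (\<lambda>x. complex_of_real (h1 x)) * sqn (\<lambda>x. complex_of_real (h2 x))) *
      (sqn gaussian * sqn (\<lambda>x. complex_of_real (h3 x)) * sqn (\<lambda>x. complex_of_real (h4 x)))"
      by (intro mult_mono m mult_nonneg_nonneg order_refl) simp_all
  qed
qed

lemma quartic_tendsto:
  fixes H1 H2 H3 H4 :: "real \<times> real \<Rightarrow> real"
  assumes U: "joint U1 \<in> Lsp 4 slab" "joint U2 \<in> Lsp 4 slab"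
      "joint U3 \<in> Lsp 4 slab" "joint U4 \<in> Lsp 4 slab"
    and u: "\<And>k. joint (u1 k) \<in> Lsp 4 slab" "\<And>k. joint (u2 k) \<in> Lsp 4 slab"
      "\<And>k. joint (u3 k) \<in> Lsp 4 slab" "\<And>k. joint (u4 k) \<in> Lsp 4 slab"
    and H: "(\<lambda>p. complex_of_real (H1 p)) \<in> Lsp 4 slab" "(\<lambda>p. complex_of_real (H2 p)) \<in> Lsp 4 slab"
      "(\<lambda>p. complex_of_real (H3 p)) \<in> Lsp 4 slab" "(\<lambda>p. complex_of_real (H4 p)) \<in> Lsp 4 slab"
    and AE: "AE p in slab. (\<lambda>k. u1 k (fst p) (snd p)) \<longlonglongrightarrow> U1 (fst p) (snd p) \<and> (\<forall>k. cmod (u1 k (fst p) (snd p)) \<le> H1 p)"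
      "AE p in slab. (\<lambda>k. u2 k (fst p) (snd p)) \<longlonglongrightarrow> U2 (fst p) (snd p) \<and> (\<forall>k. cmod (u2 k (fst p) (snd p)) \<le> H2 p)"
      "AE p in slab. (\<lambda>k. u3 k (fst p) (snd p)) \<longlonglongrightarrow> U3 (fst p) (snd p) \<and> (\<forall>k. cmod (u3 k (fst p) (snd p)) \<le> H3 p)"
      "AE p in slab. (\<lambda>k. u4 k (fst p) (snd p)) \<longlonglongrightarrow> U4 (fst p) (snd p) \<and> (\<forall>k. cmod (u4 k (fst p) (snd p)) \<le> H4 p)"
  shows "(\<lambda>k. quartic (u1 k) (u2 k) (u3 k) (u4 k)) \<longlonglongrightarrow> quartic U1 U2 U3 U4"
  unfolding quartic_def
proof (rule integral_dominated_convergence)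
  let ?w = "\<lambda>p. norm (complex_of_real (H1 p) * complex_of_real (H2 p) * cnj (complex_of_real (H3 p) * complex_of_real (H4 p)))"
  show "integrable slab ?w"
    by (intro integrable_norm integrable_mult_L4 H)
  show "(\<lambda>p. U1 (fst p) (snd p) * U2 (fst p) (snd p) * cnj (U3 (fst p) (snd p) * U4 (fst p) (snd p))) \<in> borel_measurable slab"
    by (intro borel_measurable_integrable integrable_mult_L4 U)
  show "(\<lambda>p. u1 k (fst p) (snd p) * u2 k (fst p) (snd p) * cnj (u3 k (fst p) (snd p) * u4 k (fst p) (snd p))) \<in> borel_measurable slab" for k
    by (intro borel_measurable_integrable integrable_mult_L4 u)
  show "AE p in slab. (\<lambda>k. u1 k (fst p) (snd p) * u2 k (fst p) (snd p) * cnj (u3 k (fst p) (snd p) * u4 k (fst p) (snd p))) \<longlonglongrightarrow>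
      U1 (fst p) (snd p) * U2 (fst p) (snd p) * cnj (U3 (fst p) (snd p) * U4 (fst p) (snd p))"
    using AE by eventually_elim (auto intro!: tendsto_intros)
  show "AE p in slab. norm (u1 k (fst p) (snd p) * u2 k (fst p) (snd p) * cnj (u3 k (fst p) (snd p) * u4 k (fst p) (snd p))) \<le> ?w p" for k
    using AE
  proof eventually_elim
    case (elim p)
    have *: "cmod (u1 k (fst p) (snd p)) \<le> \<bar>H1 p\<bar>" "cmod (u2 k (fst p) (snd p)) \<le> \<bar>H2 p\<bar>"
      "cmod (u3 k (fst p) (snd p)) \<le> \<bar>H3 p\<bar>" "cmod (u4 k (fst p) (snd p)) \<le> \<bar>H4 p\<bar>"
      using elim by (auto intro: order_trans[OF _ abs_ge_self])
    show ?case unfolding norm_mult complex_mod_cnj norm_of_real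
      by (intro mult_mono *) auto
  qed
qed

text \<open>The identity is first obtained for the limits U on space-time. They are exchanged for
  the propagators inside the inner integral, at each t separately, where equality almost everywhere
  in x suffices.\<close>

lemma E4_identity:
  assumes f: "f1 \<in> L2" "f2 \<in> L2" "f3 \<in> L2" "f4 \<in> L2"
  shows "E4_converges f1 f2 f3 f4"
    "E4 f1 f2 f3 f4 = of_real (1 / (2 * sqrt 2 * pi\<^sup>2)) * rot_average f1 f2 f3 f4"
proof -
  obtain g1 u1 U1 h1 H1 where "approximation f1 g1 u1 U1 h1 H1"
    using L2_approximation[OF f(1)] by blast
  note A1 = approximationD[OF this]
  obtain g2 u2 U2 h2 H2 where "approximation f2 g2 u2 U2 h2 H2"
    using L2_approximation[OF f(2)] by blast
  note A2 = approximationD[OF this]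
  obtain g3 u3 U3 h3 H3 where "approximation f3 g3 u3 U3 h3 H3"
    using L2_approximation[OF f(3)] by blast
  note A3 = approximationD[OF this]
  obtain g4 u4 U4 h4 H4 where "approximation f4 g4 u4 U4 h4 H4"
    using L2_approximation[OF f(4)] by blast
  note A4 = approximationD[OF this]
  have gL: "g1 k \<in> L2" "g2 k \<in> L2" "g3 k \<in> L2" "g4 k \<in> L2" for k
    using A1(1) A2(1) A3(1) A4(1) evolves_L2 by blast+
  have "quartic_identity f1 U1 f2 U2 f3 U3 f4 U4"
  proof -
    have r: "(\<lambda>k. rot_average (g1 k) (g2 k) (g3 k) (g4 k)) \<longlonglongrightarrow> rot_average f1 f2 f3 f4"
      by (rule rot_average_tendsto[OF f gL A1(2) A2(2) A3(2) A4(2) A1(3) A2(3) A3(3) A4(3)])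
    have q: "(\<lambda>k. quartic (u1 k) (u2 k) (u3 k) (u4 k)) \<longlonglongrightarrow> quartic U1 U2 U3 U4"
      by (rule quartic_tendsto[OF A1(6) A2(6) A3(6) A4(6) evolves_Lsp4[OF A1(1)] evolves_Lsp4[OF A2(1)]
          evolves_Lsp4[OF A3(1)] evolves_Lsp4[OF A4(1)] A1(4) A2(4) A3(4) A4(4) A1(5) A2(5) A3(5) A4(5)])
    have "of_real (2 / pi) * quartic (u1 k) (u2 k) (u3 k) (u4 k)
        = of_real (1 / (2 * sqrt 2 * pi\<^sup>2)) * rot_average (g1 k) (g2 k) (g3 k) (g4 k)" for k
      using evolves_quartic_identity[OF A1(1) A2(1) A3(1) A4(1)] by (simp only: quartic_identity_def)
    then have "(\<lambda>k. of_real (1 / (2 * sqrt 2 * pi\<^sup>2)) * rot_average (g1 k) (g2 k) (g3 k) (g4 k)) \<longlonglongrightarrow> of_real (2 / pi) * quartic U1 U2 U3 U4"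
      using tendsto_mult_left[OF q, of "of_real (2 / pi)"] by (simp only:)
    from LIMSEQ_unique[OF this tendsto_mult_left[OF r]] show ?thesis
      by (simp only: quartic_identity_def)
  qed
  note id = this
  let ?G = "\<lambda>p. U1 (fst p) (snd p) * U2 (fst p) (snd p) * cnj (U3 (fst p) (snd p) * U4 (fst p) (snd p))"
  have iG: "integrable slab ?G" by (intro integrable_mult_L4 A1 A2 A3 A4)
  have AEd: "AE x in lborel. E4_density f1 f2 f3 f4 t x = ?G (t, x)" for t
    using A1(9)[of t] A2(9)[of t] A3(9)[of t] A4(9)[of t] by eventually_elim (simp add: E4_density_def)
  have m: "E4_density f1 f2 f3 f4 t \<in> borel_measurable lborel" "(\<lambda>x. ?G (t, x)) \<in> borel_measurable lborel" for t
  proof -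
    note [measurable] = A1(7)[of t, THEN L2_borel] A2(7)[of t, THEN L2_borel] A3(7)[of t, THEN L2_borel] A4(7)[of t, THEN L2_borel]
      A1(8)[of t, THEN L2_borel] A2(8)[of t, THEN L2_borel] A3(8)[of t, THEN L2_borel] A4(8)[of t, THEN L2_borel]
    show "E4_density f1 f2 f3 f4 t \<in> borel_measurable lborel" unfolding E4_density_def[abs_def] by measurable
    show "(\<lambda>x. ?G (t, x)) \<in> borel_measurable lborel" by simp
  qed
  have eq: "(LINT x|lborel. E4_density f1 f2 f3 f4 t x) = (LINT x|lborel. ?G (t, x))" for t
    by (rule integral_cong_AE[OF m AEd])
  have "AE t in restrict_space lborel {0..pi/2}. integrable lborel (\<lambda>x. ?G (t, x))"
    using Icc_line.AE_integrable_fst'[OF iG] .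
  then have "AE t in restrict_space lborel {0..pi/2}. integrable lborel (E4_density f1 f2 f3 f4 t)"
    by eventually_elim (subst integrable_cong_AE[OF m AEd])
  then have 1: "AE t in lborel. t \<in> {0..pi/2} \<longrightarrow> integrable lborel (E4_density f1 f2 f3 f4 t)"
    by (subst (asm) AE_restrict_space_iff) simp_all
  have "integrable (restrict_space lborel {0..pi/2}) (\<lambda>t. LINT x|lborel. ?G (t, x))"
    using Icc_line.integrable_fst'[OF iG] .
  then have "set_integrable lborel {0..pi/2} (\<lambda>t. LINT x|lborel. E4_density f1 f2 f3 f4 t x)"
    unfolding eq by (simp add: set_integrable_def integrable_restrict_space)
  with 1 show "E4_converges f1 f2 f3 f4" by (simp add: E4_converges_def)
  have "E4 f1 f2 f3 f4 = of_real (2 / pi) * quartic U1 U2 U3 U4"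
    unfolding E4_def eq set_lebesgue_integral_restrict quartic_def Icc_line.integral_fst'[OF iG] ..
  with id show "E4 f1 f2 f3 f4 = of_real (1 / (2 * sqrt 2 * pi\<^sup>2)) * rot_average f1 f2 f3 f4"
    by (simp only: quartic_identity_def)
qed

section \<open>The operators\<close>

text \<open>Pairing both representatives with their difference gives it norm 0.\<close>

lemma represents_unique:
  assumes "represents h \<Phi>" "represents k \<Phi>"
  shows "AE x in lborel. h x = k x"
proof -
  have hk: "h \<in> L2" "k \<in> L2" using assms by (auto simp: represents_def)
  have d: "(\<lambda>x. 1 * h x + - 1 * k x) \<in> L2" using hk by (rule L2_lincomb)
  have "L2_inner (\<lambda>x. 1 * h x + - 1 * k x) (\<lambda>x. 1 * h x + - 1 * k x) = 0"
    by (subst L2_inner_lincomb[OF hk d]) (use assms d in \<open>simp add: represents_def\<close>)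
  moreover have "L2_inner (\<lambda>x. 1 * h x + - 1 * k x) (\<lambda>x. 1 * h x + - 1 * k x) = of_real (sqn (\<lambda>x. 1 * h x + - 1 * k x))"
    unfolding L2_inner_def complex_norm_square[symmetric] by (rule integral_complex_of_real)
  ultimately have "sqn (\<lambda>x. 1 * h x + - 1 * k x) = 0" by (metis of_real_eq_0_iff)
  from integral_square_zero_AE[OF d[unfolded L2_eq_Lsp] this] show ?thesis by simp
qed

lemma represents_by_duality: "represents h \<Phi> \<Longrightarrow> represents (by_duality \<Phi>) \<Phi>"
  unfolding by_duality_def by (rule someI[where P = "\<lambda>h. represents h \<Phi>"])

section \<open>An explicit kernel for the operators\<close>

text \<open>The density without the factor of g, integrated over the first two coordinates with the
  third, the argument of g, fixed at c. It is a representative of the operator chosen measurably in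
  \<theta> and c together.\<close>

definition T_kernel :: "(real \<Rightarrow> complex) \<Rightarrow> (real \<Rightarrow> complex) \<Rightarrow> (real \<Rightarrow> complex) \<Rightarrow> real \<Rightarrow> real \<Rightarrow> complex" where
  "T_kernel f1 f2 f3 \<theta> c =
     (LINT y|lborel. tensor3 gaussian f1 f2 (S_rot \<theta> (vec3 (c, y))) * cnj (gaussian (fst y) * f3 (snd y)))"

lemma T_kernel_measurable:
  assumes f: "f1 \<in> L2" "f2 \<in> L2" "f3 \<in> L2"
  shows "joint (T_kernel f1 f2 f3) \<in> borel_measurable (borel \<Otimes>\<^sub>M borel)"
proof -
  note [measurable] = f[THEN L2_borel] gaussian_L2[THEN L2_borel]
  let ?N = "(borel \<Otimes>\<^sub>M borel) \<Otimes>\<^sub>M (borel \<Otimes>\<^sub>M borel) :: ((real \<times> real) \<times> real \<times> real) measure"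
  have v: "(\<lambda>p. vec3 (snd (fst p), snd p)) \<in> borel_measurable ?N"
  proof (rule measurable_compose[OF _ vec3_measurable])
    have "(\<lambda>p. (snd (fst p), snd p)) \<in> measurable ?N (borel \<Otimes>\<^sub>M (borel \<Otimes>\<^sub>M borel))" by measurable
    then show "(\<lambda>p. (snd (fst p), snd p)) \<in> borel_measurable ?N" by (simp add: borel_prod)
  qed
  have "(\<lambda>p. fst (fst p)) \<in> borel_measurable ?N" by measurable
  note measurable_Pair[OF this v]
  from measurable_compose[OF this S_rot_nth_measurable]
  have S: "(\<lambda>p. S_rot (fst (fst p)) (vec3 (snd (fst p), snd p)) $ i) \<in> borel_measurable ?N" for i
    by simp
  have "(\<lambda>p. tensor3 gaussian f1 f2 (S_rot (fst (fst p)) (vec3 (snd (fst p), snd p))) * cnj (gaussian (fst (snd p)) * f3 (snd (snd p))))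
      \<in> borel_measurable ?N"
    unfolding tensor3_def
  proof (intro borel_measurable_times borel_measurable_cnj)
    show "(\<lambda>p. gaussian (S_rot (fst (fst p)) (vec3 (snd (fst p), snd p)) $ 1)) \<in> borel_measurable ?N"
      "(\<lambda>p. f1 (S_rot (fst (fst p)) (vec3 (snd (fst p), snd p)) $ 2)) \<in> borel_measurable ?N"
      "(\<lambda>p. f2 (S_rot (fst (fst p)) (vec3 (snd (fst p), snd p)) $ 3)) \<in> borel_measurable ?N"
      by (rule measurable_compose[OF S L2_borel], rule gaussian_L2 f)+
    show "(\<lambda>p. gaussian (fst (snd p))) \<in> borel_measurable ?N" "(\<lambda>p. f3 (snd (snd p))) \<in> borel_measurable ?N"
      by measurable
  qed
  moreover have "sets ?N = sets (((borel :: real measure) \<Otimes>\<^sub>M (borel :: real measure)) \<Otimes>\<^sub>M (lborel :: (real \<times> real) measure))"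
    by (rule sets_pair_measure_cong[OF refl], subst borel_prod, simp)
  ultimately have "(\<lambda>(p, y). tensor3 gaussian f1 f2 (S_rot (fst p) (vec3 (snd p, y))) * cnj (gaussian (fst y) * f3 (snd y)))
      \<in> borel_measurable ((borel \<Otimes>\<^sub>M borel) \<Otimes>\<^sub>M (lborel :: (real \<times> real) measure))"
    by (simp add: split_beta' cong: measurable_cong_sets)
  then show ?thesis unfolding T_kernel_def by (rule lborel.borel_measurable_lebesgue_integral)
qed

text \<open>Cauchy-Schwarz in y for each fixed c; integration over c then reassembles the rotated
  tensor product on R^3, whose norm is free of \<theta>. Nonnegative integrals make sense before any
  integrability is known.\<close>

lemma integral_square_T_kernel:
  assumes f: "f1 \<in> L2" "f2 \<in> L2" "f3 \<in> L2"
  shows "(\<integral>\<^sup>+c. ennreal ((cmod (T_kernel f1 f2 f3 \<theta> c))\<^sup>2) \<partial>lborel) \<le> ennreal ((sqn gaussian * sqn f1 * sqn f2) * (sqn gaussian * sqn f3))"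
proof -
  note [measurable] = f[THEN L2_borel] gaussian_L2[THEN L2_borel]
  let ?F = "\<lambda>x. tensor3 gaussian f1 f2 (S_rot \<theta> x)"
  let ?g = "\<lambda>y. cnj (gaussian (fst y) * f3 (snd y))"
  have [measurable]: "(\<lambda>x. ?F x) \<in> borel_measurable borel" by measurable
  have "?g \<in> borel_measurable (borel \<Otimes>\<^sub>M borel)" by measurable
  then have [measurable]: "?g \<in> borel_measurable borel" by (simp add: borel_prod)
  have FL: "(\<lambda>x. ?F x) \<in> Lsp 2 lborel" and Fn: "(LINT x|lborel. (cmod (?F x))\<^sup>2) = sqn gaussian * sqn f1 * sqn f2"
    using L2_S_rot[OF tensor3_L2(1)[OF gaussian_L2 f(1,2)], of \<theta>] tensor3_L2(2)[OF gaussian_L2 f(1,2)] by auto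
  have gi: "(\<integral>\<^sup>+y. ennreal ((cmod (?g y))\<^sup>2) \<partial>lborel) = ennreal (sqn gaussian * sqn f3)"
  proof -
    have "(\<integral>\<^sup>+y. ennreal ((cmod (?g y))\<^sup>2) \<partial>lborel) = (\<integral>\<^sup>+y. ennreal ((cmod (gaussian (fst y)))\<^sup>2) * ennreal ((cmod (f3 (snd y)))\<^sup>2) \<partial>(lborel \<Otimes>\<^sub>M lborel))"
      by (simp add: norm_mult power_mult_distrib ennreal_mult lborel_prod)
    also have "\<dots> = (\<integral>\<^sup>+a. \<integral>\<^sup>+b. ennreal ((cmod (gaussian a))\<^sup>2) * ennreal ((cmod (f3 b))\<^sup>2) \<partial>lborel \<partial>lborel)"
      by (subst lborel.nn_integral_fst[symmetric]) simp_all
    also have "\<dots> = ennreal (sqn gaussian * sqn f3)"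
      by (simp add: nn_integral_cmult nn_integral_multc nn_integral_L2 gaussian_L2 f ennreal_mult)
    finally show ?thesis .
  qed
  have pw: "ennreal ((cmod (T_kernel f1 f2 f3 \<theta> c))\<^sup>2) \<le>
      (\<integral>\<^sup>+y. ennreal ((cmod (?F (vec3 (c, y))))\<^sup>2) \<partial>lborel) * ennreal (sqn gaussian * sqn f3)" for c
  proof -
    have [measurable]: "(\<lambda>y. ?F (vec3 (c, y))) \<in> borel_measurable borel"
      by measurable
    have "ennreal ((cmod (T_kernel f1 f2 f3 \<theta> c))\<^sup>2) = (ennreal (cmod (T_kernel f1 f2 f3 \<theta> c)))\<^sup>2"
      by (simp add: ennreal_power)
    also have "ennreal (cmod (T_kernel f1 f2 f3 \<theta> c)) \<le> (\<integral>\<^sup>+y. ennreal (cmod (?F (vec3 (c, y)) * ?g y)) \<partial>lborel)"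
    \<comment> \<open>Where the inner integrand is not integrable, its Bochner integral is 0 by
      convention and the estimate is trivial.\<close>
    proof (cases "integrable lborel (\<lambda>y. ?F (vec3 (c, y)) * ?g y)")
      case True
      then show ?thesis unfolding T_kernel_def by (rule integral_norm_bound_ennreal)
    qed (simp add: T_kernel_def not_integrable_integral_eq)
    also have "\<dots> = (\<integral>\<^sup>+y. ennreal (cmod (?F (vec3 (c, y)))) * ennreal (cmod (?g y)) \<partial>lborel)"
      by (simp add: norm_mult ennreal_mult)
    also have "\<dots>\<^sup>2 \<le> (\<integral>\<^sup>+y. (ennreal (cmod (?F (vec3 (c, y)))))\<^sup>2 \<partial>lborel) * (\<integral>\<^sup>+y. (ennreal (cmod (?g y)))\<^sup>2 \<partial>lborel)"
      by (rule Cauchy_Schwarz_nn_integral) measurable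
    also have "\<dots> = (\<integral>\<^sup>+y. ennreal ((cmod (?F (vec3 (c, y))))\<^sup>2) \<partial>lborel) * ennreal (sqn gaussian * sqn f3)"
      by (simp only: ennreal_power norm_ge_zero gi)
    finally show ?thesis by (simp add: power_mono)
  qed
  have "(\<integral>\<^sup>+c. ennreal ((cmod (T_kernel f1 f2 f3 \<theta> c))\<^sup>2) \<partial>lborel) \<le>
     (\<integral>\<^sup>+c. (\<integral>\<^sup>+y. ennreal ((cmod (?F (vec3 (c, y))))\<^sup>2) \<partial>lborel) * ennreal (sqn gaussian * sqn f3) \<partial>lborel)"
    by (intro nn_integral_mono pw)
  also have "\<dots> = (\<integral>\<^sup>+c. \<integral>\<^sup>+y. ennreal ((cmod (?F (vec3 (c, y))))\<^sup>2) \<partial>lborel \<partial>lborel) * ennreal (sqn gaussian * sqn f3)"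
    by (rule nn_integral_multc) measurable
  also have "(\<integral>\<^sup>+c. \<integral>\<^sup>+y. ennreal ((cmod (?F (vec3 (c, y))))\<^sup>2) \<partial>lborel \<partial>lborel) = (\<integral>\<^sup>+x. ennreal ((cmod (?F x))\<^sup>2) \<partial>lborel)"
  proof -
    have "(\<integral>\<^sup>+x. ennreal ((cmod (?F x))\<^sup>2) \<partial>lborel) = (\<integral>\<^sup>+p. ennreal ((cmod (?F (vec3 p)))\<^sup>2) \<partial>(lborel \<Otimes>\<^sub>M lborel))"
      by (subst distr_vec3[symmetric], subst nn_integral_distr) (simp_all add: lborel_prod)
    then show ?thesis by (subst (asm) lborel.nn_integral_fst[symmetric]) (simp_all add: lborel_prod)
  qed
  also have "\<dots> = ennreal (sqn gaussian * sqn f1 * sqn f2)"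
    using FL Fn by (simp add: Lsp_def nn_integral_eq_integral)
  finally show ?thesis by (simp add: ennreal_mult)
qed

lemma T_kernel_section_measurable:
  assumes f: "f1 \<in> L2" "f2 \<in> L2" "f3 \<in> L2"
  shows "T_kernel f1 f2 f3 \<theta> \<in> borel_measurable borel"
  using measurable_compose[OF measurable_Pair1' T_kernel_measurable[OF f], of \<theta>] by simp

lemma T_kernel_L2:
  assumes f: "f1 \<in> L2" "f2 \<in> L2" "f3 \<in> L2"
  shows "T_kernel f1 f2 f3 \<theta> \<in> L2"
proof -
  note [measurable] = T_kernel_section_measurable[OF f, of \<theta>]
  have "integrable lborel (\<lambda>c. (cmod (T_kernel f1 f2 f3 \<theta> c))\<^sup>2)"
    by (rule integrableI_nonneg)
      (use le_less_trans[OF integral_square_T_kernel[OF f, of \<theta>] ennreal_less_top] in auto)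
  then show ?thesis by (simp add: L2_def)
qed

lemma L2_inner_T_kernel:
  assumes f: "f1 \<in> L2" "f2 \<in> L2" "f3 \<in> L2" and g: "g \<in> L2"
  shows "L2_inner (T_kernel f1 f2 f3 \<theta>) g = E_iso (S_rot \<theta>) gaussian f1 f2 gaussian f3 g"
proof -
  let ?D = "E_density (S_rot \<theta>) gaussian f1 f2 gaussian f3 g"
  have i: "integrable lborel ?D" by (intro integrable_E_density gaussian_L2 f g)
  have "integrable lborel (\<lambda>p. ?D (vec3 p))"
    using integrable_distr_eq[of vec3 lborel borel ?D] i borel_measurable_integrable[OF i] by (simp add: distr_vec3)
  then have ip: "integrable (lborel \<Otimes>\<^sub>M lborel) (\<lambda>p. ?D (vec3 p))" by (simp add: lborel_prod)
  have "E_iso (S_rot \<theta>) gaussian f1 f2 gaussian f3 g = (LINT p|lborel. ?D (vec3 p))"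
    unfolding E_iso_def using borel_measurable_integrable[OF i] by (intro integral_real3) simp
  also have "\<dots> = (LINT p|(lborel \<Otimes>\<^sub>M lborel). ?D (vec3 p))" by (simp add: lborel_prod)
  also have "\<dots> = (LINT c|lborel. LINT y|lborel. ?D (vec3 (c, y)))"
    by (rule lborel_pair.integral_fst'[OF ip, symmetric])
  also have "\<dots> = (LINT c|lborel. LINT y|lborel. tensor3 gaussian f1 f2 (S_rot \<theta> (vec3 (c, y))) * cnj (gaussian (fst y) * f3 (snd y)) * cnj (g c))"
    by (simp add: E_density_eq tensor3_def vec3_def mult_ac)
  also have "\<dots> = L2_inner (T_kernel f1 f2 f3 \<theta>) g"
    unfolding L2_inner_def T_kernel_def integral_mult_left_zero ..
  finally show ?thesis ..
qed

lemma represents_T_kernel: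
  assumes "f1 \<in> L2" "f2 \<in> L2" "f3 \<in> L2"
  shows "represents (T_kernel f1 f2 f3 \<theta>) (\<lambda>g. E_iso (S_rot \<theta>) gaussian f1 f2 gaussian f3 g)"
  using assms by (simp add: represents_def T_kernel_L2 L2_inner_T_kernel)

lemma T_iso_represents:
  assumes "f1 \<in> L2" "f2 \<in> L2" "f3 \<in> L2"
  shows "represents (T_iso (S_rot \<theta>) gaussian f1 f2 gaussian f3) (\<lambda>g. E_iso (S_rot \<theta>) gaussian f1 f2 gaussian f3 g)"
  unfolding T_iso_def by (rule represents_by_duality[OF represents_T_kernel[OF assms]])

lemma T_iso_eq_T_kernel:
  assumes "f1 \<in> L2" "f2 \<in> L2" "f3 \<in> L2"
  shows "AE x in lborel. T_iso (S_rot \<theta>) gaussian f1 f2 gaussian f3 x = T_kernel f1 f2 f3 \<theta> x"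
  by (rule represents_unique[OF T_iso_represents represents_T_kernel]) fact+

lemma T_kernel_Lsp2:
  assumes f: "f1 \<in> L2" "f2 \<in> L2" "f3 \<in> L2"
  shows "joint (T_kernel f1 f2 f3) \<in> Lsp 2 (circle \<Otimes>\<^sub>M lborel)"
proof -
  note m = Icc_line_measurable[OF T_kernel_measurable[OF f], of 0 "2 * pi"]
  note [measurable] = m
  have "(\<integral>\<^sup>+p. ennreal ((cmod (T_kernel f1 f2 f3 (fst p) (snd p)))\<^sup>2) \<partial>(circle \<Otimes>\<^sub>M lborel)) =
     (\<integral>\<^sup>+\<theta>. \<integral>\<^sup>+c. ennreal ((cmod (T_kernel f1 f2 f3 \<theta> c))\<^sup>2) \<partial>lborel \<partial>circle)"
    by (subst lborel.nn_integral_fst[symmetric]) simp_all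
  also have "\<dots> \<le> (\<integral>\<^sup>+\<theta>. ennreal ((sqn gaussian * sqn f1 * sqn f2) * (sqn gaussian * sqn f3)) \<partial>circle)"
    by (intro nn_integral_mono integral_square_T_kernel f)
  also have "\<dots> < \<infinity>"
    by (simp add: emeasure_restrict_space space_restrict_space ennreal_mult_less_top)
  finally have "integrable (circle \<Otimes>\<^sub>M lborel) (\<lambda>p. (cmod (T_kernel f1 f2 f3 (fst p) (snd p)))\<^sup>2)"
    by (intro integrableI_nonneg) auto
  then show ?thesis using m by (simp add: Lsp_def)
qed

lemma T_kernel_AE_Lsp2:
  assumes f: "f1 \<in> L2" "f2 \<in> L2" "f3 \<in> L2"
  shows "AE x in lborel. (\<lambda>\<theta>. T_kernel f1 f2 f3 \<theta> x) \<in> Lsp 2 circle"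
proof -
  have "AE x in lborel. integrable circle (\<lambda>\<theta>. (cmod (T_kernel f1 f2 f3 \<theta> x))\<^sup>2)"
    using Icc_line.AE_integrable_snd[of 0 "2 * pi" "\<lambda>\<theta> x. (cmod (T_kernel f1 f2 f3 \<theta> x))\<^sup>2"] Lsp_integrable[OF T_kernel_Lsp2[OF f]]
    by (simp add: split_beta')
  moreover have "(\<lambda>\<theta>. T_kernel f1 f2 f3 \<theta> x) \<in> borel_measurable circle" for x
    using measurable_compose[OF measurable_Pair2' T_kernel_measurable[OF f], of x] by (intro measurable_restrict_Icc) simp
  ultimately show ?thesis by (auto simp: Lsp_def)
qed

section \<open>Averages of the kernel over the angle\<close>

definition T_average :: "(real \<Rightarrow> complex) \<Rightarrow> (real \<Rightarrow> complex) \<Rightarrow> (real \<Rightarrow> complex) \<Rightarrow> real \<Rightarrow> complex" where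
  "T_average f1 f2 f3 x = (LINT \<theta>|circle. T_kernel f1 f2 f3 \<theta> x)"

text \<open>Pairing with 1 turns square integrability on a finite interval into integrability, and
  Cauchy-Schwarz against 1 bounds the average; on the circle its squared norm is 2 pi.\<close>

lemma const_Lsp2: "(\<lambda>_. 1) \<in> Lsp 2 (restrict_space lborel {a..b::real})"
  by (simp add: Lsp_def)

lemma T_average_L2:
  assumes f: "f1 \<in> L2" "f2 \<in> L2" "f3 \<in> L2"
  shows "T_average f1 f2 f3 \<in> L2"
proof -
  note m = Icc_line_measurable[OF T_kernel_measurable[OF f], of 0 "2 * pi"]
  have "(\<lambda>(x, \<theta>). T_kernel f1 f2 f3 \<theta> x) \<in> borel_measurable (lborel \<Otimes>\<^sub>M circle)"
    using measurable_pair_swap[OF m] by (simp add: split_beta')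
  then have m1: "T_average f1 f2 f3 \<in> borel_measurable lborel"
    unfolding T_average_def[abs_def] by (rule Icc.borel_measurable_lebesgue_integral)
  have "integrable lborel (\<lambda>x. LINT \<theta>|circle. (cmod (T_kernel f1 f2 f3 \<theta> x))\<^sup>2)"
    using Icc_line.integrable_snd[of 0 "2 * pi" "\<lambda>\<theta> x. (cmod (T_kernel f1 f2 f3 \<theta> x))\<^sup>2"] Lsp_integrable[OF T_kernel_Lsp2[OF f]]
    by (simp add: split_beta')
  then have "integrable lborel (\<lambda>x. (LINT \<theta>|circle. (cmod (T_kernel f1 f2 f3 \<theta> x))\<^sup>2) * (2 * pi))"
    by (rule integrable_mult_left)
  then have "integrable lborel (\<lambda>x. (cmod (T_average f1 f2 f3 x))\<^sup>2)"
  proof (rule Bochner_Integration.integrable_bound)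
    show "(\<lambda>x. (cmod (T_average f1 f2 f3 x))\<^sup>2) \<in> borel_measurable lborel" using m1 by measurable
    show "AE x in lborel. norm ((cmod (T_average f1 f2 f3 x))\<^sup>2) \<le> norm ((LINT \<theta>|circle. (cmod (T_kernel f1 f2 f3 \<theta> x))\<^sup>2) * (2 * pi))"
      using T_kernel_AE_Lsp2[OF f]
    proof eventually_elim
      case (elim x)
      show ?case using Cauchy_Schwarz_Lsp[OF elim const_Lsp2] by (simp add: T_average_def measure_restrict_space)
    qed
  qed
  with m1 show ?thesis by (simp add: L2_def)
qed

text \<open>The integrals over \<theta> and x may be exchanged because the kernel and g, extended
  constantly in \<theta>, are both square integrable on circle times line.\<close>

lemma L2_inner_T_average:
  assumes f: "f1 \<in> L2" "f2 \<in> L2" "f3 \<in> L2" and g: "g \<in> L2"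
  shows "L2_inner (T_average f1 f2 f3) g = rot_average f1 f2 f3 g"
proof -
  note [measurable] = L2_borel[OF g]
  have mg: "(\<lambda>p::real \<times> real. g (snd p)) \<in> borel_measurable (circle \<Otimes>\<^sub>M lborel)"
    by (rule Icc_line_measurable) measurable
  have "integrable (circle \<Otimes>\<^sub>M lborel) (\<lambda>p. (cmod (g (snd p)))\<^sup>2)"
    by (rule Icc_line.Fubini_integrable) (use g mg in \<open>auto simp: L2_def\<close>)
  then have gL: "(\<lambda>p. g (snd p)) \<in> Lsp 2 (circle \<Otimes>\<^sub>M lborel)" using mg by (simp add: Lsp_def)
  have i: "integrable (circle \<Otimes>\<^sub>M lborel) (\<lambda>(\<theta>, x). T_kernel f1 f2 f3 \<theta> x * cnj (g x))"
    using integrable_mult_L2[OF T_kernel_Lsp2[OF f] Lsp_cnj[OF gL]] by (simp add: split_beta')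
  have "L2_inner (T_average f1 f2 f3) g = (LINT x|lborel. LINT \<theta>|circle. T_kernel f1 f2 f3 \<theta> x * cnj (g x))"
    unfolding L2_inner_def T_average_def integral_mult_left_zero ..
  also have "\<dots> = (LINT \<theta>|circle. LINT x|lborel. T_kernel f1 f2 f3 \<theta> x * cnj (g x))"
    by (rule Icc_line.Fubini_integral[OF i])
  also have "\<dots> = (LINT \<theta>|circle. E_iso (S_rot \<theta>) gaussian f1 f2 gaussian f3 g)"
    unfolding L2_inner_def[symmetric] L2_inner_T_kernel[OF f g] ..
  finally show ?thesis by (simp add: rot_average_def set_lebesgue_integral_restrict)
qed

lemma represents_T4:
  assumes f: "f1 \<in> L2" "f2 \<in> L2" "f3 \<in> L2"
  shows "represents (\<lambda>x. of_real (sqrt 2 / pi\<^sup>2) * T_average f1 f2 f3 x) (\<lambda>g. 4 * E4 f1 f2 f3 g)"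
  unfolding represents_def
proof (intro conjI ballI)
  show "(\<lambda>x. of_real (sqrt 2 / pi\<^sup>2) * T_average f1 f2 f3 x) \<in> L2"
    using T_average_L2[OF f] unfolding L2_eq_Lsp by (rule Lsp_scale)
  fix g assume g: "g \<in> L2"
  \<comment> \<open>The factor 4 in the definition of the operator turns the constant of the first
    representation into that of the second.\<close>
  have "4 * (1 / (2 * sqrt 2 * pi\<^sup>2)) = sqrt 2 / pi\<^sup>2"
    by (simp add: field_simps)
  then have c: "4 * complex_of_real (1 / (2 * sqrt 2 * pi\<^sup>2)) = of_real (sqrt 2 / pi\<^sup>2)"
    by (metis of_real_mult of_real_numeral)
  have "L2_inner (\<lambda>x. of_real (sqrt 2 / pi\<^sup>2) * T_average f1 f2 f3 x) g = of_real (sqrt 2 / pi\<^sup>2) * rot_average f1 f2 f3 g"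
    unfolding L2_inner_T_average[OF f g, symmetric] L2_inner_def mult.assoc by (rule integral_mult_right_zero)
  then show "L2_inner (\<lambda>x. of_real (sqrt 2 / pi\<^sup>2) * T_average f1 f2 f3 x) g = 4 * E4 f1 f2 f3 g"
    unfolding E4_identity(2)[OF f g] mult.assoc[symmetric] c .
qed

text \<open>Agreement at almost every x for each \<theta> becomes agreement at almost every \<theta>
  for almost every x; joint measurability is what lets the quantifiers be exchanged. Hence every
  admissible choice of representatives has the same average.\<close>

lemma measurable_version_T_average:
  assumes f: "f1 \<in> L2" "f2 \<in> L2" "f3 \<in> L2"
    and K: "measurable_version {0..2*pi} (\<lambda>\<theta>. T_iso (S_rot \<theta>) gaussian f1 f2 gaussian f3) K"
  shows "AE x in lborel. set_integrable lborel {0..2*pi} (\<lambda>\<theta>. K \<theta> x) \<and> (LINT \<theta>:{0..2*pi}|lborel. K \<theta> x) = T_average f1 f2 f3 x"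
proof -
  have mK: "joint K \<in> borel_measurable (borel \<Otimes>\<^sub>M borel)"
    using K by (simp add: measurable_version_def split_beta' cong: measurable_cong_sets)
  note m = Icc_line_measurable[OF mK, of 0 "2 * pi"] Icc_line_measurable[OF T_kernel_measurable[OF f], of 0 "2 * pi"]
  note [measurable] = m
  have "AE \<theta> in circle. AE x in lborel. K \<theta> x = T_kernel f1 f2 f3 \<theta> x"
  proof (rule AE_I2)
    fix \<theta> assume "\<theta> \<in> space circle"
    then have "\<theta> \<in> {0..2*pi}" by (simp add: space_restrict_space)
    then have "AE x in lborel. K \<theta> x = T_iso (S_rot \<theta>) gaussian f1 f2 gaussian f3 x"
      using K by (simp add: measurable_version_def)
    with T_iso_eq_T_kernel[OF f, of \<theta>] show "AE x in lborel. K \<theta> x = T_kernel f1 f2 f3 \<theta> x"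
      by eventually_elim simp
  qed
  then have "AE x in lborel. AE \<theta> in circle. K \<theta> x = T_kernel f1 f2 f3 \<theta> x"
    by (subst (asm) Icc_line.AE_commute) measurable
  with T_kernel_AE_Lsp2[OF f] show ?thesis
  proof eventually_elim
    case (elim x)
    have mx: "(\<lambda>\<theta>. K \<theta> x) \<in> borel_measurable circle" "(\<lambda>\<theta>. T_kernel f1 f2 f3 \<theta> x) \<in> borel_measurable circle"
      using measurable_compose[OF measurable_Pair2' mK, of x] measurable_compose[OF measurable_Pair2' T_kernel_measurable[OF f], of x]
      by (auto intro: measurable_restrict_Icc)
    have "integrable circle (\<lambda>\<theta>. T_kernel f1 f2 f3 \<theta> x)"
      using integrable_mult_L2[OF elim(1) const_Lsp2] by simp
    then have "integrable circle (\<lambda>\<theta>. K \<theta> x)"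
      by (subst integrable_cong_AE[OF mx elim(2)])
    moreover have "(LINT \<theta>|circle. K \<theta> x) = T_average f1 f2 f3 x"
      unfolding T_average_def by (rule integral_cong_AE[OF mx elim(2)])
    ultimately show ?case
      by (simp add: set_lebesgue_integral_restrict set_integrable_def integrable_restrict_space)
  qed
qed

theorem theorem4p4:
  fixes f1 f2 f3 f4 :: "real \<Rightarrow> complex"
  assumes "f1 \<in> L2" and "f2 \<in> L2" and "f3 \<in> L2" and "f4 \<in> L2"
  shows
    \<comment> \<open>first representation, with convergence of the integrals in it\<close>
    "(E4_converges f1 f2 f3 f4 \<and>
      (\<forall>\<theta>. integrable lborel (E_density (S_rot \<theta>) gaussian f1 f2 gaussian f3 f4)) \<and>
      set_integrable lborel {0..2*pi} (\<lambda>\<theta>. E_iso (S_rot \<theta>) gaussian f1 f2 gaussian f3 f4) \<and>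
      E4 f1 f2 f3 f4 = of_real (1 / (2 * sqrt 2 * pi\<^sup>2)) *
        (LINT \<theta>:{0..2*pi}|lborel. E_iso (S_rot \<theta>) gaussian f1 f2 gaussian f3 f4)) \<and>
    \<comment> \<open>second representation, with existence of the operators defined by duality\<close>
     (represents (T4 f1 f2 f3) (\<lambda>g. 4 * E4 f1 f2 f3 g) \<and>
      (\<forall>\<theta>. represents (T_iso (S_rot \<theta>) gaussian f1 f2 gaussian f3)
             (\<lambda>g. E_iso (S_rot \<theta>) gaussian f1 f2 gaussian f3 g)) \<and>
      (\<exists>K. measurable_version {0..2*pi} (\<lambda>\<theta>. T_iso (S_rot \<theta>) gaussian f1 f2 gaussian f3) K) \<and>
      (\<forall>K. measurable_version {0..2*pi} (\<lambda>\<theta>. T_iso (S_rot \<theta>) gaussian f1 f2 gaussian f3) K \<longrightarrow>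
         (AE x in lborel. set_integrable lborel {0..2*pi} (\<lambda>\<theta>. K \<theta> x) \<and>
            T4 f1 f2 f3 x = of_real (sqrt 2 / pi\<^sup>2) * (LINT \<theta>:{0..2*pi}|lborel. K \<theta> x))))"
proof (intro conjI allI impI)
  note f = assms(1-3) and all = assms
  show "E4_converges f1 f2 f3 f4" by (rule E4_identity(1)[OF all])
  show "integrable lborel (E_density (S_rot \<theta>) gaussian f1 f2 gaussian f3 f4)" for \<theta>
    by (intro integrable_E_density gaussian_L2 all)
  show "set_integrable lborel {0..2*pi} (\<lambda>\<theta>. E_iso (S_rot \<theta>) gaussian f1 f2 gaussian f3 f4)"
    by (intro set_integrable_E_iso gaussian_L2 all)
  show "E4 f1 f2 f3 f4 = of_real (1 / (2 * sqrt 2 * pi\<^sup>2)) *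
        (LINT \<theta>:{0..2*pi}|lborel. E_iso (S_rot \<theta>) gaussian f1 f2 gaussian f3 f4)"
    unfolding rot_average_def[symmetric] by (rule E4_identity(2)[OF all])
  show T4: "represents (T4 f1 f2 f3) (\<lambda>g. 4 * E4 f1 f2 f3 g)"
    unfolding T4_def by (rule represents_by_duality[OF represents_T4[OF f]])
  show "represents (T_iso (S_rot \<theta>) gaussian f1 f2 gaussian f3) (\<lambda>g. E_iso (S_rot \<theta>) gaussian f1 f2 gaussian f3 g)" for \<theta>
    by (rule T_iso_represents[OF f])
  \<comment> \<open>The explicit kernel is the witness: it is jointly measurable and, by uniqueness
    of representatives, equals the operator almost everywhere at each angle.\<close>
  have "measurable_version {0..2*pi} (\<lambda>\<theta>. T_iso (S_rot \<theta>) gaussian f1 f2 gaussian f3) (T_kernel f1 f2 f3)"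
    unfolding measurable_version_def
  proof (intro conjI ballI)
    show "(\<lambda>(\<theta>, x). T_kernel f1 f2 f3 \<theta> x) \<in> borel_measurable (lborel \<Otimes>\<^sub>M lborel)"
      using T_kernel_measurable[OF f] by (simp add: split_beta' cong: measurable_cong_sets)
    show "AE x in lborel. T_kernel f1 f2 f3 \<theta> x = T_iso (S_rot \<theta>) gaussian f1 f2 gaussian f3 x" for \<theta>
      using T_iso_eq_T_kernel[OF f, of \<theta>] by eventually_elim simp
  qed
  then show "\<exists>K. measurable_version {0..2*pi} (\<lambda>\<theta>. T_iso (S_rot \<theta>) gaussian f1 f2 gaussian f3) K"
    by (rule exI[of _ "T_kernel f1 f2 f3"])
  fix K assume K: "measurable_version {0..2*pi} (\<lambda>\<theta>. T_iso (S_rot \<theta>) gaussian f1 f2 gaussian f3) K"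
  show "AE x in lborel. set_integrable lborel {0..2*pi} (\<lambda>\<theta>. K \<theta> x) \<and>
            T4 f1 f2 f3 x = of_real (sqrt 2 / pi\<^sup>2) * (LINT \<theta>:{0..2*pi}|lborel. K \<theta> x)"
    using measurable_version_T_average[OF f K] represents_unique[OF T4 represents_T4[OF f]]
    by eventually_elim simp
qed

end
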